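(* Let $\mu_1,\mu_2$ be an Angelesco system on $[a_1,b_1]$, $[a_2,b_2]$. Suppose that $\mu_1'>0$ almost everywhere on $[a_1,b_1]$, $\mu_2'>0$ almost everywhere on $[a_2,b_2]$, and $b_1<a_2$. Then $$\lim_{n\to\infty}\bigl|\lambda_{n+j,2n}^{(1)}\bigr|^{1/n}=\exp\bigl(2U(x;\nu_1)+U(x;\nu_2)-\ell_1\bigr)$$ whenever $j=j_n\in\{1,\dots,n\}$ is such that $x_{n+j,2n}\to x\in[a^*,b_2]$ as $n\to\infty$.
   Context: Setting: $-\infty<a_1<b_1\le a_2<b_2<\infty$, and $\mu_1,\mu_2$ are finite positive Borel measures with $\mathrm{supp}(\mu_j)\subset[a_j,b_j]$ (an Angelesco system); $\mu_j'$ denotes the density of the absolutely continuous part of $\mu_j$ with respect to Lebesgue measure. For $n\ge1$, $P_{n,n}$ is the (unique) monic polynomial of degree $2n$ with $\int P_{n,n}(x)x^k\,d\mu_j(x)=0$ for $0\le k\le n-1$ and $j=1,2$. It is known that $P_{n,n}$ has $n$ simple zeros in $(a_1,b_1)$ and $n$ simple zeros in $(a_2,b_2)$; they are denoted in increasing order $x_{1,2n}<\dots<x_{n,2n}$ (in $(a_1,b_1)$) and $x_{n+1,2n}<\dots<x_{2n,2n}$ (in $(a_2,b_2)$). The quadrature weights are $\lambda_{k,2n}^{(j)}=\int \ell_{k,2n}(x)\,d\mu_j(x)$, $1\le k\le 2n$, $j=1,2$, where $\ell_{k,2n}$ is the polynomial of degree at most $2n-1$ with $\ell_{k,2n}(x_{i,2n})=\delta_{i,k}$.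 Consequently $\sum_{k=1}^{2n}\lambda_{k,2n}^{(j)}P(x_{k,2n})=\int P\,d\mu_j$ for every polynomial $P$ of degree at most $3n-1$. Vector equilibrium problem: $(\nu_1,\nu_2)$ is the unique minimizer of $I(\nu_1,\nu_1)+I(\nu_2,\nu_2)+I(\nu_1,\nu_2)$ over all probability measures $\nu_1$ on $[a_1,b_1]$ and $\nu_2$ on $[a_2,b_2]$, where $I(\nu_i,\nu_j)=\iint\log\frac1{|x-y|}\,d\nu_j(x)\,d\nu_i(y)$. It is known that $\mathrm{supp}(\nu_1)=[a_1,b^*]$ with $b^*\le b_1$ and $\mathrm{supp}(\nu_2)=[a^*,b_2]$ with $a^*\ge a_2$. With $U(x;\nu)=\int\log\frac1{|x-y|}\,d\nu(y)$, the minimizer is characterized by constants $\ell_1,\ell_2$ such that $2U(x;\nu_1)+U(x;\nu_2)=\ell_1$ on $[a_1,b^*]$ and $>\ell_1$ on $(b^*,b_1]$, and $U(x;\nu_1)+2U(x;\nu_2)=\ell_2$ on $[a^*,b_2]$ and $>\ell_2$ on $[a_2,a^* )$. *)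

theory Defs
  imports "HOL-Analysis.Analysis" "HOL-Probability.Probability_Measure"
    "HOL-Computational_Algebra.Polynomial"
begin

section \<open>Measures on the real line\<close>

definition supp :: "real measure \<Rightarrow> real set" where
  "supp M = {x. \<forall>U. open U \<longrightarrow> x \<in> U \<longrightarrow> 0 < emeasure M U}"

text \<open>\<open>w\<close> is a version of the density \<open>M'\<close> of the absolutely continuous part in the Lebesgue
  decomposition \<open>M = w dx + S\<close>, where \<open>S\<close> is carried by a Lebesgue null set.\<close>

definition ac_density :: "real measure \<Rightarrow> (real \<Rightarrow> real) \<Rightarrow> bool" where
  "ac_density M w \<longleftrightarrow>
     w \<in> borel_measurable borel \<and> (\<forall>x. 0 \<le> w x) \<and>
     (\<exists>S. sets S = sets borel \<and>
          (\<exists>N \<in> null_sets lborel. emeasure S (UNIV - N) = 0) \<and>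
          (\<forall>A \<in> sets borel. emeasure M A = emeasure (density lborel (\<lambda>x. ennreal (w x))) A + emeasure S A))"

definition angelesco ::
  "real \<Rightarrow> real \<Rightarrow> real \<Rightarrow> real \<Rightarrow> real measure \<Rightarrow> real measure \<Rightarrow> bool" where
  "angelesco a\<^sub>1 b\<^sub>1 a\<^sub>2 b\<^sub>2 \<mu>\<^sub>1 \<mu>\<^sub>2 \<longleftrightarrow>
     a\<^sub>1 < b\<^sub>1 \<and> b\<^sub>1 \<le> a\<^sub>2 \<and> a\<^sub>2 < b\<^sub>2 \<and>
     finite_measure \<mu>\<^sub>1 \<and> sets \<mu>\<^sub>1 = sets borel \<and> supp \<mu>\<^sub>1 \<subseteq> {a\<^sub>1..b\<^sub>1} \<and>
     finite_measure \<mu>\<^sub>2 \<and> sets \<mu>\<^sub>2 = sets borel \<and> supp \<mu>\<^sub>2 \<subseteq> {a\<^sub>2..b\<^sub>2}"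


section \<open>Multiple orthogonal polynomials and quadrature weights\<close>

text \<open>The diagonal multiple orthogonal polynomial \<open>P\<^bsub>n,n\<^esub>\<close>.\<close>

definition mop :: "real measure \<Rightarrow> real measure \<Rightarrow> nat \<Rightarrow> real poly" where
  "mop \<mu>\<^sub>1 \<mu>\<^sub>2 n = (THE p. degree p = 2 * n \<and> lead_coeff p = 1 \<and>
     (\<forall>k<n. (LINT x|\<mu>\<^sub>1. poly p x * x ^ k) = 0 \<and> (LINT x|\<mu>\<^sub>2. poly p x * x ^ k) = 0))"

text \<open>\<open>mop_zero \<mu>\<^sub>1 \<mu>\<^sub>2 n k\<close> is \<open>x\<^bsub>k,2n\<^esub>\<close> for \<open>1 \<le> k \<le> 2 n\<close>. All zeros are listed in one
  increasing sequence: as \<open>b\<^sub>1 \<le> a\<^sub>2\<close>, the \<open>n\<close> zeros in \<open>(a\<^sub>1, b\<^sub>1)\<close> come first and the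
  \<open>n\<close> zeros in \<open>(a\<^sub>2, b\<^sub>2)\<close> have the indices \<open>n + 1, \<dots>, 2 n\<close>.\<close>

definition mop_zero :: "real measure \<Rightarrow> real measure \<Rightarrow> nat \<Rightarrow> nat \<Rightarrow> real" where
  "mop_zero \<mu>\<^sub>1 \<mu>\<^sub>2 n k = sorted_list_of_set {x. poly (mop \<mu>\<^sub>1 \<mu>\<^sub>2 n) x = 0} ! (k - 1)"

definition lagrange_poly :: "real measure \<Rightarrow> real measure \<Rightarrow> nat \<Rightarrow> nat \<Rightarrow> real poly" where
  "lagrange_poly \<mu>\<^sub>1 \<mu>\<^sub>2 n k = (THE p. degree p \<le> 2 * n - 1 \<and>
     (\<forall>i\<in>{1..2*n}. poly p (mop_zero \<mu>\<^sub>1 \<mu>\<^sub>2 n i) = (if i = k then 1 else 0)))"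

text \<open>The weight \<open>\<lambda>\<^bsub>k,2n\<^esub>\<^bsup>(j)\<^esup>\<close> is obtained by taking \<open>\<mu> = \<mu>\<^sub>j\<close>.\<close>

definition quad_weight ::
  "real measure \<Rightarrow> real measure \<Rightarrow> real measure \<Rightarrow> nat \<Rightarrow> nat \<Rightarrow> real" where
  "quad_weight \<mu>\<^sub>1 \<mu>\<^sub>2 \<mu> n k = (LINT x|\<mu>. poly (lagrange_poly \<mu>\<^sub>1 \<mu>\<^sub>2 n k) x)"


section \<open>Logarithmic potentials and the vector equilibrium problem\<close>

text \<open>Potentials and energies take the value \<open>\<infinity>\<close> (for instance at point masses), so they are
  extended-real integrals, defined as the integral of the positive part minus that of the
  negative part. For compactly supported finite measures the latter is always finite, so
  \<open>\<infinity> - \<infinity>\<close> never occurs.\<close>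

definition ereal_integral :: "real measure \<Rightarrow> (real \<Rightarrow> ereal) \<Rightarrow> ereal" where
  "ereal_integral M f =
     enn2ereal (\<integral>\<^sup>+x. e2ennreal (f x) \<partial>M) - enn2ereal (\<integral>\<^sup>+x. e2ennreal (- f x) \<partial>M)"

text \<open>The case distinction is needed because \<open>ln (1 / 0) = 0\<close> in HOL.\<close>

definition log_kernel :: "real \<Rightarrow> real \<Rightarrow> ereal" where
  "log_kernel x y = (if x = y then \<infinity> else ereal (ln (1 / \<bar>x - y\<bar>)))"

definition log_potential :: "real \<Rightarrow> real measure \<Rightarrow> ereal" where
  "log_potential x \<nu> = ereal_integral \<nu> (\<lambda>y. log_kernel x y)"

definition log_energy :: "real measure \<Rightarrow> real measure \<Rightarrow> ereal" where
  "log_energy \<nu> \<rho> = ereal_integral \<nu> (\<lambda>y. ereal_integral \<rho> (\<lambda>x. log_kernel x y))"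

definition prob_on :: "real \<Rightarrow> real \<Rightarrow> real measure \<Rightarrow> bool" where
  "prob_on a b \<nu> \<longleftrightarrow> prob_space \<nu> \<and> sets \<nu> = sets borel \<and> supp \<nu> \<subseteq> {a..b}"

definition vector_equilibrium ::
  "real \<Rightarrow> real \<Rightarrow> real \<Rightarrow> real \<Rightarrow> real measure \<Rightarrow> real measure \<Rightarrow> bool" where
  "vector_equilibrium a\<^sub>1 b\<^sub>1 a\<^sub>2 b\<^sub>2 \<nu>\<^sub>1 \<nu>\<^sub>2 \<longleftrightarrow>
     prob_on a\<^sub>1 b\<^sub>1 \<nu>\<^sub>1 \<and> prob_on a\<^sub>2 b\<^sub>2 \<nu>\<^sub>2 \<and>
     (\<forall>\<rho>\<^sub>1 \<rho>\<^sub>2. prob_on a\<^sub>1 b\<^sub>1 \<rho>\<^sub>1 \<longrightarrow> prob_on a\<^sub>2 b\<^sub>2 \<rho>\<^sub>2 \<longrightarrow>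
        log_energy \<nu>\<^sub>1 \<nu>\<^sub>1 + log_energy \<nu>\<^sub>2 \<nu>\<^sub>2 + log_energy \<nu>\<^sub>1 \<nu>\<^sub>2
        \<le> log_energy \<rho>\<^sub>1 \<rho>\<^sub>1 + log_energy \<rho>\<^sub>2 \<rho>\<^sub>2 + log_energy \<rho>\<^sub>1 \<rho>\<^sub>2)"

end

theory Submission
  imports Defs "HOL-Probability.Probability" "HOL-Real_Asymp.Real_Asymp"
begin

text \<open>
  Let \<open>p\<close> and \<open>q\<close> be the monic polynomials with the zeros of the multiple orthogonal polynomial in
  the first and in the second interval. For a zero \<open>\<xi>\<close> of \<open>q = (X - \<xi>) q\<^sub>\<xi>\<close>, applying the quadrature rule
  to \<open>p\<^sup>2 q\<^sub>\<xi>\<close> expresses the absolute value of its weight as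
  \<open>(\<integral>p\<^sup>2 \<bar>q\<^sub>\<xi>\<bar> d\<mu>\<^sub>1) / (p(\<xi>)\<^sup>2 \<bar>q\<^sub>\<xi>(\<xi>)\<bar>)\<close>.

  Pass to a subsequence along which the zero distributions converge to \<open>\<alpha>\<close>, \<open>\<beta>\<close> and the normalized
  logarithms of the minimal norms converge, the first one to \<open>m\<close>. Jensen's inequality for the measure with
  positive density gives \<open>2 U(\<alpha>) + U(\<beta>) \<ge> m\<close> on the first interval, while comparison with
  discretized test measures gives equality on the support of \<open>\<alpha>\<close>; likewise for \<open>\<beta>\<close>. Positivity of the
  logarithmic energy shows that these conditions determine the limits, so they are the equilibrium measures
  and constants. It remains to find the limit of \<open>\<bar>q\<^sub>\<xi>(\<xi>)\<bar>\<close>: convergence of the zeros bounds it from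
  above, and the extremal property of the Christoffel function bounds it from below.
\<close>

text \<open>Weak convergence of the zero distributions controls integrals of continuous functions
  only, while the logarithm is singular and potentials may be infinite. Limits are therefore taken
  with the kernel \<open>log_ker e\<close> at a fixed scale \<open>e\<close>: it is Lipschitz and
  increases to -ln as \<open>e\<close> decreases, so monotone convergence and a Dini argument
  recover the potentials. Across the gap between the intervals a short truncation changes nothing.
  The tangent continuation, rather than a constant one, is what results, up to an affine term, from
  mixing the triangle kernels max 0 (r - d) over r \<ge> e; so positivity of the energy holds at
  every scale, by Fubini, without Fourier analysis. The densities are positive only almost
  everywhere and may be tiny near any point. Lower bounds for the norms hence come from averages
  over sets on which the density exceeds some constant, and the constant disappears in the n-th
  root. The delicate factor is the value at the node \<open>\<xi>\<close> of \<open>q\<close>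
  without its factor at \<open>\<xi>\<close>: other zeros might lie extremely close to the node,
  which weak convergence cannot see.\<close>

lemma emeasure_Compl_supp:
  assumes [measurable_cong]: "sets M = sets borel"
  shows "supp M \<in> sets M" "emeasure M (- supp M) = 0"
proof -
  let ?F = "{U. open U \<and> emeasure M U = 0}"
  have eq: "- supp M = \<Union>?F"
    unfolding supp_def by (auto simp: zero_less_iff_neq_zero)
  have "open (\<Union>?F)" by auto
  then show "supp M \<in> sets M"
    using eq by (metis assms borel_closed closed_def)
  \<comment> \<open>The family of open null sets may be uncountable; by Lindelof countably many of
    them have the same union.\<close>
  obtain F' where F': "F' \<subseteq> ?F" "countable F'" "\<Union>F' = \<Union>?F"
    by (rule Lindelof[of ?F]) auto
  have "(\<Union>F') \<in> null_sets M"
    using F' by (intro null_sets_UN'[where N="\<lambda>x. x" and I=F', simplified] ) (auto simp: null_sets_def assms)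
  then show "emeasure M (- supp M) = 0"
    using F'(3) eq by auto
qed

lemma AE_supp:
  assumes "sets M = sets borel"
  shows "AE x in M. x \<in> supp M"
  using emeasure_Compl_supp[OF assms] sets_eq_imp_space_eq[OF assms]
  by (intro AE_I[of _ _ "- supp M"]) (auto simp: assms)

lemma AE_in_interval:
  assumes "sets M = sets borel" "supp M \<subseteq> {a..b}"
  shows "AE x in M. x \<in> {a..b}"
  using AE_supp[OF assms(1)] assms(2) by (auto elim!: eventually_mono)

section \<open>Truncated logarithmic kernel\<close>

text \<open>The function \<open>- ln\<close>, continued below \<open>e\<close> along its tangent at \<open>e\<close>.\<close>

definition log_ker :: "real \<Rightarrow> real \<Rightarrow> real" where
  "log_ker e d = - ln (max e d) + 1 - min e d / e"

lemma log_ker_eq: "0 < e \<Longrightarrow> e \<le> d \<Longrightarrow> log_ker e d = - ln d"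
  by (simp add: log_ker_def)

text \<open>The slope at \<open>d\<close> is -1 / max e d, so its modulus is at most 1/e. The
  increment above \<open>e\<close> is handled by ln x \<le> x - 1; below \<open>e\<close> the
  function is linear.\<close>

lemma log_ker_lipschitz:
  assumes "0 < e" shows "\<bar>log_ker e d - log_ker e d'\<bar> \<le> \<bar>d - d'\<bar> / e"
proof -
  have *: "\<bar>log_ker e d - log_ker e d'\<bar> \<le> (d - d') / e" if "d' \<le> d" for d d'
  proof -
    have pos: "0 < max e d" "0 < max e d'" using assms by auto
    have "ln (max e d) - ln (max e d') = ln (max e d / max e d')"
      using pos by (simp add: ln_div)
    also have "\<dots> \<le> max e d / max e d' - 1" using pos by (intro ln_le_minus_one) auto
    also have "\<dots> = (max e d - max e d') / max e d'" using pos by (simp add: field_simps)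
    also have "\<dots> \<le> (max e d - max e d') / e" using that assms by (intro divide_left_mono) auto
    finally have 1: "ln (max e d) - ln (max e d') \<le> (max e d - max e d') / e" .
    have 2: "ln (max e d') \<le> ln (max e d)" "min e d' / e \<le> min e d / e"
      using pos that assms by (auto intro!: divide_right_mono)
    have "(max e d - max e d') / e + (min e d / e - min e d' / e) = (d - d') / e"
      using assms by (auto simp: max_def min_def field_simps)
    moreover have "\<bar>(- A + 1 - B) - (- A' + 1 - B')\<bar> \<le> R"
      if "A - A' \<le> S" "A' \<le> A" "B' \<le> B" "S + (B - B') = R" for A A' B B' S R :: real
      using that by linarith
    ultimately show ?thesis unfolding log_ker_def using 1 2 by blast
  qed
  show ?thesis using *[of d d'] *[of d' d] by (cases "d' \<le> d") auto
qed

lemma log_ker_antimono: "0 < e \<Longrightarrow> d' \<le> d \<Longrightarrow> log_ker e d \<le> log_ker e d'"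
proof -
  assume "0 < e" "d' \<le> d"
  then have "ln (max e d') \<le> ln (max e d)" "min e d' / e \<le> min e d / e"
    by (auto intro!: divide_right_mono)
  moreover have "- A + 1 - B \<le> - A' + 1 - B'" if "A' \<le> A" "B' \<le> B" for A A' B B' :: real
    using that by linarith
  ultimately show ?thesis unfolding log_ker_def by blast
qed

text \<open>Convexity: -ln lies above its tangent at \<open>e\<close>.\<close>

lemma log_ker_le_ln:
  assumes "0 < e" "0 < d" shows "log_ker e d \<le> - ln d"
proof (cases "e \<le> d")
  case False
  have "ln (d / e) \<le> d / e - 1" using assms by (intro ln_le_minus_one) auto
  then show ?thesis using False assms by (simp add: log_ker_def ln_div)
qed (use assms in \<open>simp add: log_ker_eq\<close>)

text \<open>At the point \<open>e\<close> the tangent taken at \<open>e'\<close> is still below -ln,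
  and further to the left the tangent at \<open>e\<close> is the steeper one. This monotonicity in
  the scale is behind every passage from \<open>e\<close> to 0.\<close>

lemma log_ker_mono_trunc:
  assumes "0 < e" "e \<le> e'" "0 \<le> d" shows "log_ker e' d \<le> log_ker e d"
proof (cases "e \<le> d")
  case True
  then show ?thesis using assms log_ker_le_ln[of e' d] by (simp add: log_ker_eq)
next
  case False
  have "ln (e / e') \<le> e / e' - 1" using assms by (intro ln_le_minus_one) auto
  then have "- ln e' + 1 - d / e' \<le> - ln e + e / e' - d / e'"
    using assms by (simp add: ln_div)
  also have "\<dots> = - ln e + (e - d) / e'" by (simp add: diff_divide_distrib)
  also have "\<dots> \<le> - ln e + (e - d) / e" using assms False by (intro add_left_mono divide_left_mono) auto
  also have "\<dots> = - ln e + 1 - d / e" using assms by (simp add: field_simps)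
  finally have "- ln e' + 1 - d / e' \<le> - ln e + 1 - d / e" .
  then show ?thesis using False assms by (simp add: log_ker_def)
qed

lemma log_ker_le: "0 < e \<Longrightarrow> 0 \<le> d \<Longrightarrow> log_ker e d \<le> 1 - ln e"
  using log_ker_antimono[of e 0 d] by (simp add: log_ker_def)

lemma log_ker_ge: "0 < e \<Longrightarrow> d \<le> D \<Longrightarrow> e \<le> D \<Longrightarrow> - ln D \<le> log_ker e d"
  using log_ker_antimono[of e d D] by (simp add: log_ker_eq)

lemma log_ker_continuous: "0 < e \<Longrightarrow> continuous_on A (log_ker e)"
  unfolding log_ker_def by (intro continuous_intros) auto

lemma log_ker_continuous' [continuous_intros]:
  "0 < e \<Longrightarrow> continuous_on A f \<Longrightarrow> continuous_on A (\<lambda>x. log_ker e (f x))"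
  using continuous_on_compose2[OF log_ker_continuous[of e UNIV]] by blast

lemma log_ker_measurable [measurable]: "log_ker e \<in> borel_measurable borel"
  unfolding log_ker_def by measurable

lemma log_ker_bounded:
  assumes "0 < e" "0 \<le> d" "d \<le> D" shows "\<bar>log_ker e d\<bar> \<le> 1 + \<bar>ln e\<bar> + \<bar>ln (max e D)\<bar>"
  using log_ker_le[OF assms(1,2)] log_ker_ge[OF assms(1), of d "max e D"] assms by linarith

section \<open>Truncated potentials\<close>

definition log_pot :: "real \<Rightarrow> real measure \<Rightarrow> real \<Rightarrow> real" where
  "log_pot e \<nu> t = (LINT y|\<nu>. log_ker e \<bar>t - y\<bar>)"

lemma prob_on_D:
  assumes "prob_on a b \<nu>"
  shows "prob_space \<nu>" "sets \<nu> = sets borel" "space \<nu> = UNIV" "AE x in \<nu>. x \<in> {a..b}" "a \<le> b"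
proof -
  interpret prob_space \<nu> using assms by (simp add: prob_on_def)
  show s: "prob_space \<nu>" "sets \<nu> = sets borel" "AE x in \<nu>. x \<in> {a..b}"
    using assms AE_in_interval by (auto simp: prob_on_def)
  then show "space \<nu> = UNIV" by (metis sets_eq_imp_space_eq space_borel)
  show "a \<le> b"
  proof (rule ccontr)
    assume "\<not> a \<le> b"
    then have "AE x in \<nu>. False" using s(3) by auto
    then show False using AE_False by blast
  qed
qed

lemma prob_on_I:
  assumes "prob_space \<nu>" "sets \<nu> = sets borel" "AE x in \<nu>. x \<in> {a..b}"
  shows "prob_on a b \<nu>"
proof -
  have "x \<in> {a..b}" if x: "x \<in> supp \<nu>" for x
  proof (rule ccontr)
    assume "x \<notin> {a..b}"
    moreover have "open (- {a..b})" by (simp add: open_Compl)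
    ultimately have "0 < emeasure \<nu> (- {a..b})" using x unfolding supp_def by blast
    moreover have "{x \<in> space \<nu>. \<not> x \<in> {a..b}} = - {a..b}"
      using sets_eq_imp_space_eq[OF assms(2)] by auto
    then have "emeasure \<nu> (- {a..b}) = 0"
      using assms(3) AE_iff_measurable[of "- {a..b}" \<nu> "\<lambda>x. x \<in> {a..b}"] assms(2) by simp
    ultimately show False by simp
  qed
  then show ?thesis using assms by (auto simp: prob_on_def)
qed

lemma integrable_cont_prob_on:
  assumes "prob_on a b \<nu>" "f \<in> borel_measurable borel" "\<And>x. x \<in> {a..b} \<Longrightarrow> \<bar>f x\<bar> \<le> B"
  shows "integrable \<nu> (f::real\<Rightarrow>real)"
proof -
  interpret prob_space \<nu> using prob_on_D[OF assms(1)] by simp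
  have "AE x in \<nu>. norm (f x) \<le> B"
    using prob_on_D(4)[OF assms(1)] by eventually_elim (use assms(3) in auto)
  then show ?thesis
    using assms(2) by (intro integrable_const_bound[of _ B]) (auto simp: prob_on_D(2)[OF assms(1)] cong: measurable_cong_sets)
qed

lemma log_ker_integrable:
  assumes "prob_on a b \<nu>" "0 < e"
  shows "integrable \<nu> (\<lambda>y. log_ker e \<bar>t - y\<bar>)"
  by (rule integrable_cont_prob_on[OF assms(1), where B="1 + \<bar>ln e\<bar> + \<bar>ln (max e (\<bar>t\<bar>+\<bar>a\<bar>+\<bar>b\<bar>))\<bar>"])
    (use assms(2) in \<open>auto intro!: log_ker_bounded\<close>)

lemma log_pot_lipschitz:
  assumes "prob_on a b \<nu>" "0 < e"
  shows "\<bar>log_pot e \<nu> t - log_pot e \<nu> t'\<bar> \<le> \<bar>t - t'\<bar> / e"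
proof -
  interpret prob_space \<nu> using prob_on_D[OF assms(1)] by simp
  have "\<bar>log_pot e \<nu> t - log_pot e \<nu> t'\<bar> = \<bar>LINT y|\<nu>. log_ker e \<bar>t - y\<bar> - log_ker e \<bar>t' - y\<bar>\<bar>"
    unfolding log_pot_def using log_ker_integrable[OF assms] by simp
  also have "\<dots> \<le> (LINT y|\<nu>. \<bar>log_ker e \<bar>t - y\<bar> - log_ker e \<bar>t' - y\<bar>\<bar>)" by (rule integral_abs_bound)
  also have "\<dots> \<le> (LINT y|\<nu>. \<bar>t - t'\<bar> / e)"
  proof (rule integral_mono)
    show "\<bar>log_ker e \<bar>t - y\<bar> - log_ker e \<bar>t' - y\<bar>\<bar> \<le> \<bar>t - t'\<bar> / e" for y
      by (rule order_trans[OF log_ker_lipschitz[OF assms(2)]]) (use assms(2) in \<open>auto intro!: divide_right_mono\<close>)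
  qed (use log_ker_integrable[OF assms] in auto)
  also have "\<dots> = \<bar>t - t'\<bar> / e" by (simp add: prob_space)
  finally show ?thesis .
qed

lemma log_pot_continuous:
  assumes "prob_on a b \<nu>" "0 < e"
  shows "continuous_on A (log_pot e \<nu>)"
proof -
  have "(1/e)-lipschitz_on A (log_pot e \<nu>)"
    using log_pot_lipschitz[OF assms] assms(2) by (auto simp: lipschitz_on_def dist_real_def)
  then show ?thesis by (rule lipschitz_on_continuous_on)
qed

lemma log_pot_mono_trunc:
  assumes "prob_on a b \<nu>" "0 < e" "e \<le> e'"
  shows "log_pot e' \<nu> t \<le> log_pot e \<nu> t"
  unfolding log_pot_def
  by (intro integral_mono log_ker_integrable[OF assms(1)] log_ker_mono_trunc) (use assms in auto)

text \<open>A truncation shorter than the distance to the measure is invisible. The potential of the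
  measure on the other interval can therefore always be taken at the fixed scale of the gap.\<close>

lemma log_pot_eq_far:
  assumes "prob_on a b \<nu>" "0 < e" "0 < e'" "\<And>y. y \<in> {a..b} \<Longrightarrow> e \<le> \<bar>t - y\<bar> \<and> e' \<le> \<bar>t - y\<bar>"
  shows "log_pot e \<nu> t = log_pot e' \<nu> t"
proof -
  have "AE y in \<nu>. log_ker e \<bar>t - y\<bar> = log_ker e' \<bar>t - y\<bar>"
    using prob_on_D(4)[OF assms(1)] by eventually_elim (use assms in \<open>simp add: log_ker_eq\<close>)
  then show ?thesis
    unfolding log_pot_def
    by (intro integral_cong_AE) (simp_all add: prob_on_D(2)[OF assms(1)] cong: measurable_cong_sets)
qed

section \<open>Relation to the potential\<close>

text \<open>The scales 1/(n+1) do not exceed 1, so truncation alters the kernel only at distances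
  where -ln is positive. The negative part is thus one finite number for all \<open>n\<close>, and
  the positive part converges monotonically.\<close>

lemma log_potential_limit:
  assumes "prob_on a b \<nu>"
  shows "(\<lambda>n. ereal (log_pot (1 / real (Suc n)) \<nu> t)) \<longlonglongrightarrow> log_potential t \<nu>"
proof -
  interpret prob_space \<nu> using prob_on_D[OF assms(1)] by simp
  note [measurable_cong] = prob_on_D(2)[OF assms]
  define e :: "nat \<Rightarrow> real" where "e n = 1 / real (Suc n)" for n
  have e: "0 < e n" "e n \<le> 1" for n by (auto simp: e_def)
  have emono: "e n \<le> e m" if "m \<le> n" for m n using that by (auto simp: e_def field_simps)
  define Pp where "Pp n = (\<integral>\<^sup>+y. ennreal (log_ker (e n) \<bar>t - y\<bar>) \<partial>\<nu>)" for n
  define Nn where "Nn = (\<integral>\<^sup>+y. ennreal (ln (max 1 \<bar>t - y\<bar>)) \<partial>\<nu>)"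
  have neg: "ennreal (- log_ker (e n) d) = ennreal (ln (max 1 d))" if "0 \<le> d" for n d
  proof (cases "1 \<le> d")
    case True then show ?thesis using e[of n] by (simp add: log_ker_eq max_def)
  next
    case False
    have "- ln 1 \<le> log_ker (e n) d" using e[of n] False by (intro log_ker_ge) auto
    then show ?thesis using False by (simp add: max_def ennreal_neg)
  qed
  have negk: "e2ennreal (- log_kernel t y) = ennreal (ln (max 1 \<bar>t - y\<bar>))" for y
  proof -
    consider "t = y" | "1 \<le> \<bar>t - y\<bar>" | "t \<noteq> y" "\<bar>t - y\<bar> < 1" by linarith
    then show ?thesis
    proof cases
      case 3
      then have "ln \<bar>t - y\<bar> \<le> 0" by (intro ln_le_zero_iff[THEN iffD2]) auto
      then show ?thesis using 3 by (auto simp: log_kernel_def e2ennreal_neg ln_div max_def ennreal_def[symmetric] e2ennreal_ereal ennreal_neg)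
    qed (auto simp: log_kernel_def e2ennreal_neg ln_div max_def)
  qed
  have int: "integrable \<nu> (\<lambda>y. log_ker (e n) \<bar>t - y\<bar>)" for n
    by (rule log_ker_integrable[OF assms]) (use e in auto)
  have Nn_eq: "Nn = (\<integral>\<^sup>+y. ennreal (- log_ker (e n) \<bar>t - y\<bar>) \<partial>\<nu>)" for n
    unfolding Nn_def by (simp add: neg)
  have fin: "Nn < \<infinity>" "Pp n < \<infinity>" for n
  proof -
    have "\<infinity> \<noteq> (\<integral>\<^sup>+y. ennreal (- log_ker (e n) \<bar>t - y\<bar>) \<partial>\<nu>)" "\<infinity> \<noteq> (\<integral>\<^sup>+y. ennreal (log_ker (e n) \<bar>t - y\<bar>) \<partial>\<nu>)"
      using int[of n] unfolding real_integrable_def by auto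
    then show "Nn < \<infinity>" "Pp n < \<infinity>" unfolding Nn_eq[of n] Pp_def by (metis less_top infinity_ennreal_def)+
  qed
  have log_pot_eq: "ereal (log_pot (e n) \<nu> t) = enn2ereal (Pp n) - enn2ereal Nn" for n
  proof -
    have "log_pot (e n) \<nu> t = enn2real (Pp n) - enn2real Nn"
      unfolding log_pot_def by (subst real_lebesgue_integral_def[OF int]) (simp add: Pp_def Nn_eq[of n])
    moreover have "enn2ereal (Pp n) = ereal (enn2real (Pp n))" "enn2ereal Nn = ereal (enn2real Nn)"
      using fin by (auto simp: less_top[symmetric] simp flip: enn2ereal_ennreal[OF enn2real_nonneg] intro!: arg_cong[of _ _ enn2ereal])
    ultimately show ?thesis by (metis ereal_minus(1))
  qed
  have lim_log_ker: "(\<lambda>n. ennreal (log_ker (e n) \<bar>t - y\<bar>)) \<longlonglongrightarrow> e2ennreal (log_kernel t y)" for y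
  proof (cases "t = y")
    case True
    have "filterlim (\<lambda>n. 1 + ln (real (Suc n))) at_top sequentially"
      by (intro filterlim_tendsto_add_at_top[OF tendsto_const] filterlim_compose[OF ln_at_top]
           filterlim_compose[OF filterlim_real_sequentially filterlim_Suc])
    then have "(\<lambda>n. ennreal (1 + ln (real (Suc n)))) \<longlonglongrightarrow> top"
      by (subst (asm) ennreal_tendsto_top_eq_at_top[symmetric]) (simp only: infinity_ennreal_def)
    moreover have "log_ker (e n) 0 = 1 + ln (real (Suc n))" for n
      by (simp add: log_ker_def e_def ln_div max_def)
    ultimately show ?thesis using True by (simp add: log_kernel_def e2ennreal_infty)
  next
    case False
    then obtain m where m: "e m < \<bar>t - y\<bar>"
      using reals_Archimedean[of "\<bar>t - y\<bar>"] by (auto simp: e_def inverse_eq_divide)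
    have "\<forall>\<^sub>F n in sequentially. e2ennreal (log_kernel t y) = ennreal (log_ker (e n) \<bar>t - y\<bar>)"
      using eventually_ge_at_top[of m]
    proof eventually_elim
      case (elim n)
      then show ?case using False m emono[OF elim] e[of n]
        by (simp add: log_ker_eq log_kernel_def ln_div e2ennreal_ereal)
    qed
    then show ?thesis by (metis (mono_tags) tendsto_eventually eventually_mono)
  qed
  have "Pp \<longlonglongrightarrow> (\<integral>\<^sup>+y. e2ennreal (log_kernel t y) \<partial>\<nu>)"
    unfolding Pp_def
  proof (rule nn_integral_LIMSEQ)
    show "incseq (\<lambda>n y. ennreal (log_ker (e n) \<bar>t - y\<bar>))"
      using e emono by (auto simp: incseq_def le_fun_def intro!: ennreal_leI log_ker_mono_trunc)
  qed (use lim_log_ker in auto)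
  then have "(\<lambda>n. enn2ereal (Pp n)) \<longlonglongrightarrow> enn2ereal (\<integral>\<^sup>+y. e2ennreal (log_kernel t y) \<partial>\<nu>)"
    by (simp add: tendsto_enn2ereal_iff)
  then have "(\<lambda>n. enn2ereal (Pp n) - enn2ereal Nn) \<longlonglongrightarrow> enn2ereal (\<integral>\<^sup>+y. e2ennreal (log_kernel t y) \<partial>\<nu>) - enn2ereal Nn"
    using fin(1) by (intro tendsto_diff_ereal_general tendsto_const) auto
  then show ?thesis
    unfolding log_pot_eq[symmetric] log_potential_def ereal_integral_def negk Nn_def[symmetric] e_def .
qed

lemma log_pot_le_log_potential:
  assumes "prob_on a b \<nu>" "0 < e"
  shows "ereal (log_pot e \<nu> t) \<le> log_potential t \<nu>"
proof (rule LIMSEQ_le_const[OF log_potential_limit[OF assms(1)]])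
  obtain N where N: "1 / real (Suc N) < e" using reals_Archimedean[OF assms(2)] by (auto simp: inverse_eq_divide)
  have "log_pot e \<nu> t \<le> log_pot (1 / real (Suc n)) \<nu> t" if "N \<le> n" for n
  proof -
    have "1 / real (Suc n) \<le> 1 / real (Suc N)" using that by (simp add: field_simps)
    with N show ?thesis by (intro log_pot_mono_trunc[OF assms(1)]) auto
  qed
  then show "\<exists>N. \<forall>n\<ge>N. ereal (log_pot e \<nu> t) \<le> ereal (log_pot (1 / real (Suc n)) \<nu> t)" by auto
qed

lemma less_log_potential:
  assumes "prob_on a b \<nu>" "ereal l < log_potential t \<nu>"
  shows "\<exists>e>0. \<forall>e'. 0 < e' \<and> e' \<le> e \<longrightarrow> l < log_pot e' \<nu> t"
proof -
  have "\<forall>\<^sub>F n in sequentially. ereal l < ereal (log_pot (1 / real (Suc n)) \<nu> t)"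
    using order_tendstoD(1)[OF log_potential_limit[OF assms(1)] assms(2)] .
  then obtain n where "l < log_pot (1 / real (Suc n)) \<nu> t"
    by (auto simp: eventually_sequentially)
  then show ?thesis using log_pot_mono_trunc[OF assms(1)]
    by (intro exI[of _ "1 / real (Suc n)"]) (auto intro: less_le_trans)
qed

lemma log_potential_far:
  assumes "prob_on a b \<nu>" "0 < g" "\<And>y. y \<in> {a..b} \<Longrightarrow> g \<le> \<bar>t - y\<bar>"
  shows "log_potential t \<nu> = ereal (log_pot g \<nu> t)"
proof (rule LIMSEQ_unique[OF log_potential_limit[OF assms(1)]])
  obtain N where N: "1 / real (Suc N) < g" using reals_Archimedean[OF assms(2)] by (auto simp: inverse_eq_divide)
  have "\<forall>\<^sub>F n in sequentially. ereal (log_pot (1 / real (Suc n)) \<nu> t) = ereal (log_pot g \<nu> t)"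
    using eventually_ge_at_top[of N]
  proof eventually_elim
    case (elim n)
    then have "1 / real (Suc n) \<le> 1 / real (Suc N)" by (simp add: field_simps)
    with N have "1 / real (Suc n) \<le> g" by linarith
    with assms(2,3) show ?case
      by (intro arg_cong[of _ _ ereal] log_pot_eq_far[OF assms(1)]) (auto intro: order_trans simp del: of_nat_Suc)
  qed
  then show "(\<lambda>n. ereal (log_pot (1 / real (Suc n)) \<nu> t)) \<longlonglongrightarrow> ereal (log_pot g \<nu> t)" by (rule tendsto_eventually)
qed

section \<open>Compactness\<close>

text \<open>Dini's argument: bad points at the scales 1/(n+1) accumulate at some \<open>l\<close>;
  at a fixed scale that is good for \<open>l\<close> continuity makes all points near
  \<open>l\<close> good, and monotonicity carries this to the finer scales.\<close>

lemma dini_lower: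
  fixes f :: "real \<Rightarrow> real \<Rightarrow> real"
  assumes "compact I" and cont: "\<And>e. 0 < e \<Longrightarrow> continuous_on I (f e)"
    and mono: "\<And>e e' t. 0 < e \<Longrightarrow> e \<le> e' \<Longrightarrow> t \<in> I \<Longrightarrow> f e' t \<le> f e t"
    and pt: "\<And>t. t \<in> I \<Longrightarrow> \<exists>e>0. c < f e t"
  shows "\<exists>e>0. \<forall>t\<in>I. c < f e t"
proof (rule ccontr)
  assume neg: "\<not> ?thesis"
  have "\<exists>t\<in>I. f (1 / real (Suc n)) t \<le> c" for n
    using neg by (meson divide_pos_pos not_less of_nat_0_less_iff zero_less_Suc zero_less_one)
  then obtain T where T: "\<And>n. T n \<in> I" "\<And>n. f (1 / real (Suc n)) (T n) \<le> c" by metis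
  obtain l r where l: "l \<in> I" "strict_mono r" "(T \<circ> r) \<longlonglongrightarrow> l"
    using assms(1) T(1) unfolding compact_def by metis
  obtain e where e: "0 < e" "c < f e l" using pt[OF l(1)] by auto
  have "(\<lambda>n. f e ((T \<circ> r) n)) \<longlonglongrightarrow> f e l"
    by (rule continuous_on_tendsto_compose[OF cont[OF e(1)] l(3,1)]) (use T(1) in auto)
  then have "\<forall>\<^sub>F n in sequentially. c < f e (T (r n))"
    using order_tendstoD(1)[OF _ e(2)] by auto
  moreover obtain N where N: "1 / real (Suc N) < e" using reals_Archimedean[OF e(1)] by (auto simp: inverse_eq_divide)
  ultimately have "\<forall>\<^sub>F n in sequentially. c < f e (T (r n)) \<and> N \<le> n"
    using eventually_ge_at_top[of N] by (auto elim: eventually_conj)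
  then obtain n where n: "c < f e (T (r n))" "N \<le> n" by (auto simp: eventually_sequentially)
  then have "N \<le> r n" using seq_suble[OF l(2), of n] by simp
  then have "1 / real (Suc (r n)) \<le> 1 / real (Suc N)" by (simp add: field_simps)
  then have "f e (T (r n)) \<le> f (1 / real (Suc (r n))) (T (r n))"
    using N T(1) by (intro mono) auto
  with n T(2)[of "r n"] show False by linarith
qed

text \<open>With a common Lipschitz constant, convergence on a finite net gives uniform
  convergence.\<close>

lemma equi_lipschitz_uniform:
  fixes f :: "nat \<Rightarrow> real \<Rightarrow> real"
  assumes L: "\<And>n t t'. \<bar>f n t - f n t'\<bar> \<le> L * \<bar>t - t'\<bar>" and lim: "\<And>t. (\<lambda>n. f n t) \<longlonglongrightarrow> g t" and "0 < e"
  shows "\<forall>\<^sub>F n in sequentially. \<forall>t\<in>{a..b}. \<bar>f n t - g t\<bar> \<le> e"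
proof -
  have "0 \<le> L" using L[of 0 0 1] by simp
  \<comment> \<open>Mesh of the net, with L * d \<le> e/3; \<open>L + 1\<close> avoids a division by
    zero when \<open>L = 0\<close>.\<close>
  define d where "d = e / (3 * (L + 1))"
  have d: "0 < d" using assms \<open>0 \<le> L\<close> by (simp add: d_def)
  have Ld: "L * x \<le> e / 3" if "x \<le> d" "0 \<le> x" for x
  proof -
    have "L * x \<le> (L + 1) * d" using that \<open>0 \<le> L\<close> by (intro mult_mono) auto
    also have "\<dots> = e / 3" using \<open>0 \<le> L\<close> by (simp add: d_def divide_simps)
    finally show ?thesis .
  qed
  have Lg: "\<bar>g t - g t'\<bar> \<le> L * \<bar>t - t'\<bar>" for t t'
    by (rule LIMSEQ_le_const2[OF tendsto_rabs[OF tendsto_diff[OF lim lim]]]) (use L in auto)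
  obtain D where D: "D \<subseteq> {a..b}" "finite D" "{a..b} \<subseteq> (\<Union>x\<in>D. ball x d)"
    by (rule compactE_image[of "{a..b}" "{a..b}" "\<lambda>x. ball x d"]) (use d in force)+
  have "\<forall>\<^sub>F n in sequentially. \<forall>x\<in>D. \<bar>f n x - g x\<bar> < e / 3"
  proof (rule eventually_ball_finite[OF D(2)], rule ballI)
    fix x
    show "\<forall>\<^sub>F n in sequentially. \<bar>f n x - g x\<bar> < e / 3"
      using tendstoD[OF lim[of x], of "e/3"] \<open>0 < e\<close> by (simp add: dist_real_def)
  qed
  then show ?thesis
  proof eventually_elim
    case (elim n)
    show ?case
    proof
      fix t assume "t \<in> {a..b}"
      then obtain x where x: "x \<in> D" "\<bar>t - x\<bar> \<le> d" using D(3) by (auto simp: dist_real_def abs_minus_commute)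
      have "\<bar>f n t - f n x\<bar> \<le> e / 3" "\<bar>g t - g x\<bar> \<le> e / 3"
        using L[of n t x] Lg[of t x] Ld[OF x(2)] by auto
      with elim[rule_format, OF x(1)] show "\<bar>f n t - g t\<bar> \<le> e" by linarith
    qed
  qed
qed

text \<open>Used for averages evaluated at nodes that move with the degree.\<close>

lemma equi_lipschitz_tendsto:
  fixes f :: "nat \<Rightarrow> real \<Rightarrow> real"
  assumes L: "\<And>n t t'. \<bar>f n t - f n t'\<bar> \<le> L * \<bar>t - t'\<bar>" and lim: "\<And>t. (\<lambda>n. f n t) \<longlonglongrightarrow> g t"
    and X: "X \<longlonglongrightarrow> x"
  shows "(\<lambda>n. f n (X n)) \<longlonglongrightarrow> g x"
proof -
  have "(\<lambda>n. L * \<bar>X n - x\<bar>) \<longlonglongrightarrow> L * \<bar>x - x\<bar>" by (intro tendsto_intros X)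
  then have "(\<lambda>n. L * \<bar>X n - x\<bar>) \<longlonglongrightarrow> 0" by simp
  then have "(\<lambda>n. f n (X n) - f n x) \<longlonglongrightarrow> 0"
    by (rule Lim_null_comparison[rotated]) (use L in auto)
  from tendsto_add[OF this lim[of x]] show ?thesis by simp
qed

text \<open>Helly selection for normalized counting measures, which are tight because all the sets
  lie in one bounded interval.\<close>

lemma helly_empirical:
  fixes Z :: "nat \<Rightarrow> real set"
  assumes Z: "\<And>n. finite (Z n)" "\<And>n. Z n \<noteq> {}" "\<And>n. Z n \<subseteq> {a..b}"
  obtains r \<alpha> where "strict_mono (r :: nat \<Rightarrow> nat)" "prob_on a b \<alpha>"
    "\<And>f. continuous_on UNIV f \<Longrightarrow> (\<lambda>n. (\<Sum>z\<in>Z (r n). f z) / real (card (Z (r n)))) \<longlonglongrightarrow> (LINT y|\<alpha>. f y)"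
proof -
  define M where "M n = distr (measure_pmf (pmf_of_set (Z n))) borel (\<lambda>x. x)" for n
  have rd: "real_distribution (M n)" for n
    unfolding M_def by (intro prob_space.real_distribution_distr prob_space_measure_pmf) simp
  have int: "integral\<^sup>L (M n) f = (\<Sum>z\<in>Z n. f z) / real (card (Z n))"
    if "f \<in> borel_measurable borel" for f :: "real \<Rightarrow> real" and n
    unfolding M_def using that Z by (simp add: integral_distr integral_pmf_of_set)
  \<comment> \<open>Tightness is phrased with half-open intervals; enlarging by 1 keeps the point
    \<open>a\<close> inside and the interval nonempty.\<close>
  have meas: "measure (M n) {a - 1<..b + 1} = 1" for n
  proof -
    have "measure (M n) {a - 1<..b + 1} = measure (measure_pmf (pmf_of_set (Z n))) {a - 1<..b + 1}"
      unfolding M_def by (subst measure_distr) auto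
    also have "\<dots> = 1" using Z[of n] by (subst measure_pmf.prob_eq_1) (auto simp: AE_measure_pmf_iff)
    finally show ?thesis .
  qed
  have "a \<le> b" using Z(2,3)[of 0] by fastforce
  have "\<exists>c d. c < d \<and> (\<forall>n. 1 - e < measure (M n) {c<..d})" if "0 < e" for e :: real
    using that meas \<open>a \<le> b\<close> by (intro exI[of _ "a - 1"] exI[of _ "b + 1"]) simp
  then have "tight M" unfolding tight_def using rd by simp
  from tight_imp_convergent_subsubsequence[OF this, of "\<lambda>n. n"]
  obtain r \<alpha> where r: "strict_mono (r::nat\<Rightarrow>nat)" "real_distribution \<alpha>" "weak_conv_m (\<lambda>n. M (r n)) \<alpha>"
    by (auto simp: strict_mono_def comp_def)
  interpret \<alpha>: real_distribution \<alpha> by fact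
  have conv: "(\<lambda>n. (\<Sum>z\<in>Z (r n). f z) / real (card (Z (r n)))) \<longlonglongrightarrow> (LINT y|\<alpha>. f y)"
    if f: "continuous_on UNIV f" "\<And>x. \<bar>f x\<bar> \<le> B" for f B
  proof -
    have "(\<lambda>n. integral\<^sup>L (M (r n)) f) \<longlonglongrightarrow> integral\<^sup>L \<alpha> f"
      using f by (intro weak_conv_imp_integral_bdd_continuous_conv[OF rd r(2,3), of f B])
        (auto simp: continuous_on_eq_continuous_at)
    then show ?thesis using int borel_measurable_continuous_onI[OF f(1)] by simp
  qed
  have AE: "AE x in \<alpha>. x \<in> {a..b}"
  proof -
    \<comment> \<open>A bounded continuous function whose zero set is exactly the interval; its
      averages vanish, so the limit measure is carried by the interval.\<close>
    define h where "h x = min 1 (max 0 (a - x) + max 0 (x - b))" for x :: real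
    have h: "continuous_on UNIV h" "\<And>x. \<bar>h x\<bar> \<le> 1" "\<And>x. 0 \<le> h x"
      unfolding h_def by (auto intro!: continuous_intros)
    have hm: "h \<in> borel_measurable borel" by (rule borel_measurable_continuous_onI[OF h(1)])
    have "(\<Sum>z\<in>Z n. h z) = 0" for n
      by (rule sum.neutral) (use Z(3)[of n] in \<open>auto simp: h_def\<close>)
    then have "(LINT y|\<alpha>. h y) = 0" using conv[OF h(1,2)] by (simp add: LIMSEQ_const_iff)
    moreover have "integrable \<alpha> h" using h hm by (intro \<alpha>.integrable_const_bound[of _ 1]) auto
    ultimately have "AE x in \<alpha>. h x = 0" using integral_nonneg_eq_0_iff_AE[of \<alpha> h] h by auto
    then show ?thesis by eventually_elim (auto simp: h_def min_def max_def split: if_splits)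
  qed
  have p: "prob_on a b \<alpha>" by (rule prob_on_I[OF _ _ AE]) (auto simp: \<alpha>.prob_space_axioms)
  show ?thesis
  proof (rule that[OF r(1) p])
    fix f :: "real \<Rightarrow> real" assume f: "continuous_on UNIV f"
    \<comment> \<open>Weak convergence needs bounded test functions. Clamping the argument bounds
      \<open>f\<close> without changing it where the measures live.\<close>
    define c where "c x = f (max a (min b x))" for x
    have cf: "c x = f x" if "x \<in> {a..b}" for x using that by (auto simp: c_def)
    have cc: "continuous_on UNIV c"
      unfolding c_def by (intro continuous_on_compose2[OF f] continuous_intros) auto
    have "compact (f ` {a..b})" by (intro compact_continuous_image continuous_on_subset[OF f]) auto
    then obtain B where B: "\<And>x. x \<in> {a..b} \<Longrightarrow> \<bar>f x\<bar> \<le> B"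
      using compact_imp_bounded bounded_iff by (metis image_eqI real_norm_def)
    have "\<bar>c x\<bar> \<le> B" for x unfolding c_def by (rule B) (use \<open>a \<le> b\<close> in auto)
    from conv[OF cc this]
    have "(\<lambda>n. (\<Sum>z\<in>Z (r n). c z) / real (card (Z (r n)))) \<longlonglongrightarrow> (LINT y|\<alpha>. c y)" .
    moreover have "(\<Sum>z\<in>Z n. c z) = (\<Sum>z\<in>Z n. f z)" for n
      by (rule sum.cong) (use Z(3)[of n] cf in auto)
    moreover have "(LINT y|\<alpha>. c y) = (LINT y|\<alpha>. f y)"
    proof (rule integral_cong_AE)
      show "AE x in \<alpha>. c x = f x" using AE by eventually_elim (rule cf)
    qed (use borel_measurable_continuous_onI[OF f] borel_measurable_continuous_onI[OF cc] in auto)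
    ultimately show "(\<lambda>n. (\<Sum>z\<in>Z (r n). f z) / real (card (Z (r n)))) \<longlonglongrightarrow> (LINT y|\<alpha>. f y)"
      by simp
  qed
qed

section \<open>Discretization\<close>

lemma nat_floor_bounds:
  fixes x :: real assumes "0 \<le> x"
  shows "real (nat \<lfloor>x\<rfloor>) \<le> x" "x < real (nat \<lfloor>x\<rfloor>) + 1"
  using floor_correct[of x] assms by auto

text \<open>Turns an empirical average into an integral over the unit interval, where it can be
  compared with the quantile representation of a measure.\<close>

lemma integral_step_unit:
  fixes h :: "nat \<Rightarrow> real"
  assumes "0 < n"
  shows "integrable (restrict_space lborel {0<..<1::real}) (\<lambda>w. h (nat \<lfloor>real n * w\<rfloor>))"
    and "(LINT w|restrict_space lborel {0<..<1::real}. h (nat \<lfloor>real n * w\<rfloor>)) = (\<Sum>i<n. h i) / real n"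
proof -
  define J where "J i = {real i / real n..<real (Suc i) / real n}" for i
  let ?s = "\<lambda>w::real. \<Sum>i<n. h i * indicator (J i \<inter> {0<..<1}) w"
  have eq: "indicator {0<..<1} w * h (nat \<lfloor>real n * w\<rfloor>) = ?s w" for w :: real
  proof (cases "w \<in> {0<..<1}")
    case True
    define k where "k = nat \<lfloor>real n * w\<rfloor>"
    have k0: "real k \<le> real n * w" "real n * w < real k + 1"
      using True nat_floor_bounds[of "real n * w"] unfolding k_def by auto
    have mem: "w \<in> J i \<longleftrightarrow> i = k" for i
    proof -
      have "w \<in> J i \<longleftrightarrow> real i \<le> real n * w \<and> real n * w < real i + 1"
        using assms by (auto simp: J_def field_simps)
      also have "\<dots> \<longleftrightarrow> i = k" using k0 by auto
      finally show ?thesis .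
    qed
    have "real n * w < real n * 1" using True assms by (intro mult_strict_left_mono) auto
    then have "k < n" using k0 by linarith
    then show ?thesis using True by (simp add: indicator_def mem k_def[symmetric] if_distrib[of "\<lambda>x. _ * x"] cong: if_cong)
  qed simp
  have J: "emeasure lborel (J i \<inter> {0<..<1}) = ennreal (1 / real n)" if "i < n" for i
  proof -
    have "real (Suc i) / real n \<le> 1" using that by (simp add: field_simps)
    have "emeasure lborel (J i \<inter> {0<..<1}) = emeasure lborel {real i / real n..<real (Suc i) / real n}"
    proof (rule emeasure_eq_AE)
      show "AE x in lborel. (x \<in> J i \<inter> {0<..<1}) = (x \<in> {real i / real n..<real (Suc i) / real n})"
        using AE_lborel_singleton[of 0] AE_lborel_singleton[of 1]
      proof eventually_elim
        case (elim x)
        have "0 < x" "x < 1" if "x \<in> J i"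
        proof -
          have "0 \<le> real i / real n" by simp
          then show "0 < x" "x < 1" using that elim \<open>real (Suc i) / real n \<le> 1\<close> unfolding J_def atLeastLessThan_iff by linarith+
        qed
        then show ?case by (auto simp: J_def)
      qed
    qed (auto simp: J_def)
    also have "\<dots> = ennreal (1 / real n)" using assms by (simp add: divide_right_mono flip: diff_divide_distrib)
    finally show ?thesis .
  qed
  have int: "integrable lborel (\<lambda>w. h i * indicator (J i \<inter> {0<..<1}) w)" if "i < n" for i
    using J[OF that] by (intro integrable_mult_right integrable_real_indicator) (auto simp: J_def)
  have *: "integrable lborel ?s" by (intro Bochner_Integration.integrable_sum int) auto
  have "(LINT w|lborel. ?s w) = (\<Sum>i<n. h i * (1 / real n))"
    using int J by (subst Bochner_Integration.integral_sum) (auto simp: measure_def)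
  with * show "integrable (restrict_space lborel {0<..<1::real}) (\<lambda>w. h (nat \<lfloor>real n * w\<rfloor>))"
    "(LINT w|restrict_space lborel {0<..<1::real}. h (nat \<lfloor>real n * w\<rfloor>)) = (\<Sum>i<n. h i) / real n"
    by (simp_all add: integrable_restrict_space integral_restrict_space eq sum_divide_distrib)
qed

text \<open>The points are quantiles, one per cell of length 1/n. On each cell the error is at most
  \<open>L\<close> times the increase of the quantile function there, and these increases telescope
  to at most \<open>b - a\<close>. A single choice of points serves all \<open>f\<close>; this
  matters because it is used for a whole family of kernels at once.\<close>

lemma discretize:
  assumes "prob_on a b \<sigma>" "0 < n"
  obtains y :: "nat \<Rightarrow> real" where "\<And>i. i < n \<Longrightarrow> y i \<in> supp \<sigma>"
    "\<And>f L. f \<in> borel_measurable borel \<Longrightarrow> (\<And>u v. u \<in> {a..b} \<Longrightarrow> v \<in> {a..b} \<Longrightarrow> \<bar>f u - f v\<bar> \<le> L * \<bar>u - v\<bar>)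
      \<Longrightarrow> \<bar>(\<Sum>i<n. f (y i)) / real n - (LINT x|\<sigma>. f x)\<bar> \<le> L * (b - a) / real n"
proof -
  interpret \<sigma>: prob_space \<sigma> using prob_on_D[OF assms(1)] by simp
  interpret rd: real_distribution \<sigma>
    using prob_on_D[OF assms(1)] by unfold_locales auto
  interpret cdf_distribution \<sigma> ..
  have ab: "a \<le> b" using prob_on_D(5)[OF assms(1)] .
  define Q where "Q = I"
  have pinv: "w \<le> C x \<longleftrightarrow> Q w \<le> x" if "0 < w" "w < 1" for w x
    unfolding Q_def by (rule pseudoinverse[OF that])
  have mono_Q: "mono_on {0<..<1} Q" unfolding Q_def by (rule mono_I)
  have [measurable]: "Q \<in> borel_measurable (restrict_space borel {0<..<1})"
    unfolding Q_def by (rule measurable_CI)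
  have distr_Q: "distr (restrict_space lborel {0<..<1::real}) borel Q = \<sigma>"
    unfolding Q_def by (rule distr_I_eq_M)
  \<comment> \<open>The mass up to any point left of \<open>Q w\<close> is below \<open>w\<close>,
    the mass up to \<open>Q w\<close> is not; hence every interval ending at \<open>Q w\<close> is
    charged.\<close>
  have I_supp: "Q w \<in> supp \<sigma>" if w: "0 < w" "w < 1" for w
    unfolding supp_def
  proof (intro CollectI allI impI)
    fix U assume U: "open U" "Q w \<in> U"
    then obtain d where d: "0 < d" "ball (Q w) d \<subseteq> U" using openE by blast
    have "\<not> w \<le> C (Q w - d/2)" "w \<le> C (Q w)" using pinv[OF w, of "Q w - d/2"] pinv[OF w, of "Q w"] d by auto
    then have "0 < measure \<sigma> {Q w - d/2<..Q w}"
      using rd.cdf_diff_eq[of "Q w - d/2" "Q w"] d by auto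
    then have "0 < emeasure \<sigma> {Q w - d/2<..Q w}" by (simp add: \<sigma>.emeasure_eq_measure)
    also have "\<dots> \<le> emeasure \<sigma> U" using U d by (intro emeasure_mono) (force simp: dist_real_def)+
    finally show "0 < emeasure \<sigma> U" .
  qed
  have I_ab: "Q w \<in> {a..b}" if "0 < w" "w < 1" for w
    using I_supp[OF that] assms(1) by (auto simp: prob_on_def)
  \<comment> \<open>Quantiles at the midpoints of the cells, which avoid the levels 0 and 1 where
    the quantile function is not controlled.\<close>
  define y where "y i = Q ((2 * real i + 1) / (2 * real n))" for i
  \<comment> \<open>Quantiles at the cell ends, with the interval ends substituted at the levels 0
    and 1.\<close>
  define u where "u i = (if i = 0 then a else if n \<le> i then b else Q (real i / real n))" for i
  let ?R = "restrict_space lborel {0<..<1::real}"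
  have y_in: "0 < (2 * real i + 1) / (2 * real n)" "(2 * real i + 1) / (2 * real n) < 1" if "i < n" for i
    using that by (auto simp: field_simps)
  have mono_I': "Q w \<le> Q w'" if "0 < w" "w \<le> w'" "w' < 1" for w w'
    using mono_Q that by (auto simp: mono_on_def)
  have between: "u i \<le> Q w" "Q w \<le> u (Suc i)" if "0 < w" "w < 1" "real i \<le> real n * w" "real n * w \<le> real (Suc i)" for i w
  proof -
    have "real n * w < real n * 1" using that assms by (intro mult_strict_left_mono) auto
    then have "i < n" using that by simp
    then show "u i \<le> Q w" "Q w \<le> u (Suc i)"
      using I_ab[of w] that assms by (auto simp: u_def field_simps intro!: mono_I')
  qed
  show ?thesis
  proof (rule that)
    show "y i \<in> supp \<sigma>" if "i < n" for i unfolding y_def by (rule I_supp[OF y_in[OF that]])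
  next
    fix f :: "real \<Rightarrow> real" and L
    assume f [measurable]: "f \<in> borel_measurable borel"
      and L: "\<And>u v. u \<in> {a..b} \<Longrightarrow> v \<in> {a..b} \<Longrightarrow> \<bar>f u - f v\<bar> \<le> L * \<bar>u - v\<bar>"
    show "\<bar>(\<Sum>i<n. f (y i)) / real n - (LINT x|\<sigma>. f x)\<bar> \<le> L * (b - a) / real n"
    proof (cases "a = b")
      case True
      have "(LINT x|\<sigma>. f x) = (LINT x|\<sigma>. f a)"
        using prob_on_D(4)[OF assms(1)] True by (intro integral_cong_AE) (auto elim!: eventually_mono)
      moreover have "y i = a" if "i < n" for i
        using I_ab[OF y_in[OF that]] True by (auto simp: y_def)
      ultimately show ?thesis using assms(2) True \<sigma>.prob_space prob_on_D(3)[OF assms(1)] by simp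
    next
      case False
      then have "a < b" using ab by simp
      \<comment> \<open>Nonnegativity of \<open>L\<close> follows only from two distinct points; for
        \<open>a = b\<close> the Lipschitz hypothesis says nothing about \<open>L\<close>, whence
        the case distinction.\<close>
      have "0 \<le> L * \<bar>a - b\<bar>" using L[of a b] ab by (intro order_trans[OF abs_ge_zero]) auto
      then have "0 \<le> L" using \<open>a < b\<close> by (simp add: zero_le_mult_iff)
      have intf: "integrable \<sigma> f"
      proof (rule integrable_cont_prob_on[OF assms(1) f])
        show "\<bar>f x\<bar> \<le> \<bar>f a\<bar> + L * (b - a)" if "x \<in> {a..b}" for x
        proof -
          have "L * \<bar>x - a\<bar> \<le> L * (b - a)" using that \<open>0 \<le> L\<close> by (intro mult_left_mono) auto
          then show ?thesis using L[of x a] that ab by auto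
        qed
      qed
      have intf': "integrable ?R (\<lambda>w. f (Q w))"
        using intf by (subst (asm) distr_Q[symmetric], subst (asm) integrable_distr_eq) auto
      have eqf: "(LINT x|\<sigma>. f x) = (LINT w|?R. f (Q w))"
        by (subst distr_Q[symmetric], subst integral_distr) auto
      let ?k = "\<lambda>w. nat \<lfloor>real n * w\<rfloor>"
      have "\<bar>(\<Sum>i<n. f (y i)) / real n - (LINT x|\<sigma>. f x)\<bar> = \<bar>LINT w|?R. f (y (?k w)) - f (Q w)\<bar>"
        unfolding eqf using integral_step_unit[OF assms(2), of "\<lambda>i. f (y i)"] intf' by simp
      also have "\<dots> \<le> (LINT w|?R. \<bar>f (y (?k w)) - f (Q w)\<bar>)" by (rule integral_abs_bound)
      also have "\<dots> \<le> (LINT w|?R. L * (u (Suc (?k w)) - u (?k w)))"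
      proof (rule integral_mono)
        show "integrable ?R (\<lambda>w. \<bar>f (y (?k w)) - f (Q w)\<bar>)"
          using integral_step_unit(1)[OF assms(2), of "\<lambda>i. f (y i)"] intf' by auto
        show "integrable ?R (\<lambda>w. L * (u (Suc (?k w)) - u (?k w)))"
          using integral_step_unit(1)[OF assms(2), of "\<lambda>i. L * (u (Suc i) - u i)"] .
        fix w assume "w \<in> space ?R"
        then have w: "0 < w" "w < 1" by (auto simp: space_restrict_space)
        have k: "real (?k w) \<le> real n * w" "real n * w \<le> real (Suc (?k w))"
        proof -
          have "0 \<le> real n * w" using w by simp
          from nat_floor_bounds[OF this]
          show "real (?k w) \<le> real n * w" "real n * w \<le> real (Suc (?k w))"
            unfolding of_nat_Suc by linarith+
        qed
        have "real n * w < real n * 1" using w assms by (intro mult_strict_left_mono) auto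
        then have kn: "?k w < n" using k(1) by linarith
        have "\<bar>y (?k w) - Q w\<bar> \<le> u (Suc (?k w)) - u (?k w)"
          using between[OF w k] between[OF y_in[OF kn], of "?k w"] assms(2) unfolding y_def by (auto simp: abs_le_iff)
        moreover have "\<bar>f (y (?k w)) - f (Q w)\<bar> \<le> L * \<bar>y (?k w) - Q w\<bar>"
          using I_ab[OF w] I_ab[OF y_in[OF kn]] by (intro L) (auto simp: y_def)
        ultimately show "\<bar>f (y (?k w)) - f (Q w)\<bar> \<le> L * (u (Suc (?k w)) - u (?k w))"
          using \<open>0 \<le> L\<close> by (meson mult_left_mono order_trans)
      qed
      also have "\<dots> = (\<Sum>i<n. L * (u (Suc i) - u i)) / real n"
        using integral_step_unit(2)[OF assms(2), of "\<lambda>i. L * (u (Suc i) - u i)"] .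
      also have "\<dots> = L * (b - a) / real n"
      proof -
        have "u n = b" "u 0 = a" using assms(2) by (auto simp: u_def)
        then show ?thesis by (simp only: sum_distrib_left[symmetric] sum_lessThan_telescope)
      qed
      finally show ?thesis .
    qed
  qed
qed

section \<open>Monic polynomials with prescribed zeros\<close>

definition root_poly :: "real set \<Rightarrow> real poly" where
  "root_poly Z = (\<Prod>z\<in>Z. [:- z, 1:])"

lemma poly_root_poly: "poly (root_poly Z) x = (\<Prod>z\<in>Z. x - z)"
  by (simp add: root_poly_def poly_prod)

lemma root_poly_insert: "finite Z \<Longrightarrow> z \<notin> Z \<Longrightarrow> root_poly (insert z Z) = [:- z, 1:] * root_poly Z"
  by (simp add: root_poly_def)

lemma root_poly_remove: "finite Z \<Longrightarrow> z \<in> Z \<Longrightarrow> root_poly Z = [:- z, 1:] * root_poly (Z - {z})"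
  by (simp add: root_poly_def prod.remove)

lemma root_poly_union: "finite Z \<Longrightarrow> finite Z' \<Longrightarrow> Z \<inter> Z' = {} \<Longrightarrow> root_poly (Z \<union> Z') = root_poly Z * root_poly Z'"
  by (simp add: root_poly_def prod.union_disjoint)

lemma lead_coeff_root_poly: "lead_coeff (root_poly Z) = 1"
  by (simp add: root_poly_def lead_coeff_prod)

lemma root_poly_neq_0 [simp]: "root_poly Z \<noteq> 0"
  using lead_coeff_root_poly[of Z] by auto

lemma degree_root_poly: "finite Z \<Longrightarrow> degree (root_poly Z) = card Z"
proof (induction Z rule: finite_induct)
  case (insert z Z)
  have "degree ([:- z, 1:] * root_poly Z) = degree [:- z, 1:] + degree (root_poly Z)"
    by (rule degree_mult_eq) auto
  then show ?case using insert by (simp add: root_poly_insert)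
qed (simp add: root_poly_def)

lemma poly_root_poly_eq_0_iff: "finite Z \<Longrightarrow> poly (root_poly Z) x = 0 \<longleftrightarrow> x \<in> Z"
  by (auto simp: poly_root_poly)

lemma borel_measurable_poly [measurable]: "poly p \<in> borel_measurable (borel :: real measure)"
  by (rule borel_measurable_continuous_onI) (intro continuous_intros)

text \<open>The difference has degree below \<open>card Z\<close> but vanishes on
  \<open>Z\<close>.\<close>

lemma poly_eq_smult_root_poly:
  assumes "finite Z" "degree p \<le> card Z" "\<And>z. z \<in> Z \<Longrightarrow> poly p z = 0"
  shows "p = smult (poly.coeff p (card Z)) (root_poly Z)"
proof (rule ccontr)
  let ?q = "p - smult (poly.coeff p (card Z)) (root_poly Z)"
  assume "p \<noteq> smult (poly.coeff p (card Z)) (root_poly Z)"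
  then have q: "?q \<noteq> 0" by simp
  have "poly.coeff (root_poly Z) (card Z) = 1" using lead_coeff_root_poly[of Z] degree_root_poly[OF assms(1)] by simp
  then have c: "poly.coeff ?q (card Z) = 0" by simp
  have "degree ?q \<le> card Z" using assms(1,2) degree_root_poly[OF assms(1)]
    by (intro degree_diff_le) (auto intro: order_trans[OF degree_smult_le])
  with c q have d: "degree ?q < card Z" by (metis le_neq_implies_less leading_coeff_0_iff)
  have "Z \<subseteq> {x. poly ?q x = 0}" using assms(1,3) by (auto simp: poly_root_poly_eq_0_iff)
  then have "card Z \<le> card {x. poly ?q x = 0}" using poly_roots_finite[OF q] by (rule card_mono[rotated])
  also have "\<dots> \<le> degree ?q" by (rule card_poly_roots_bound[OF q])
  finally show False using d by simp
qed

text \<open>\<open>Z\<close> consists of the zeros at which \<open>p\<close> changes sign. The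
  induction splits off one linear factor and toggles its zero: a zero already present is removed, a
  new one is added and completes a square.\<close>

lemma poly_sign_fix:
  fixes p :: "real poly"
  assumes "p \<noteq> 0" "a < b"
  shows "\<exists>Z. finite Z \<and> Z \<subseteq> {a<..<b} \<and> (\<forall>z\<in>Z. poly p z = 0) \<and>
    ((\<forall>x\<in>{a..b}. 0 \<le> poly (p * root_poly Z) x) \<or> (\<forall>x\<in>{a..b}. poly (p * root_poly Z) x \<le> 0))"
  using assms(1)
proof (induction "degree p" arbitrary: p rule: less_induct)
  case less
  show ?case
  proof (cases "\<exists>z\<in>{a<..<b}. poly p z = 0")
    case False
    have "\<not> (x \<in> {a..b} \<and> y \<in> {a..b} \<and> poly p x < 0 \<and> 0 < poly p y)" for x y
    proof
      assume *: "x \<in> {a..b} \<and> y \<in> {a..b} \<and> poly p x < 0 \<and> 0 < poly p y"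
      then consider "x < y" | "y < x" by (metis linorder_neqE_linordered_idom order_less_asym)
      then show False
      proof cases
        case 1 then show False using poly_IVT_pos[of x y p] * False by force
      next
        case 2 then show False using poly_IVT_neg[of y x p] * False by force
      qed
    qed
    then have "(\<forall>x\<in>{a..b}. 0 \<le> poly p x) \<or> (\<forall>x\<in>{a..b}. poly p x \<le> 0)"
      by (meson linorder_not_le)
    moreover have "p * root_poly {} = p" by (simp add: root_poly_def)
    ultimately have "(\<forall>x\<in>{a..b}. 0 \<le> poly (p * root_poly {}) x) \<or> (\<forall>x\<in>{a..b}. poly (p * root_poly {}) x \<le> 0)"
      by metis
    then show ?thesis by (intro exI[of _ "{}"]) simp
  next
    case True
    then obtain z where z: "z \<in> {a<..<b}" "poly p z = 0" by auto
    then obtain p' where p': "p = [:- z, 1:] * p'" using poly_eq_0_iff_dvd by (metis dvdE)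
    have "p' \<noteq> 0" using less.prems p' by auto
    have "degree p = degree [:- z, 1:] + degree p'"
      unfolding p' using \<open>p' \<noteq> 0\<close> by (intro degree_mult_eq) auto
    then have "degree p' < degree p" by simp
    from less.hyps[OF this \<open>p' \<noteq> 0\<close>] obtain Z where Z: "finite Z" "Z \<subseteq> {a<..<b}" "\<forall>z\<in>Z. poly p' z = 0"
      "(\<forall>x\<in>{a..b}. 0 \<le> poly (p' * root_poly Z) x) \<or> (\<forall>x\<in>{a..b}. poly (p' * root_poly Z) x \<le> 0)"
      by blast
    show ?thesis
    proof (cases "z \<in> Z")
      case True
      have "p * root_poly (Z - {z}) = p' * root_poly Z" unfolding p' root_poly_remove[OF Z(1) True] by (simp add: algebra_simps)
      moreover have "poly p z' = 0" if "z' \<in> Z" for z' using Z(3) that p' by simp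
      ultimately show ?thesis using Z by (intro exI[of _ "Z - {z}"]) (simp, blast)
    next
      case False
      have eq: "poly (p * root_poly (insert z Z)) x = (x - z)\<^sup>2 * poly (p' * root_poly Z) x" for x
        unfolding p' root_poly_insert[OF Z(1) False] by (simp add: algebra_simps power2_eq_square)
      have "(\<forall>x\<in>{a..b}. 0 \<le> poly (p * root_poly (insert z Z)) x) \<or> (\<forall>x\<in>{a..b}. poly (p * root_poly (insert z Z)) x \<le> 0)"
        using Z(4) unfolding eq by (meson mult_nonneg_nonneg mult_nonneg_nonpos zero_le_power2)
      moreover have "poly p z' = 0" if "z' \<in> insert z Z" for z' using Z(3) that p' z(2) by auto
      ultimately show ?thesis using Z(1,2) z(1) by (intro exI[of _ "insert z Z"]) blast
    qed
  qed
qed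

text \<open>Gaussian elimination, one equation at a time. It yields the existence of the multiple
  orthogonal polynomial: 2n conditions on 2n + 1 coefficients.\<close>

lemma underdetermined_system:
  fixes A :: "'k \<Rightarrow> 'i \<Rightarrow> real"
  assumes "finite K" "finite I" "card K < card I"
  shows "\<exists>c. (\<exists>i\<in>I. c i \<noteq> 0) \<and> (\<forall>k\<in>K. (\<Sum>i\<in>I. A k i * c i) = 0)"
  using assms
proof (induction K arbitrary: I A rule: finite_induct)
  case empty
  then obtain i where "i \<in> I" by (metis card_gt_0_iff card.empty ex_in_conv)
  then show ?case by (intro exI[of _ "\<lambda>_. 1"]) auto
next
  case (insert k0 K)
  show ?case
  proof (cases "\<forall>i\<in>I. A k0 i = 0")
    case True
    have "card K < card I" using insert.prems insert.hyps by simp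
    from insert.IH[OF insert.prems(1) this, of A] obtain c
      where "\<exists>i\<in>I. c i \<noteq> 0" "\<forall>k\<in>K. (\<Sum>i\<in>I. A k i * c i) = 0" by blast
    moreover have "(\<Sum>i\<in>I. A k0 i * c i) = 0" using True by (intro sum.neutral) simp
    ultimately show ?thesis by (intro exI[of _ c]) blast
  next
    case False
    then obtain i0 where i0: "i0 \<in> I" "A k0 i0 \<noteq> 0" by auto
    define J where "J = I - {i0}"
    have J: "finite J" "card K < card J" "i0 \<notin> J" "I = insert i0 J"
      using insert.prems insert.hyps i0 by (auto simp: J_def)
    \<comment> \<open>The coefficients that remain after solving the equation \<open>k0\<close> for
      the unknown \<open>i0\<close> and substituting into the others.\<close>
    from insert.IH[OF J(1,2), of "\<lambda>k i. A k i - A k i0 * A k0 i / A k0 i0"] obtain c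
      where c: "\<exists>i\<in>J. c i \<noteq> 0" "\<And>k. k \<in> K \<Longrightarrow> (\<Sum>i\<in>J. (A k i - A k i0 * A k0 i / A k0 i0) * c i) = 0"
      by blast
    define s where "s = - (\<Sum>i\<in>J. A k0 i * c i) / A k0 i0"
    define c' where "c' = c(i0 := s)"
    have sum: "(\<Sum>i\<in>I. A k i * c' i) = A k i0 * s + (\<Sum>i\<in>J. A k i * c i)" for k
    proof -
      have "(\<Sum>i\<in>J. A k i * c' i) = (\<Sum>i\<in>J. A k i * c i)" using J(3) by (intro sum.cong) (auto simp: c'_def)
      moreover have "(\<Sum>i\<in>I. A k i * c' i) = A k i0 * c' i0 + (\<Sum>i\<in>J. A k i * c' i)"
        using J by (simp only: J(4) sum.insert not_False_eq_True)
      ultimately show ?thesis by (simp add: c'_def)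
    qed
    have "(\<Sum>i\<in>I. A k i * c' i) = 0" if "k \<in> K" for k
    proof -
      have "0 = (\<Sum>i\<in>J. A k i * c i - A k i0 / A k0 i0 * (A k0 i * c i))"
        unfolding c(2)[OF that, symmetric] by (intro sum.cong) (simp_all add: left_diff_distrib)
      also have "\<dots> = (\<Sum>i\<in>J. A k i * c i) - A k i0 / A k0 i0 * (\<Sum>i\<in>J. A k0 i * c i)"
        by (simp add: sum_subtractf sum_distrib_left)
      finally show ?thesis unfolding sum s_def by (simp add: algebra_simps)
    qed
    moreover have "(\<Sum>i\<in>I. A k0 i * c' i) = 0" unfolding sum s_def using i0 by simp
    moreover have "\<exists>i\<in>I. c' i \<noteq> 0"
    proof -
      from c(1) obtain i where "i \<in> J" "c i \<noteq> 0" by blast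
      then show ?thesis using J(3) by (intro bexI[of _ i]) (auto simp: c'_def J_def)
    qed
    ultimately show ?thesis by (intro exI[of _ c']) blast
  qed
qed

section \<open>Measures with positive density on an interval\<close>

locale ac_measure =
  fixes a b :: real and \<mu> :: "real measure" and w :: "real \<Rightarrow> real"
  assumes ab: "a < b" and fin: "finite_measure \<mu>" and sets_\<mu> [measurable_cong]: "sets \<mu> = sets borel"
    and supp_\<mu>: "supp \<mu> \<subseteq> {a..b}" and ac: "ac_density \<mu> w"
    and pos: "AE t in lborel. t \<in> {a..b} \<longrightarrow> 0 < w t"
begin

lemma AE_ab: "AE x in \<mu>. x \<in> {a..b}"
  by (rule AE_in_interval[OF sets_\<mu> supp_\<mu>])

lemma w_measurable [measurable]: "w \<in> borel_measurable borel" and w_nonneg: "0 \<le> w x"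
  using ac by (auto simp: ac_density_def)

lemma space_\<mu> [simp]: "space \<mu> = UNIV"
  using sets_eq_imp_space_eq[OF sets_\<mu>] by simp

text \<open>The singular part only adds mass.\<close>

lemma nn_integral_ge_density:
  assumes [measurable]: "f \<in> borel_measurable borel"
  shows "(\<integral>\<^sup>+x. ennreal (w x) * f x \<partial>lborel) \<le> (\<integral>\<^sup>+x. f x \<partial>\<mu>)"
proof -
  obtain S where "\<forall>A \<in> sets borel. emeasure \<mu> A = emeasure (density lborel (\<lambda>x. ennreal (w x))) A + emeasure S A"
    using ac unfolding ac_density_def by blast
  then have "density lborel (\<lambda>x. ennreal (w x)) \<le> \<mu>"
    by (subst le_measure) (auto simp: sets_\<mu>)
  then have "(\<integral>\<^sup>+x. f x \<partial>density lborel (\<lambda>x. ennreal (w x))) \<le> (\<integral>\<^sup>+x. f x \<partial>\<mu>)"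
    by (intro nn_integral_mono_measure) (auto simp: sets_\<mu>)
  then show ?thesis by (subst (asm) nn_integral_density) auto
qed

lemma continuous_integrable:
  fixes f :: "real \<Rightarrow> real"
  assumes "continuous_on UNIV f"
  shows "integrable \<mu> f"
proof -
  interpret finite_measure \<mu> by (rule fin)
  have "compact (f ` {a..b})" by (intro compact_continuous_image continuous_on_subset[OF assms]) auto
  then obtain B where B: "\<And>x. x \<in> {a..b} \<Longrightarrow> norm (f x) \<le> B"
    using compact_imp_bounded bounded_iff by (metis image_eqI)
  have "AE x in \<mu>. norm (f x) \<le> B" using AE_ab by eventually_elim (rule B)
  then show ?thesis
    using borel_measurable_continuous_onI[OF assms] by (intro integrable_const_bound) auto
qed

lemma poly_integrable: "integrable \<mu> (poly p)"
  by (rule continuous_integrable) (intro continuous_intros)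

lemma integral_cong_ab:
  fixes f g :: "real \<Rightarrow> real"
  assumes "f \<in> borel_measurable borel" "g \<in> borel_measurable borel" "\<And>x. x \<in> {a..b} \<Longrightarrow> f x = g x"
  shows "(LINT x|\<mu>. f x) = (LINT x|\<mu>. g x)"
proof (rule integral_cong_AE)
  show "AE x in \<mu>. f x = g x" using AE_ab by eventually_elim (rule assms(3))
qed (use assms in auto)

lemma integral_mono_ab:
  fixes f g :: "real \<Rightarrow> real"
  assumes "continuous_on UNIV f" "continuous_on UNIV g" "\<And>x. x \<in> {a..b} \<Longrightarrow> f x \<le> g x"
  shows "(LINT x|\<mu>. f x) \<le> (LINT x|\<mu>. g x)"
proof (rule integral_mono_AE)
  show "AE x in \<mu>. f x \<le> g x" using AE_ab by eventually_elim (rule assms(3))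
qed (use assms continuous_integrable in auto)

text \<open>A nonzero polynomial has finitely many zeros. If it vanished \<open>\<mu>\<close>-almost
  everywhere, the density would be zero almost everywhere on an interval of positive length.\<close>

lemma nonneg_poly_integral_0:
  assumes "\<And>x. x \<in> {a..b} \<Longrightarrow> 0 \<le> poly p x" "(LINT x|\<mu>. poly p x) = 0"
  shows "p = 0"
proof (rule ccontr)
  assume "p \<noteq> 0"
  have "AE x in \<mu>. 0 \<le> poly p x" using AE_ab by eventually_elim (rule assms(1))
  then have "AE x in \<mu>. poly p x = 0"
    using integral_nonneg_eq_0_iff_AE[OF poly_integrable] assms(2) by blast
  then have "(\<integral>\<^sup>+x. indicator {x. poly p x \<noteq> 0} x \<partial>\<mu>) = (\<integral>\<^sup>+x. 0 \<partial>\<mu>)"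
    by (intro nn_integral_cong_AE) (auto elim!: eventually_mono)
  then have "(\<integral>\<^sup>+x. ennreal (w x) * indicator {x. poly p x \<noteq> 0} x \<partial>lborel) = 0"
    using nn_integral_ge_density[of "indicator {x. poly p x \<noteq> 0}"] by simp
  then have "AE x in lborel. ennreal (w x) * indicator {x. poly p x \<noteq> 0} x = 0"
    by (subst (asm) nn_integral_0_iff_AE) auto
  moreover have "AE x in lborel. poly p x \<noteq> 0"
    using poly_roots_finite[OF \<open>p \<noteq> 0\<close>] by (intro AE_I'[of "{x. poly p x = 0}"]) (auto intro: finite_imp_null_set_lborel)
  ultimately have "AE x in lborel. x \<notin> {a..b}"
    using pos
  proof eventually_elim
    case (elim x)
    then show ?case using w_nonneg[of x] by (auto simp: ennreal_eq_0_iff)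
  qed
  then have "emeasure lborel {a..b} = 0" by (subst (asm) AE_iff_measurable[of "{a..b}"]) auto
  then show False using ab by simp
qed

lemma orth_poly:
  assumes "\<And>k. k < n \<Longrightarrow> (LINT x|\<mu>. poly p x * x ^ k) = 0" "degree h < n"
  shows "(LINT x|\<mu>. poly (p * h) x) = 0"
proof -
  have "(LINT x|\<mu>. poly (p * h) x) = (LINT x|\<mu>. (\<Sum>i\<le>degree h. poly.coeff h i * (poly p x * x ^ i)))"
    by (simp add: poly_altdef[of h] sum_distrib_left algebra_simps)
  also have "\<dots> = (\<Sum>i\<le>degree h. poly.coeff h i * (LINT x|\<mu>. poly p x * x ^ i))"
    by (subst Bochner_Integration.integral_sum) (auto intro!: continuous_integrable continuous_intros)
  also have "\<dots> = 0" using assms by (intro sum.neutral) auto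
  finally show ?thesis .
qed

text \<open>With fewer than \<open>n\<close> sign changes, the product with the polynomial vanishing
  at these would have one sign and yet integral zero by orthogonality.\<close>

lemma orth_zeros:
  assumes "\<And>k. k < n \<Longrightarrow> (LINT x|\<mu>. poly p x * x ^ k) = 0" "p \<noteq> 0"
  shows "\<exists>Z. finite Z \<and> Z \<subseteq> {a<..<b} \<and> (\<forall>z\<in>Z. poly p z = 0) \<and> card Z = n"
proof -
  obtain Z where Z: "finite Z" "Z \<subseteq> {a<..<b}" "\<forall>z\<in>Z. poly p z = 0"
    "(\<forall>x\<in>{a..b}. 0 \<le> poly (p * root_poly Z) x) \<or> (\<forall>x\<in>{a..b}. poly (p * root_poly Z) x \<le> 0)"
    using poly_sign_fix[OF assms(2) ab] by blast
  have "n \<le> card Z"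
  proof (rule ccontr)
    assume "\<not> n \<le> card Z"
    then have 0: "(LINT x|\<mu>. poly (p * root_poly Z) x) = 0"
      using Z(1) by (intro orth_poly[OF assms(1)]) (auto simp: degree_root_poly)
    have "p * root_poly Z = 0"
      using Z(4)
    proof
      assume "\<forall>x\<in>{a..b}. 0 \<le> poly (p * root_poly Z) x"
      then show ?thesis using nonneg_poly_integral_0[of "p * root_poly Z"] 0 by blast
    next
      assume "\<forall>x\<in>{a..b}. poly (p * root_poly Z) x \<le> 0"
      then have "- (p * root_poly Z) = 0" using 0 by (intro nonneg_poly_integral_0) (auto simp del: poly_mult)
      then show ?thesis by simp
    qed
    then show False using assms(2) by simp
  qed
  then obtain Z' where "Z' \<subseteq> Z" "card Z' = n" using obtain_subset_with_card_n by blast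
  then show ?thesis using Z finite_subset by (intro exI[of _ Z']) blast
qed

text \<open>Pythagoras in the weight \<bar>q\<bar>: competitors differ from \<open>p\<close> by a
  polynomial of degree below \<open>n\<close>, and since \<open>q\<close> has the constant sign
  \<open>s\<close>, orthogonality with \<open>q\<close> removes the cross term.\<close>

lemma orth_minimal:
  assumes orth: "\<And>h. degree h < n \<Longrightarrow> (LINT x|\<mu>. poly (p * q * h) x) = 0"
    and p: "degree p = n" "lead_coeff p = 1" and R: "degree R = n" "lead_coeff R = 1" "0 < n"
    and s: "\<And>x. x \<in> {a..b} \<Longrightarrow> \<bar>poly q x\<bar> = s * poly q x"
  shows "(LINT x|\<mu>. (poly p x)\<^sup>2 * \<bar>poly q x\<bar>) \<le> (LINT x|\<mu>. (poly R x)\<^sup>2 * \<bar>poly q x\<bar>)"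
proof -
  define h where "h = R - p"
  have "poly.coeff h n = 0" using p R by (simp add: h_def)
  moreover have "degree h \<le> n" unfolding h_def using p R by (intro degree_diff_le) auto
  ultimately have h: "degree h < n" using R(3) by (metis degree_0 le_neq_implies_less leading_coeff_0_iff)
  have "(LINT x|\<mu>. (poly R x)\<^sup>2 * \<bar>poly q x\<bar>) =
    (LINT x|\<mu>. (poly p x)\<^sup>2 * \<bar>poly q x\<bar> + 2 * s * poly (p * q * h) x + (poly h x)\<^sup>2 * \<bar>poly q x\<bar>)"
  proof (rule integral_cong_ab)
    fix x assume "x \<in> {a..b}"
    have "poly R x = poly p x + poly h x" by (simp add: h_def)
    then show "(poly R x)\<^sup>2 * \<bar>poly q x\<bar> = (poly p x)\<^sup>2 * \<bar>poly q x\<bar> + 2 * s * poly (p * q * h) x + (poly h x)\<^sup>2 * \<bar>poly q x\<bar>"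
      by (simp add: s[OF \<open>x \<in> {a..b}\<close>] algebra_simps power2_eq_square)
  qed auto
  also have "\<dots> = (LINT x|\<mu>. (poly p x)\<^sup>2 * \<bar>poly q x\<bar>) + 2 * s * (LINT x|\<mu>. poly (p * q * h) x)
      + (LINT x|\<mu>. (poly h x)\<^sup>2 * \<bar>poly q x\<bar>)"
    by (subst Bochner_Integration.integral_add, (intro continuous_integrable continuous_intros)+)+
      (simp del: poly_mult)
  finally show ?thesis using orth[OF h] by simp
qed

text \<open>Extremal property of the Christoffel function at a zero of the orthogonal polynomial:
  for a prescribed value at \<open>\<xi>\<close>, the weighted norm in degree below \<open>n\<close>
  is smallest for a multiple of the polynomial without its factor at \<open>\<xi>\<close>. The
  inequality is multiplied out, so no norm occurs in a denominator.\<close>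

lemma orth_christoffel:
  assumes orth: "\<And>h. degree h < n \<Longrightarrow> (LINT x|\<mu>. poly (root_poly Z * q * h) x) = 0"
    and Z: "finite Z" "card Z = n" "\<xi> \<in> Z" and R: "degree R < n"
    and s: "\<And>x. x \<in> {a..b} \<Longrightarrow> \<bar>poly q x\<bar> = s * poly q x"
  shows "(poly R \<xi>)\<^sup>2 * (LINT x|\<mu>. (poly (root_poly (Z - {\<xi>})) x)\<^sup>2 * \<bar>poly q x\<bar>)
    \<le> (poly (root_poly (Z - {\<xi>})) \<xi>)\<^sup>2 * (LINT x|\<mu>. (poly R x)\<^sup>2 * \<bar>poly q x\<bar>)"
proof -
  let ?r = "root_poly (Z - {\<xi>})"
  have r0: "poly ?r \<xi> \<noteq> 0" using Z by (simp add: poly_root_poly_eq_0_iff)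
  define c where "c = poly R \<xi> / poly ?r \<xi>"
  define g where "g = R - smult c ?r"
  have "poly g \<xi> = 0" using r0 by (simp add: g_def c_def)
  \<comment> \<open>As \<open>g\<close> contains the factor that \<open>?r\<close> lacks, the cross
    term \<open>g * ?r\<close> equals \<open>h * root_poly Z\<close>, to which orthogonality
    applies.\<close>
  then obtain h where h: "g = [:- \<xi>, 1:] * h" using poly_eq_0_iff_dvd by (metis dvdE)
  have "degree ?r = n - 1" using Z by (simp add: degree_root_poly)
  then have dg: "degree g < n" using R unfolding g_def
    by (intro degree_diff_less) (auto intro: le_less_trans[OF degree_smult_le])
  have "degree h \<le> degree g"
  proof (cases "h = 0")
    case False
    have "degree g = degree [:- \<xi>, 1:] + degree h" unfolding h using False by (intro degree_mult_eq) auto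
    then show ?thesis by simp
  qed simp
  then have h_deg: "degree h < n" using dg by simp
  have "(LINT x|\<mu>. (poly R x)\<^sup>2 * \<bar>poly q x\<bar>) =
    (LINT x|\<mu>. (poly g x)\<^sup>2 * \<bar>poly q x\<bar> + 2 * c * s * poly (root_poly Z * q * h) x + c\<^sup>2 * ((poly ?r x)\<^sup>2 * \<bar>poly q x\<bar>))"
  proof (rule integral_cong_ab)
    fix x assume "x \<in> {a..b}"
    have 1: "poly R x = poly g x + c * poly ?r x" by (simp add: g_def)
    have 2: "poly (root_poly Z * q * h) x = poly g x * poly ?r x * poly q x"
      unfolding h root_poly_remove[OF Z(1,3)] by (simp add: algebra_simps)
    show "(poly R x)\<^sup>2 * \<bar>poly q x\<bar> = (poly g x)\<^sup>2 * \<bar>poly q x\<bar> + 2 * c * s * poly (root_poly Z * q * h) x + c\<^sup>2 * ((poly ?r x)\<^sup>2 * \<bar>poly q x\<bar>)"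
      unfolding 1 2 by (simp add: s[OF \<open>x \<in> {a..b}\<close>] algebra_simps power2_eq_square)
  qed auto
  also have "\<dots> = (LINT x|\<mu>. (poly g x)\<^sup>2 * \<bar>poly q x\<bar>) + 2 * c * s * (LINT x|\<mu>. poly (root_poly Z * q * h) x)
      + c\<^sup>2 * (LINT x|\<mu>. (poly ?r x)\<^sup>2 * \<bar>poly q x\<bar>)"
    by (subst Bochner_Integration.integral_add, (intro continuous_integrable continuous_intros)+)+
      (simp del: poly_mult)
  finally have "c\<^sup>2 * (LINT x|\<mu>. (poly ?r x)\<^sup>2 * \<bar>poly q x\<bar>) \<le> (LINT x|\<mu>. (poly R x)\<^sup>2 * \<bar>poly q x\<bar>)"
    using orth[OF h_deg] by simp
  then have "(poly ?r \<xi>)\<^sup>2 * (c\<^sup>2 * (LINT x|\<mu>. (poly ?r x)\<^sup>2 * \<bar>poly q x\<bar>)) \<le> (poly ?r \<xi>)\<^sup>2 * (LINT x|\<mu>. (poly R x)\<^sup>2 * \<bar>poly q x\<bar>)"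
    by (intro mult_left_mono) auto
  moreover have "(poly ?r \<xi>)\<^sup>2 * c\<^sup>2 = (poly R \<xi>)\<^sup>2" using r0 by (simp add: c_def power_divide)
  ultimately show ?thesis by (simp add: mult.assoc[symmetric])
qed

end

section \<open>Multiple orthogonal polynomials and quadrature weights\<close>

lemma abs_root_poly_left:
  assumes "\<And>z. z \<in> Z \<Longrightarrow> x < z"
  shows "\<bar>poly (root_poly Z) x\<bar> = (- 1) ^ card Z * poly (root_poly Z) x"
proof -
  have "\<bar>poly (root_poly Z) x\<bar> = (\<Prod>z\<in>Z. - 1 * (x - z))"
    unfolding poly_root_poly abs_prod by (intro prod.cong refl) (simp add: assms abs_of_neg)
  then show ?thesis by (simp only: prod.distrib prod_constant poly_root_poly)
qed

lemma abs_root_poly_right: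
  assumes "\<And>z. z \<in> Z \<Longrightarrow> z < x"
  shows "\<bar>poly (root_poly Z) x\<bar> = 1 * poly (root_poly Z) x"
  unfolding poly_root_poly abs_prod mult_1 by (intro prod.cong refl) (simp add: assms abs_of_pos)

text \<open>Any nonzero solution of degree at most 2n has \<open>n\<close> zeros in each interval,
  so it is a multiple of the product of linear factors (\<open>struct\<close>). For an existing
  solution this gives the normalization, for the difference of two monic solutions it gives
  uniqueness.\<close>

lemma mop_structure:
  assumes "ac_measure a\<^sub>1 b\<^sub>1 \<mu>\<^sub>1 w\<^sub>1" "ac_measure a\<^sub>2 b\<^sub>2 \<mu>\<^sub>2 w\<^sub>2" "b\<^sub>1 < a\<^sub>2"
  obtains Z\<^sub>1 Z\<^sub>2 where "finite Z\<^sub>1" "finite Z\<^sub>2" "card Z\<^sub>1 = n" "card Z\<^sub>2 = n" "Z\<^sub>1 \<subseteq> {a\<^sub>1<..<b\<^sub>1}" "Z\<^sub>2 \<subseteq> {a\<^sub>2<..<b\<^sub>2}"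
    "mop \<mu>\<^sub>1 \<mu>\<^sub>2 n = root_poly Z\<^sub>1 * root_poly Z\<^sub>2"
    "\<And>h. degree h < n \<Longrightarrow> (LINT x|\<mu>\<^sub>1. poly (root_poly Z\<^sub>1 * root_poly Z\<^sub>2 * h) x) = 0"
    "\<And>h. degree h < n \<Longrightarrow> (LINT x|\<mu>\<^sub>2. poly (root_poly Z\<^sub>2 * root_poly Z\<^sub>1 * h) x) = 0"
proof -
  interpret m1: ac_measure a\<^sub>1 b\<^sub>1 \<mu>\<^sub>1 w\<^sub>1 by fact
  interpret m2: ac_measure a\<^sub>2 b\<^sub>2 \<mu>\<^sub>2 w\<^sub>2 by fact
  define orth where "orth p \<longleftrightarrow> (\<forall>k<n. (LINT x|\<mu>\<^sub>1. poly p x * x ^ k) = 0 \<and> (LINT x|\<mu>\<^sub>2. poly p x * x ^ k) = 0)" for p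
  have struct: "\<exists>Z\<^sub>1 Z\<^sub>2. finite Z\<^sub>1 \<and> finite Z\<^sub>2 \<and> card Z\<^sub>1 = n \<and> card Z\<^sub>2 = n \<and> Z\<^sub>1 \<subseteq> {a\<^sub>1<..<b\<^sub>1} \<and> Z\<^sub>2 \<subseteq> {a\<^sub>2<..<b\<^sub>2}
      \<and> p = smult (poly.coeff p (2 * n)) (root_poly Z\<^sub>1 * root_poly Z\<^sub>2)" if p: "orth p" "p \<noteq> 0" "degree p \<le> 2 * n" for p
  proof -
    obtain Z\<^sub>1 where Z1: "finite Z\<^sub>1" "Z\<^sub>1 \<subseteq> {a\<^sub>1<..<b\<^sub>1}" "\<forall>z\<in>Z\<^sub>1. poly p z = 0" "card Z\<^sub>1 = n"
      using m1.orth_zeros[of n p] p(1,2) unfolding orth_def by blast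
    obtain Z\<^sub>2 where Z2: "finite Z\<^sub>2" "Z\<^sub>2 \<subseteq> {a\<^sub>2<..<b\<^sub>2}" "\<forall>z\<in>Z\<^sub>2. poly p z = 0" "card Z\<^sub>2 = n"
      using m2.orth_zeros[of n p] p(1,2) unfolding orth_def by blast
    have disj: "Z\<^sub>1 \<inter> Z\<^sub>2 = {}" using Z1 Z2 assms(3) by force
    then have card: "card (Z\<^sub>1 \<union> Z\<^sub>2) = 2 * n" using Z1 Z2 by (simp add: card_Un_disjoint)
    have "p = smult (poly.coeff p (card (Z\<^sub>1 \<union> Z\<^sub>2))) (root_poly (Z\<^sub>1 \<union> Z\<^sub>2))"
      using Z1 Z2 p(3) by (intro poly_eq_smult_root_poly) (auto simp: card)
    then have "p = smult (poly.coeff p (2 * n)) (root_poly Z\<^sub>1 * root_poly Z\<^sub>2)"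
      using root_poly_union[OF Z1(1) Z2(1) disj] by (simp only: card)
    with Z1 Z2 show ?thesis by blast
  qed
  have "\<exists>p. orth p \<and> p \<noteq> 0 \<and> degree p \<le> 2 * n"
  proof -
    \<comment> \<open>The first \<open>n\<close> rows are the moment conditions of the first
      measure, the next \<open>n\<close> those of the second.\<close>
    define A where "A k i = (if k < n then (LINT x|\<mu>\<^sub>1. x ^ i * x ^ k) else (LINT x|\<mu>\<^sub>2. x ^ i * x ^ (k - n)))" for k i :: nat
    obtain c where c: "\<exists>i\<in>{..2*n}. c i \<noteq> 0" "\<And>k. k < 2 * n \<Longrightarrow> (\<Sum>i\<le>2*n. A k i * c i) = 0"
    proof -
      have "card {..<2*n} < card {..2*n}" by simp
      from underdetermined_system[OF _ _ this, of A] that show ?thesis by (metis finite_atMost finite_lessThan lessThan_iff)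
    qed
    define p where "p = (\<Sum>i\<le>2*n. monom (c i) i)"
    have cp: "poly.coeff p i = (if i \<le> 2 * n then c i else 0)" for i
      by (simp add: p_def coeff_sum)
    have pp: "poly p x * x ^ k = (\<Sum>i\<le>2*n. c i * (x ^ i * x ^ k))" for x k
      by (simp add: p_def poly_sum poly_monom sum_distrib_right mult.assoc)
    have I1: "(LINT x|\<mu>\<^sub>1. poly p x * x ^ k) = (\<Sum>i\<le>2*n. c i * (LINT x|\<mu>\<^sub>1. x ^ i * x ^ k))" for k
      unfolding pp by (subst Bochner_Integration.integral_sum) (auto intro!: m1.continuous_integrable continuous_intros)
    have I2: "(LINT x|\<mu>\<^sub>2. poly p x * x ^ k) = (\<Sum>i\<le>2*n. c i * (LINT x|\<mu>\<^sub>2. x ^ i * x ^ k))" for k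
      unfolding pp by (subst Bochner_Integration.integral_sum) (auto intro!: m2.continuous_integrable continuous_intros)
    have "orth p" unfolding orth_def
    proof (intro allI impI conjI)
      fix k assume k: "k < n"
      show "(LINT x|\<mu>\<^sub>1. poly p x * x ^ k) = 0" using c(2)[of k] k unfolding I1 by (simp add: A_def mult.commute)
      show "(LINT x|\<mu>\<^sub>2. poly p x * x ^ k) = 0" using c(2)[of "n + k"] k unfolding I2 by (simp add: A_def mult.commute)
    qed
    moreover have "p \<noteq> 0" using c(1) cp by (metis atMost_iff coeff_0)
    moreover have "degree p \<le> 2 * n" by (rule degree_le) (simp add: cp)
    ultimately show ?thesis by blast
  qed
  then obtain p where p: "orth p" "p \<noteq> 0" "degree p \<le> 2 * n" by blast
  from struct[OF this] obtain Z\<^sub>1 Z\<^sub>2 where Z: "finite Z\<^sub>1" "finite Z\<^sub>2" "card Z\<^sub>1 = n" "card Z\<^sub>2 = n"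
    "Z\<^sub>1 \<subseteq> {a\<^sub>1<..<b\<^sub>1}" "Z\<^sub>2 \<subseteq> {a\<^sub>2<..<b\<^sub>2}" and eq: "p = smult (poly.coeff p (2 * n)) (root_poly Z\<^sub>1 * root_poly Z\<^sub>2)"
    by blast
  let ?P = "root_poly Z\<^sub>1 * root_poly Z\<^sub>2"
  have c0: "poly.coeff p (2 * n) \<noteq> 0" using p(2) eq by (metis smult_0_left)
  have degP: "degree ?P = 2 * n" using Z by (simp add: degree_mult_eq degree_root_poly)
  have lcP: "lead_coeff ?P = 1" by (simp only: lead_coeff_mult lead_coeff_root_poly)
  have orthP: "orth ?P"
  proof -
    have "poly p x = poly.coeff p (2 * n) * poly ?P x" for x by (subst eq) simp
    then show ?thesis using p(1) c0 unfolding orth_def by (simp add: mult.assoc)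
  qed
  have uniq: "P = ?P" if "degree P = 2 * n" "lead_coeff P = 1" "orth P" for P
  proof (rule ccontr)
    assume "P \<noteq> ?P"
    then have d0: "P - ?P \<noteq> 0" by simp
    have "orth (P - ?P)" unfolding orth_def
    proof (intro allI impI conjI)
      fix k assume k: "k < n"
      have "(LINT x|\<mu>\<^sub>1. poly (P - ?P) x * x ^ k) = (LINT x|\<mu>\<^sub>1. poly P x * x ^ k - poly ?P x * x ^ k)"
        by (simp add: left_diff_distrib)
      also have "\<dots> = (LINT x|\<mu>\<^sub>1. poly P x * x ^ k) - (LINT x|\<mu>\<^sub>1. poly ?P x * x ^ k)"
        by (intro Bochner_Integration.integral_diff m1.continuous_integrable continuous_intros)
      finally show "(LINT x|\<mu>\<^sub>1. poly (P - ?P) x * x ^ k) = 0"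
        using that(3) orthP k unfolding orth_def by simp
      have "(LINT x|\<mu>\<^sub>2. poly (P - ?P) x * x ^ k) = (LINT x|\<mu>\<^sub>2. poly P x * x ^ k - poly ?P x * x ^ k)"
        by (simp add: left_diff_distrib)
      also have "\<dots> = (LINT x|\<mu>\<^sub>2. poly P x * x ^ k) - (LINT x|\<mu>\<^sub>2. poly ?P x * x ^ k)"
        by (intro Bochner_Integration.integral_diff m2.continuous_integrable continuous_intros)
      finally show "(LINT x|\<mu>\<^sub>2. poly (P - ?P) x * x ^ k) = 0"
        using that(3) orthP k unfolding orth_def by simp
    qed
    moreover have "degree (P - ?P) \<le> 2 * n" using that(1) degP by (intro degree_diff_le) auto
    ultimately obtain Z\<^sub>1' Z\<^sub>2' where d: "P - ?P = smult (poly.coeff (P - ?P) (2 * n)) (root_poly Z\<^sub>1' * root_poly Z\<^sub>2')"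
      using struct[OF _ d0] by blast
    \<comment> \<open>The leading terms cancel, so \<open>struct\<close> presents the difference as
      the zero polynomial.\<close>
    have "poly.coeff (P - ?P) (2 * n) = 0" using that(1,2) degP lcP by simp
    from d[unfolded this smult_0_left] d0 show False by blast
  qed
  show ?thesis
  proof (rule that[OF Z])
    show "mop \<mu>\<^sub>1 \<mu>\<^sub>2 n = ?P"
      unfolding mop_def orth_def[symmetric] by (rule the_equality) (use degP lcP orthP uniq in blast)+
    show "(LINT x|\<mu>\<^sub>1. poly (?P * h) x) = 0" if "degree h < n" for h
      using orthP that unfolding orth_def by (intro m1.orth_poly[of n]) blast+
    show "(LINT x|\<mu>\<^sub>2. poly (root_poly Z\<^sub>2 * root_poly Z\<^sub>1 * h) x) = 0" if "degree h < n" for h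
      using orthP that unfolding orth_def mult.commute[of "root_poly Z\<^sub>2" "root_poly Z\<^sub>1"] by (intro m2.orth_poly[of n]) blast+
  qed
qed

text \<open>\<open>Z\<^sub>1\<close> lies to the left of \<open>Z\<^sub>2\<close>, so the two sorted
  lists can be concatenated. Zeros are numbered from 1, list entries from 0.\<close>

lemma mop_zero_nth:
  assumes "mop \<mu>\<^sub>1 \<mu>\<^sub>2 n = root_poly Z\<^sub>1 * root_poly Z\<^sub>2" "finite Z\<^sub>1" "finite Z\<^sub>2" "\<And>x y. x \<in> Z\<^sub>1 \<Longrightarrow> y \<in> Z\<^sub>2 \<Longrightarrow> x < y"
  shows "mop_zero \<mu>\<^sub>1 \<mu>\<^sub>2 n k = (sorted_list_of_set Z\<^sub>1 @ sorted_list_of_set Z\<^sub>2) ! (k - 1)"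
proof -
  have roots: "{x. poly (mop \<mu>\<^sub>1 \<mu>\<^sub>2 n) x = 0} = Z\<^sub>1 \<union> Z\<^sub>2"
    using assms(2,3) unfolding assms(1) by (auto simp: poly_root_poly_eq_0_iff)
  have "sorted_list_of_set (Z\<^sub>1 \<union> Z\<^sub>2) = sorted_list_of_set Z\<^sub>1 @ sorted_list_of_set Z\<^sub>2"
  proof (rule sorted_distinct_set_unique)
    show "sorted (sorted_list_of_set Z\<^sub>1 @ sorted_list_of_set Z\<^sub>2)"
      using assms(2-4) by (auto simp: sorted_append intro: less_imp_le)
    show "distinct (sorted_list_of_set Z\<^sub>1 @ sorted_list_of_set Z\<^sub>2)"
      using assms(2-4) by (auto dest: assms(4))
  qed (use assms(2,3) in auto)
  then show ?thesis by (simp add: mop_zero_def roots)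
qed

lemma mop_zero_upper:
  assumes "mop \<mu>\<^sub>1 \<mu>\<^sub>2 n = root_poly Z\<^sub>1 * root_poly Z\<^sub>2" "finite Z\<^sub>1" "finite Z\<^sub>2" "\<And>x y. x \<in> Z\<^sub>1 \<Longrightarrow> y \<in> Z\<^sub>2 \<Longrightarrow> x < y"
    "card Z\<^sub>1 = n" "card Z\<^sub>2 = n" "j \<in> {1..n}"
  shows "mop_zero \<mu>\<^sub>1 \<mu>\<^sub>2 n (n + j) \<in> Z\<^sub>2"
proof -
  have "mop_zero \<mu>\<^sub>1 \<mu>\<^sub>2 n (n + j) = sorted_list_of_set Z\<^sub>2 ! (j - 1)"
    using assms(5,7) by (subst mop_zero_nth[OF assms(1-4)]) (auto simp: nth_append length_sorted_list_of_set)
  also have "\<dots> \<in> set (sorted_list_of_set Z\<^sub>2)"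
    using assms(6,7) by (intro nth_mem) (auto simp: length_sorted_list_of_set)
  finally show ?thesis using assms(3) by simp
qed

lemma lagrange_poly_eq:
  assumes "mop \<mu>\<^sub>1 \<mu>\<^sub>2 n = root_poly Z\<^sub>1 * root_poly Z\<^sub>2" "finite Z\<^sub>1" "finite Z\<^sub>2" "\<And>x y. x \<in> Z\<^sub>1 \<Longrightarrow> y \<in> Z\<^sub>2 \<Longrightarrow> x < y"
    "card Z\<^sub>1 = n" "card Z\<^sub>2 = n" "j \<in> {1..n}"
  defines "\<xi> \<equiv> mop_zero \<mu>\<^sub>1 \<mu>\<^sub>2 n (n + j)"
  defines "Q \<equiv> root_poly Z\<^sub>1 * root_poly (Z\<^sub>2 - {\<xi>})"
  shows "lagrange_poly \<mu>\<^sub>1 \<mu>\<^sub>2 n (n + j) = smult (1 / poly Q \<xi>) Q"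
proof -
  let ?x = "\<lambda>i. mop_zero \<mu>\<^sub>1 \<mu>\<^sub>2 n i"
  let ?l = "sorted_list_of_set Z\<^sub>1 @ sorted_list_of_set Z\<^sub>2"
  have \<xi>: "\<xi> \<in> Z\<^sub>2" unfolding \<xi>_def by (rule mop_zero_upper[OF assms(1-7)])
  have disj: "Z\<^sub>1 \<inter> Z\<^sub>2 = {}" using assms(4) by blast
  have len: "length ?l = 2 * n" using assms(5,6) by (simp add: length_sorted_list_of_set)
  have dist: "distinct ?l" using assms(2-3) disj by auto
  have nth: "?x i = ?l ! (i - 1)" for i by (rule mop_zero_nth[OF assms(1-4)])
  have inj: "?x i = ?x k \<longleftrightarrow> i = k" if "i \<in> {1..2*n}" "k \<in> {1..2*n}" for i k
  proof -
    have "i - 1 < length ?l" "k - 1 < length ?l" using that len by auto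
    then have "?x i = ?x k \<longleftrightarrow> i - 1 = k - 1" unfolding nth by (rule nth_eq_iff_index_eq[OF dist])
    then show ?thesis using that by auto
  qed
  have surj: "\<exists>i\<in>{1..2*n}. ?x i = z" if "z \<in> Z\<^sub>1 \<union> Z\<^sub>2" for z
  proof -
    have "z \<in> set ?l" using that assms(2,3) by auto
    then obtain m where "m < length ?l" "?l ! m = z" by (metis in_set_conv_nth)
    then show ?thesis using len by (intro bexI[of _ "Suc m"]) (simp_all add: nth)
  qed
  have mem: "?x i \<in> Z\<^sub>1 \<union> Z\<^sub>2" if "i \<in> {1..2*n}" for i
  proof -
    have "?l ! (i - 1) \<in> set ?l" using that len by (intro nth_mem) auto
    then show ?thesis unfolding nth using assms(2,3) by auto
  qed
  have Q\<xi>: "poly Q \<xi> \<noteq> 0" using \<xi> assms(2,3) disj by (auto simp: Q_def poly_root_poly_eq_0_iff)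
  have degQ: "degree Q = 2 * n - 1"
    using assms(2,3,5,6,7) \<xi> by (simp add: Q_def degree_mult_eq degree_root_poly)
  have Qi: "poly Q (?x i) = (if i = n + j then poly Q \<xi> else 0)" if "i \<in> {1..2*n}" for i
  proof (cases "i = n + j")
    case False
    then have "?x i \<noteq> \<xi>" unfolding \<xi>_def using inj[OF that, of "n + j"] assms(7) by auto
    then show ?thesis using False mem[OF that] assms(2,3) by (auto simp: Q_def poly_root_poly_eq_0_iff)
  qed (simp add: \<xi>_def)
  show ?thesis
    unfolding lagrange_poly_def
  proof (rule the_equality)
    show "degree (smult (1 / poly Q \<xi>) Q) \<le> 2 * n - 1 \<and>
        (\<forall>i\<in>{1..2*n}. poly (smult (1 / poly Q \<xi>) Q) (?x i) = (if i = n + j then 1 else 0))"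
      using Q\<xi> degQ Qi by simp
  next
    fix p assume p: "degree p \<le> 2 * n - 1 \<and> (\<forall>i\<in>{1..2*n}. poly p (?x i) = (if i = n + j then 1 else 0))"
    let ?d = "p - smult (1 / poly Q \<xi>) Q"
    have deg: "degree ?d \<le> 2 * n - 1" using p degQ by (intro degree_diff_le) auto
    have z: "poly ?d z = 0" if "z \<in> Z\<^sub>1 \<union> Z\<^sub>2" for z
    proof -
      from surj[OF that] obtain i where i: "i \<in> {1..2*n}" "?x i = z" by blast
      have "poly p (?x i) = (if i = n + j then 1 else 0)" using p i(1) by blast
      then show ?thesis using Qi[OF i(1)] Q\<xi> i(2) by simp
    qed
    have card: "card (Z\<^sub>1 \<union> Z\<^sub>2) = 2 * n" using assms(2,3,5,6) disj by (simp add: card_Un_disjoint)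
    have "?d = smult (poly.coeff ?d (card (Z\<^sub>1 \<union> Z\<^sub>2))) (root_poly (Z\<^sub>1 \<union> Z\<^sub>2))"
      using assms(2,3) deg z by (intro poly_eq_smult_root_poly) (auto simp: card)
    \<comment> \<open>The bound \<open>2 * n - 1\<close> is a genuine drop in degree only for
      positive \<open>n\<close>, which the range of \<open>j\<close> ensures.\<close>
    moreover have "poly.coeff ?d (2 * n) = 0" using deg assms(7) by (intro coeff_eq_0) auto
    ultimately have "?d = 0" unfolding card by (metis smult_0_left)
    then show "p = smult (1 / poly Q \<xi>) Q" by simp
  qed
qed

text \<open>Orthogonality does the work of the quadrature rule: \<open>?p\<close> minus its value at
  \<open>\<xi>\<close> is (X - \<xi>) h with deg h < n, so \<open>?p * ?p * ?q\<close> differs from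
  \<open>poly ?p \<xi>\<close> times \<open>?p * ?q\<close> by a term orthogonal to 1. The absolute
  value may go inside the integral because \<open>?q\<close> has constant sign on the
  interval.\<close>

lemma quad_weight_eq:
  assumes "ac_measure a b \<mu>\<^sub>1 w" and mop: "mop \<mu>\<^sub>1 \<mu>\<^sub>2 n = root_poly Z\<^sub>1 * root_poly Z\<^sub>2"
    and Z: "finite Z\<^sub>1" "finite Z\<^sub>2" "Z\<^sub>1 \<subseteq> {a..b}" "\<And>y. y \<in> Z\<^sub>2 \<Longrightarrow> b < y" "card Z\<^sub>1 = n" "card Z\<^sub>2 = n"
    and j: "j \<in> {1..n}"
    and orth: "\<And>h. degree h < n \<Longrightarrow> (LINT x|\<mu>\<^sub>1. poly (root_poly Z\<^sub>1 * root_poly Z\<^sub>2 * h) x) = 0"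
  defines "\<xi> \<equiv> mop_zero \<mu>\<^sub>1 \<mu>\<^sub>2 n (n + j)"
  shows "\<bar>quad_weight \<mu>\<^sub>1 \<mu>\<^sub>2 \<mu>\<^sub>1 n (n + j)\<bar> =
    (LINT x|\<mu>\<^sub>1. (poly (root_poly Z\<^sub>1) x)\<^sup>2 * \<bar>poly (root_poly (Z\<^sub>2 - {\<xi>})) x\<bar>) /
      ((poly (root_poly Z\<^sub>1) \<xi>)\<^sup>2 * \<bar>poly (root_poly (Z\<^sub>2 - {\<xi>})) \<xi>\<bar>)"
proof -
  interpret ac_measure a b \<mu>\<^sub>1 w by fact
  have less: "x < y" if "x \<in> Z\<^sub>1" "y \<in> Z\<^sub>2" for x y using Z that by fastforce
  have \<xi>: "\<xi> \<in> Z\<^sub>2" unfolding \<xi>_def by (rule mop_zero_upper[OF mop Z(1,2) less Z(5,6) j])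
  let ?p = "root_poly Z\<^sub>1" and ?q = "root_poly (Z\<^sub>2 - {\<xi>})"
  have p\<xi>: "poly ?p \<xi> \<noteq> 0" using less[of \<xi> \<xi>] \<xi> Z(1) by (auto simp: poly_root_poly_eq_0_iff)
  have "poly (?p - [:poly ?p \<xi>:]) \<xi> = 0" by simp
  then obtain h where h: "?p - [:poly ?p \<xi>:] = [:- \<xi>, 1:] * h" using poly_eq_0_iff_dvd by (metis dvdE)
  have "degree h < n"
  proof (cases "h = 0")
    case False
    have "degree ([:- \<xi>, 1:] * h) = degree [:- \<xi>, 1:] + degree h" using False by (intro degree_mult_eq) auto
    moreover have "degree (?p - [:poly ?p \<xi>:]) \<le> n" using Z by (intro degree_diff_le) (auto simp: degree_root_poly)
    ultimately show ?thesis by (simp add: h)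
  qed (use j in auto)
  have "(LINT x|\<mu>\<^sub>1. poly (?p * ?p * ?q) x) = (LINT x|\<mu>\<^sub>1. poly ?p \<xi> * poly (?p * ?q) x + poly (?p * root_poly Z\<^sub>2 * h) x)"
  proof (rule Bochner_Integration.integral_cong)
    fix x
    have "?p * ?p * ?q = ?p * ?q * ([:poly ?p \<xi>:] + [:- \<xi>, 1:] * h)" unfolding h[symmetric] by simp
    also have "\<dots> = smult (poly ?p \<xi>) (?p * ?q) + ?p * root_poly Z\<^sub>2 * h"
      unfolding root_poly_remove[OF Z(2) \<xi>] by (simp add: algebra_simps)
    finally show "poly (?p * ?p * ?q) x = poly ?p \<xi> * poly (?p * ?q) x + poly (?p * root_poly Z\<^sub>2 * h) x" by simp
  qed simp
  also have "\<dots> = poly ?p \<xi> * (LINT x|\<mu>\<^sub>1. poly (?p * ?q) x)"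
    by (subst Bochner_Integration.integral_add, (intro continuous_integrable continuous_intros)+)
      (simp add: orth[OF \<open>degree h < n\<close>] del: poly_mult)
  finally have 1: "poly ?p \<xi> * (LINT x|\<mu>\<^sub>1. poly (?p * ?q) x) = (LINT x|\<mu>\<^sub>1. poly (?p * ?p * ?q) x)" by simp
  have "(LINT x|\<mu>\<^sub>1. (poly ?p x)\<^sup>2 * \<bar>poly ?q x\<bar>) = (LINT x|\<mu>\<^sub>1. (- 1) ^ card (Z\<^sub>2 - {\<xi>}) * poly (?p * ?p * ?q) x)"
  proof (rule integral_cong_ab)
    fix x assume "x \<in> {a..b}"
    then have "\<bar>poly ?q x\<bar> = (- 1) ^ card (Z\<^sub>2 - {\<xi>}) * poly ?q x" using Z(4) by (intro abs_root_poly_left) fastforce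
    then show "(poly ?p x)\<^sup>2 * \<bar>poly ?q x\<bar> = (- 1) ^ card (Z\<^sub>2 - {\<xi>}) * poly (?p * ?p * ?q) x"
      by (simp add: power2_eq_square)
  qed auto
  then have 2: "\<bar>LINT x|\<mu>\<^sub>1. (poly ?p x)\<^sup>2 * \<bar>poly ?q x\<bar>\<bar> = \<bar>LINT x|\<mu>\<^sub>1. poly (?p * ?p * ?q) x\<bar>"
    by (simp add: abs_mult power_abs del: poly_mult)
  have 3: "0 \<le> (LINT x|\<mu>\<^sub>1. (poly ?p x)\<^sup>2 * \<bar>poly ?q x\<bar>)" by (rule integral_nonneg_AE) auto
  have "quad_weight \<mu>\<^sub>1 \<mu>\<^sub>2 \<mu>\<^sub>1 n (n + j) = (LINT x|\<mu>\<^sub>1. poly (?p * ?q) x) / (poly ?p \<xi> * poly ?q \<xi>)"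
  proof -
    have "lagrange_poly \<mu>\<^sub>1 \<mu>\<^sub>2 n (n + j) = smult (1 / poly (?p * ?q) \<xi>) (?p * ?q)"
      using lagrange_poly_eq[OF mop Z(1,2) less Z(5,6) j] unfolding \<xi>_def .
    then have "quad_weight \<mu>\<^sub>1 \<mu>\<^sub>2 \<mu>\<^sub>1 n (n + j) = 1 / poly (?p * ?q) \<xi> * (LINT x|\<mu>\<^sub>1. poly (?p * ?q) x)"
      by (simp only: quad_weight_def poly_smult integral_mult_right_zero)
    then show ?thesis by (simp only: poly_mult times_divide_eq_left mult_1)
  qed
  also have "(LINT x|\<mu>\<^sub>1. poly (?p * ?q) x) = (LINT x|\<mu>\<^sub>1. poly (?p * ?p * ?q) x) / poly ?p \<xi>"
    using 1 p\<xi> by (simp add: field_simps)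
  finally have "\<bar>quad_weight \<mu>\<^sub>1 \<mu>\<^sub>2 \<mu>\<^sub>1 n (n + j)\<bar> = \<bar>LINT x|\<mu>\<^sub>1. poly (?p * ?p * ?q) x\<bar> / (\<bar>poly ?p \<xi>\<bar> * (\<bar>poly ?p \<xi>\<bar> * \<bar>poly ?q \<xi>\<bar>))"
    by (simp only: abs_divide abs_mult divide_divide_eq_left)
  also have "\<bar>poly ?p \<xi>\<bar> * (\<bar>poly ?p \<xi>\<bar> * \<bar>poly ?q \<xi>\<bar>) = (poly ?p \<xi>)\<^sup>2 * \<bar>poly ?q \<xi>\<bar>"
    by (simp add: power2_eq_square[symmetric] mult.assoc[symmetric])
  finally show ?thesis using 2 3 by simp
qed

section \<open>Logarithmic integrals\<close>

text \<open>What truncation at scale \<open>r\<close> removes from -ln. It is nonnegative except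
  possibly at 0, where \<open>ln 0 = 0\<close> in HOL distorts it, vanishes outside
  \<open>{-r..r}\<close>, and has integral \<open>r\<close>.\<close>

definition ln_excess :: "real \<Rightarrow> real \<Rightarrow> real" where
  "ln_excess r u = indicator {-r..r} u * (- ln \<bar>u\<bar> - log_ker r \<bar>u\<bar>)"

lemma ln_excess_eq:
  assumes "0 < r" "\<bar>u\<bar> \<le> r" shows "ln_excess r u = - ln \<bar>u\<bar> + ln r - 1 + \<bar>u\<bar> / r"
  using assms by (auto simp: ln_excess_def log_ker_def indicator_def abs_le_iff)

text \<open>The antiderivative \<open>\<Psi>\<close> stays continuous at 0 because u ln
  \<bar>u\<bar> tends to 0, so the fundamental theorem applies with 0 as exceptional point.\<close>

lemma ln_excess_has_integral:
  fixes r :: real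
  assumes r: "0 < r"
  shows "((\<lambda>u. - ln \<bar>u\<bar> + ln r - 1 + \<bar>u\<bar> / r) has_integral r) {-r..r}"
proof -
  define \<Psi> where "\<Psi> u = u * (- ln \<bar>u\<bar>) + u * ln r + u * \<bar>u\<bar> / (2 * r)" for u :: real
  have c0: "isCont (\<lambda>u::real. u * (- ln \<bar>u\<bar>)) 0"
  proof -
    have "((\<lambda>u::real. u * (- ln \<bar>u\<bar>)) \<longlongrightarrow> 0) (at_right 0)" by real_asymp
    moreover have "((\<lambda>u::real. u * (- ln \<bar>u\<bar>)) \<longlongrightarrow> 0) (at_left 0)" by real_asymp
    ultimately show ?thesis by (simp add: isCont_def filterlim_split_at)
  qed
  have cont: "isCont \<Psi> u" for u
  proof (cases "u = 0")
    case True
    show ?thesis unfolding True \<Psi>_def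
      by (rule continuous_add[OF continuous_add[OF c0]]) (use r in \<open>auto intro!: continuous_intros\<close>)
  next
    case False then show ?thesis unfolding \<Psi>_def using r by (intro continuous_intros) auto
  qed
  have "((\<lambda>u. - ln \<bar>u\<bar> + ln r - 1 + \<bar>u\<bar> / r) has_integral (\<Psi> r - \<Psi> (-r))) {-r..r}"
  proof (rule fundamental_theorem_of_calculus_interior_strong[of "{0}"])
    show "continuous_on {-r..r} \<Psi>" using cont by (simp add: continuous_at_imp_continuous_on)
    fix u assume "u \<in> {-r<..<r} - {0}"
    then have "u \<noteq> 0" by simp
    then consider "0 < u" | "u < 0" by linarith
    then have "(\<Psi> has_real_derivative - ln \<bar>u\<bar> + ln r - 1 + \<bar>u\<bar> / r) (at u)"
    proof cases
      case 1
      have "((\<lambda>u. u * (- ln u) + u * ln r + u * u / (2 * r)) has_real_derivative - ln \<bar>u\<bar> + ln r - 1 + \<bar>u\<bar> / r) (at u)"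
        using 1 r by (auto intro!: derivative_eq_intros simp: field_simps)
      moreover have "\<forall>\<^sub>F v in nhds u. u * 0 = 0 \<and> \<Psi> v = v * (- ln v) + v * ln r + v * v / (2 * r)"
        using eventually_nhds_in_open[of "{0<..}" u] 1 by (auto elim!: eventually_mono simp: \<Psi>_def)
      ultimately show ?thesis by (subst DERIV_cong_ev[OF refl _ refl]) (auto elim: eventually_mono)
    next
      case 2
      have "((\<lambda>u. u * (- ln (- u)) + u * ln r - u * u / (2 * r)) has_real_derivative - ln \<bar>u\<bar> + ln r - 1 + \<bar>u\<bar> / r) (at u)"
        using 2 r by (auto intro!: derivative_eq_intros simp: field_simps)
      moreover have "\<forall>\<^sub>F v in nhds u. u * 0 = 0 \<and> \<Psi> v = v * (- ln (- v)) + v * ln r - v * v / (2 * r)"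
        using eventually_nhds_in_open[of "{..<0}" u] 2 by (auto elim!: eventually_mono simp: \<Psi>_def)
      ultimately show ?thesis by (subst DERIV_cong_ev[OF refl _ refl]) (auto elim: eventually_mono)
    qed
    then show "(\<Psi> has_vector_derivative - ln \<bar>u\<bar> + ln r - 1 + \<bar>u\<bar> / r) (at u)"
      by (simp add: has_real_derivative_iff_has_vector_derivative)
  qed (use r in auto)
  moreover have "\<Psi> r - \<Psi> (-r) = r" using r by (simp add: \<Psi>_def)
  ultimately show ?thesis by simp
qed

lemma ln_excess_nonneg:
  assumes "0 < r" "u \<noteq> 0" shows "0 \<le> ln_excess r u"
  using log_ker_le_ln[OF assms(1), of "\<bar>u\<bar>"] assms by (auto simp: ln_excess_def indicator_def)

lemma minus_ln_eq_ln_excess: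
  assumes "0 < r" shows "- ln \<bar>u\<bar> = log_ker r \<bar>u\<bar> + ln_excess r u"
  using assms by (auto simp: ln_excess_def indicator_def log_ker_eq abs_le_iff not_le)

lemma ln_excess_integral:
  assumes r: "0 < r"
  shows "integrable lborel (ln_excess r)" "(LINT u|lborel. ln_excess r u) = r"
proof -
  let ?f = "\<lambda>u. max 0 (ln_excess r u)"
  have ae: "AE u in lborel. ln_excess r u = ?f u"
    using AE_lborel_singleton[of 0] by eventually_elim (use ln_excess_nonneg[OF r] in auto)
  have meas: "ln_excess r \<in> borel_measurable borel" unfolding ln_excess_def by measurable
  have "((\<lambda>u. ?f u) has_integral r) {-r..r}"
    by (rule has_integral_spike_finite[OF _ _ ln_excess_has_integral[OF r], of "{0}"])
      (use ln_excess_nonneg[OF r] ln_excess_eq[OF r] in \<open>fastforce simp: max_absorb2\<close>)+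
  then have "integral\<^sup>N lborel (\<lambda>u. indicator {-r..r} u * ?f u) = ennreal r"
    using meas by (intro nn_integral_has_integral_lebesgue) auto
  then have nn: "(\<integral>\<^sup>+u. ennreal (?f u) \<partial>lborel) = ennreal r"
    by (subst (asm) nn_integral_cong[where v="\<lambda>u. ennreal (?f u)"]) (auto simp: ln_excess_def indicator_def)
  have "has_bochner_integral lborel ?f r"
    using nn meas r by (intro has_bochner_integral_nn_integral) auto
  then have "has_bochner_integral lborel (ln_excess r) r"
    using ae meas by (subst has_bochner_integral_cong_AE[where g="?f"]) auto
  then show "integrable lborel (ln_excess r)" "(LINT u|lborel. ln_excess r u) = r"
    by (auto simp: has_bochner_integral_iff)
qed

lemma ln_excess_shift:
  assumes r: "0 < r"
  shows "integrable lborel (\<lambda>s. ln_excess r (s - z))" "(LINT s|lborel. ln_excess r (s - z)) = r"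
  using lborel_integrable_real_affine[OF ln_excess_integral(1)[OF r], of 1 "- z"]
    lborel_integral_real_affine[of 1 "ln_excess r" "- z"] ln_excess_integral(2)[OF r]
  by (simp_all add: add.commute)

text \<open>Whatever the shape of \<open>S\<close> and the position of \<open>z\<close>, the
  logarithmic singularity costs at most \<open>r\<close>, the whole integral of the excess; the
  truncated kernel is bounded by \<open>B\<close> on \<open>S\<close>.\<close>

lemma ln_set_integral_le:
  assumes S: "S \<in> sets borel" "bounded S" and r: "0 < r" and B: "\<And>s. s \<in> S \<Longrightarrow> log_ker r \<bar>s - z\<bar> \<le> B"
  shows "integrable lborel (\<lambda>s. indicator S s * - ln \<bar>s - z\<bar>)"
    and "(LINT s|lborel. indicator S s * - ln \<bar>s - z\<bar>) \<le> B * measure lborel S + r"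
proof -
  have S_fin: "emeasure lborel S < \<infinity>" using emeasure_bounded_finite[OF S(2)] .
  obtain c where c: "\<And>s. s \<in> S \<Longrightarrow> \<bar>s\<bar> \<le> c" using S(2) by (auto simp: bounded_iff)
  have intk: "integrable lborel (\<lambda>s. indicator S s * log_ker r \<bar>s - z\<bar>)"
  proof (rule Bochner_Integration.integrable_bound[of _ "\<lambda>s. indicator S s * (1 + \<bar>ln r\<bar> + \<bar>ln (max r (c + \<bar>z\<bar>))\<bar>)"])
    show "integrable lborel (\<lambda>s. indicator S s * (1 + \<bar>ln r\<bar> + \<bar>ln (max r (c + \<bar>z\<bar>))\<bar>))"
      using S S_fin by (intro integrable_mult_left) (auto simp: less_top)
    show "AE s in lborel. norm (indicator S s * log_ker r \<bar>s - z\<bar>) \<le> norm (indicator S s * (1 + \<bar>ln r\<bar> + \<bar>ln (max r (c + \<bar>z\<bar>))\<bar>))"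
    proof (rule AE_I2)
      fix s :: real
      show "norm (indicator S s * log_ker r \<bar>s - z\<bar>) \<le> norm (indicator S s * (1 + \<bar>ln r\<bar> + \<bar>ln (max r (c + \<bar>z\<bar>))\<bar>))"
      proof (cases "s \<in> S")
        case True
        have "\<bar>log_ker r \<bar>s - z\<bar>\<bar> \<le> 1 + \<bar>ln r\<bar> + \<bar>ln (max r (c + \<bar>z\<bar>))\<bar>" using c[OF True] r by (intro log_ker_bounded) auto
        then show ?thesis using True by simp
      qed simp
    qed
    show "(\<lambda>s. indicator S s * log_ker r \<bar>s - z\<bar>) \<in> borel_measurable lborel" using S(1) by measurable
  qed
  have inte: "integrable lborel (\<lambda>s. indicator S s * ln_excess r (s - z))"
    using integrable_real_mult_indicator[OF _ ln_excess_shift(1)[OF r], of S z] S by (simp add: mult.commute)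
  have eq: "indicator S s * - ln \<bar>s - z\<bar> = indicator S s * log_ker r \<bar>s - z\<bar> + indicator S s * ln_excess r (s - z)" for s
    by (subst minus_ln_eq_ln_excess[OF r]) (simp add: algebra_simps)
  show "integrable lborel (\<lambda>s. indicator S s * - ln \<bar>s - z\<bar>)"
    unfolding eq using intk inte by simp
  have "(LINT s|lborel. indicator S s * log_ker r \<bar>s - z\<bar>) \<le> (LINT s|lborel. B * indicator S s)"
  proof (rule integral_mono[OF intk])
    show "integrable lborel (\<lambda>s. B * indicator S s)"
      using S S_fin by (intro integrable_mult_right) (auto simp: less_top)
  qed (use B in \<open>auto simp: indicator_def\<close>)
  also have "\<dots> = B * measure lborel S" using S by simp
  finally have 1: "(LINT s|lborel. indicator S s * log_ker r \<bar>s - z\<bar>) \<le> B * measure lborel S" .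
  have "(LINT s|lborel. indicator S s * ln_excess r (s - z)) \<le> (LINT s|lborel. ln_excess r (s - z))"
  proof (rule integral_mono_AE[OF inte ln_excess_shift(1)[OF r]])
    show "AE s in lborel. indicator S s * ln_excess r (s - z) \<le> ln_excess r (s - z)"
      using AE_lborel_singleton[of z]
      by eventually_elim (use ln_excess_nonneg[OF r] in \<open>auto simp: indicator_def\<close>)
  qed
  with 1 show "(LINT s|lborel. indicator S s * - ln \<bar>s - z\<bar>) \<le> B * measure lborel S + r"
    unfolding eq using intk inte ln_excess_shift(2)[OF r, of z] by simp
qed

section \<open>A lower bound by Jensen's inequality\<close>

text \<open>Jensen's inequality for the uniform distribution on \<open>S\<close>, in the form of the
  tangent of exp at \<open>A\<close>. The measure enters only through the bound \<open>d\<close> for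
  its density on \<open>S\<close>.\<close>

lemma (in ac_measure) jensen_lower_bound:
  assumes F: "continuous_on UNIV F" "\<And>x. 0 \<le> F x"
    and S: "S \<in> sets borel" "emeasure lborel S < \<infinity>" and d: "0 < d" "\<And>x. x \<in> S \<Longrightarrow> d \<le> w x"
    and l: "integrable lborel (\<lambda>s. indicator S s * l s)" "AE x in lborel. x \<in> S \<longrightarrow> exp (l x) \<le> F x"
    and A: "A * measure lborel S \<le> (LINT s|lborel. indicator S s * l s)"
  shows "d * measure lborel S * exp A \<le> (LINT x|\<mu>. F x)"
proof -
  have [measurable]: "F \<in> borel_measurable borel" "S \<in> sets borel"
    using F(1) S(1) by (auto intro: borel_measurable_continuous_onI)
  \<comment> \<open>The tangent exp A (1 + l - A) to exp at \<open>A\<close>, restricted to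
    \<open>S\<close>.\<close>
  define g where "g s = exp A * (indicator S s * (1 - A) + indicator S s * l s)" for s
  have int1: "integrable lborel (\<lambda>s. indicator S s * (1 - A))"
    using S by (intro integrable_mult_left) (auto simp: less_top)
  have intg: "integrable lborel g" unfolding g_def using l(1) int1 by (intro integrable_mult_right Bochner_Integration.integrable_add)
  have "exp A * measure lborel S \<le> exp A * ((1 - A) * measure lborel S + (LINT s|lborel. indicator S s * l s))"
    using A by (intro mult_left_mono) (auto simp: algebra_simps)
  also have "\<dots> = (LINT s|lborel. g s)"
    unfolding g_def using l(1) int1 S by (simp add: mult.commute)
  finally have g: "exp A * measure lborel S \<le> (LINT s|lborel. g s)" .
  have g_le: "AE s in lborel. g s \<le> indicator S s * F s"
    using l(2)
  proof eventually_elim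
    case (elim s)
    show ?case
    proof (cases "s \<in> S")
      case True
      have "1 + (l s - A) \<le> exp (l s - A)" by (rule exp_ge_add_one_self)
      then have "exp A * (1 + (l s - A)) \<le> exp A * exp (l s - A)" by (intro mult_left_mono) auto
      also have "\<dots> = exp (l s)" by (simp flip: exp_add)
      finally show ?thesis using elim True by (simp add: g_def algebra_simps)
    qed (simp add: g_def)
  qed
  have "ennreal (d * measure lborel S * exp A) \<le> ennreal (d * (LINT s|lborel. g s))"
    using g d(1) by (intro ennreal_leI) (simp add: mult.commute mult.left_commute)
  also have "\<dots> \<le> ennreal d * (\<integral>\<^sup>+s. ennreal (g s) \<partial>lborel)"
  proof -
    have "ennreal (LINT s|lborel. g s) \<le> (\<integral>\<^sup>+s. ennreal (g s) \<partial>lborel)"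
    proof -
      have "(LINT s|lborel. g s) \<le> (LINT s|lborel. max 0 (g s))"
        using intg by (intro integral_mono) auto
      then have "ennreal (LINT s|lborel. g s) \<le> ennreal (LINT s|lborel. max 0 (g s))" by (rule ennreal_leI)
      also have "\<dots> = (\<integral>\<^sup>+s. ennreal (max 0 (g s)) \<partial>lborel)"
        using intg by (intro nn_integral_eq_integral[symmetric]) auto
      also have "\<dots> = (\<integral>\<^sup>+s. ennreal (g s) \<partial>lborel)"
        by (intro nn_integral_cong) (auto simp: max_def ennreal_neg)
      finally show ?thesis .
    qed
    then show ?thesis using d(1) by (simp add: ennreal_mult' mult_left_mono)
  qed
  also have "\<dots> = (\<integral>\<^sup>+s. ennreal d * ennreal (g s) \<partial>lborel)"
    using intg by (intro nn_integral_cmult[symmetric]) auto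
  also have "\<dots> \<le> (\<integral>\<^sup>+s. ennreal (w s) * ennreal (F s) \<partial>lborel)"
  proof (rule nn_integral_mono_AE)
    show "AE s in lborel. ennreal d * ennreal (g s) \<le> ennreal (w s) * ennreal (F s)"
      using g_le
    proof eventually_elim
      case (elim s)
      show ?case
      proof (cases "s \<in> S")
        case True
        then have "ennreal d \<le> ennreal (w s)" "ennreal (g s) \<le> ennreal (F s)" using d elim by (auto intro: ennreal_leI)
        then show ?thesis by (intro mult_mono) auto
      qed (use elim in \<open>auto simp: g_def\<close>)
    qed
  qed
  also have "\<dots> \<le> (\<integral>\<^sup>+x. ennreal (F x) \<partial>\<mu>)" by (rule nn_integral_ge_density) measurable
  also have "\<dots> = ennreal (LINT x|\<mu>. F x)"
    using F by (intro nn_integral_eq_integral continuous_integrable) auto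
  finally show ?thesis using F(2) by (simp add: integral_nonneg)
qed

text \<open>The sets where \<open>w\<close> is at least 1/(n+1) exhaust \<open>J\<close> up to a
  null set; continuity of measure from below gives one with more than half of it.\<close>

lemma (in ac_measure) density_bounded_below:
  assumes "J \<in> sets borel" "J \<subseteq> {a..b}" "0 < measure lborel J"
  obtains d where "0 < d" "measure lborel J / 2 < measure lborel (J \<inter> {x. d \<le> w x})"
proof -
  have Jfin: "emeasure lborel J < \<infinity>"
    using assms(2) by (intro emeasure_bounded_finite bounded_subset[OF bounded_closed_interval])
  define T where "T n = J \<inter> {x. 1 / real (Suc n) \<le> w x}" for n
  have T [measurable]: "T n \<in> sets borel" for n unfolding T_def using assms(1) by measurable
  have "1 / real (Suc n) \<le> 1 / real (Suc m)" if "m \<le> n" for m n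
    using that by (simp add: field_simps)
  then have "incseq T" unfolding T_def incseq_def by (force intro: order_trans)
  moreover have "emeasure lborel (\<Union>n. T n) = emeasure lborel J"
  proof (rule emeasure_eq_AE)
    show "AE x in lborel. (x \<in> (\<Union>n. T n)) = (x \<in> J)"
      using pos
    proof eventually_elim
      case (elim x)
      have "\<exists>n. 1 / real (Suc n) \<le> w x" if "0 < w x"
        using reals_Archimedean[OF that] by (auto simp: inverse_eq_divide intro: less_imp_le)
      then show ?case using elim assms(2) by (auto simp: T_def)
    qed
  qed (use assms(1) in auto)
  ultimately have "(\<lambda>n. measure lborel (T n)) \<longlonglongrightarrow> measure lborel J"
    using Lim_measure_incseq[of T lborel] Jfin by (simp add: measure_def T image_subset_iff)
  then have "\<forall>\<^sub>F n in sequentially. measure lborel J / 2 < measure lborel (T n)"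
    using assms(3) by (intro order_tendstoD(1)) auto
  then obtain n where "measure lborel J / 2 < measure lborel (T n)" by (auto simp: eventually_sequentially)
  then show ?thesis by (intro that[of "1 / real (Suc n)"]) (auto simp: T_def)
qed

section \<open>Limits of the zero distributions\<close>

lemma log_ker_shift_lipschitz: "0 < e \<Longrightarrow> \<bar>log_ker e \<bar>t - u\<bar> - log_ker e \<bar>t' - v\<bar>\<bar> \<le> 1 / e * (\<bar>t - t'\<bar> + \<bar>u - v\<bar>)"
proof -
  assume e: "0 < e"
  have "\<bar>\<bar>t - u\<bar> - \<bar>t' - v\<bar>\<bar> / e \<le> (\<bar>t - t'\<bar> + \<bar>u - v\<bar>) / e" using e by (intro divide_right_mono) auto
  then show ?thesis using log_ker_lipschitz[OF e, of "\<bar>t - u\<bar>" "\<bar>t' - v\<bar>"] by simp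
qed

lemma average_log_ker_lipschitz:
  fixes e :: real and f :: "'i \<Rightarrow> real"
  assumes "0 < e" "finite I" "card I = n" "0 < n"
  shows "\<bar>(\<Sum>i\<in>I. log_ker e \<bar>t - f i\<bar>) / real n - (\<Sum>i\<in>I. log_ker e \<bar>t' - f i\<bar>) / real n\<bar> \<le> 1 / e * \<bar>t - t'\<bar>"
proof -
  have "\<bar>(\<Sum>i\<in>I. log_ker e \<bar>t - f i\<bar>) - (\<Sum>i\<in>I. log_ker e \<bar>t' - f i\<bar>)\<bar> \<le> (\<Sum>i\<in>I. \<bar>log_ker e \<bar>t - f i\<bar> - log_ker e \<bar>t' - f i\<bar>\<bar>)"
    unfolding sum_subtractf[symmetric] by (rule sum_abs)
  also have "\<dots> \<le> (\<Sum>i\<in>I. 1 / e * \<bar>t - t'\<bar>)"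
    by (intro sum_mono order_trans[OF log_ker_shift_lipschitz[OF assms(1)]]) simp
  also have "\<dots> = real n * (1 / e * \<bar>t - t'\<bar>)" using assms by simp
  finally have *: "\<bar>(\<Sum>i\<in>I. log_ker e \<bar>t - f i\<bar>) - (\<Sum>i\<in>I. log_ker e \<bar>t' - f i\<bar>)\<bar> \<le> real n * (1 / e * \<bar>t - t'\<bar>)" .
  have "\<bar>(\<Sum>i\<in>I. log_ker e \<bar>t - f i\<bar>) / real n - (\<Sum>i\<in>I. log_ker e \<bar>t' - f i\<bar>) / real n\<bar>
      = \<bar>(\<Sum>i\<in>I. log_ker e \<bar>t - f i\<bar>) - (\<Sum>i\<in>I. log_ker e \<bar>t' - f i\<bar>)\<bar> / real n"
    using assms(4) by (simp add: diff_divide_distrib[symmetric])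
  also have "\<dots> \<le> real n * (1 / e * \<bar>t - t'\<bar>) / real n" using * assms(4) by (intro divide_right_mono) auto
  also have "\<dots> = 1 / e * \<bar>t - t'\<bar>" using assms(4) by simp
  finally show ?thesis .
qed

lemma abs_le_exp_log_ker: "0 < e \<Longrightarrow> \<bar>u\<bar> \<le> exp (- log_ker e \<bar>u\<bar>)"
proof (cases "u = 0")
  case False
  assume "0 < e"
  then have "log_ker e \<bar>u\<bar> \<le> - ln \<bar>u\<bar>" using False by (intro log_ker_le_ln) auto
  then have "ln \<bar>u\<bar> \<le> - log_ker e \<bar>u\<bar>" by simp
  then have "exp (ln \<bar>u\<bar>) \<le> exp (- log_ker e \<bar>u\<bar>)" by simp
  then show ?thesis using False by simp
qed simp

text \<open>Zeros may coincide with \<open>t\<close>: truncation only enlarges the factors. Upper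
  bounds for polynomials thus need no distance from the zeros, lower bounds do.\<close>

lemma abs_prod_le_exp_log_ker:
  fixes f :: "'i \<Rightarrow> real"
  assumes "0 < e" "finite I"
  shows "\<bar>\<Prod>i\<in>I. t - f i\<bar> \<le> exp (- (\<Sum>i\<in>I. log_ker e \<bar>t - f i\<bar>))"
proof -
  have "\<bar>\<Prod>i\<in>I. t - f i\<bar> \<le> (\<Prod>i\<in>I. exp (- log_ker e \<bar>t - f i\<bar>))"
    unfolding abs_prod using abs_le_exp_log_ker[OF assms(1)] by (intro prod_mono) auto
  also have "\<dots> = exp (- (\<Sum>i\<in>I. log_ker e \<bar>t - f i\<bar>))"
    using assms(2) by (simp only: sum_negf[symmetric] exp_sum)
  finally show ?thesis .
qed

lemma abs_prod_eq_exp_log_ker: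
  fixes f :: "'i \<Rightarrow> real"
  assumes "0 < e" "finite I" "\<And>i. i \<in> I \<Longrightarrow> e \<le> \<bar>t - f i\<bar>"
  shows "\<bar>\<Prod>i\<in>I. t - f i\<bar> = exp (- (\<Sum>i\<in>I. log_ker e \<bar>t - f i\<bar>))"
proof -
  have "exp (- log_ker e \<bar>t - f i\<bar>) = \<bar>t - f i\<bar>" if "i \<in> I" for i
    using assms(1) assms(3)[OF that] by (simp add: log_ker_eq)
  then show ?thesis
    using assms(2) by (simp add: abs_prod exp_sum flip: sum_negf)
qed

text \<open>Zeros are excluded because \<open>ln 0 = 0\<close> would turn a vanishing factor into
  1.\<close>

lemma exp_sum_ln_eq:
  assumes "finite A" "finite B" "s \<notin> A \<union> B"
  shows "exp (2 * (\<Sum>z\<in>A. ln \<bar>s - z\<bar>) + (\<Sum>z\<in>B. ln \<bar>s - z\<bar>)) = (poly (root_poly A) s)\<^sup>2 * \<bar>poly (root_poly B) s\<bar>"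
proof -
  have "exp (\<Sum>z\<in>C. ln \<bar>s - z\<bar>) = \<bar>poly (root_poly C) s\<bar>" if "finite C" "s \<notin> C" for C
    unfolding poly_root_poly abs_prod exp_sum[OF that(1)] by (rule prod.cong) (use that in auto)
  from this[OF assms(1)] this[OF assms(2)] assms(3)
  have "exp (\<Sum>z\<in>A. ln \<bar>s - z\<bar>) = \<bar>poly (root_poly A) s\<bar>" "exp (\<Sum>z\<in>B. ln \<bar>s - z\<bar>) = \<bar>poly (root_poly B) s\<bar>"
    by auto
  moreover have "exp (2 * u + v) = (exp u)\<^sup>2 * exp v" for u v :: real
    by (simp add: exp_add exp_double)
  ultimately show ?thesis by simp
qed

lemma monic_prod_linear:
  fixes f :: "nat \<Rightarrow> real"
  shows "degree (\<Prod>i<n. [:- f i, 1:]) = n" "lead_coeff (\<Prod>i<n. [:- f i, 1:]) = 1"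
proof -
  show l: "lead_coeff (\<Prod>i<n. [:- f i, 1:]) = 1" by (simp add: lead_coeff_prod)
  have "degree (\<Prod>i\<in>I. [:- f i, 1:]) = card I" if "finite I" for I :: "nat set"
    using that
  proof (induction I rule: finite_induct)
    case (insert j I)
    have "lead_coeff (\<Prod>i\<in>I. [:- f i, 1:]) = 1" by (simp add: lead_coeff_prod)
    then have "degree ([:- f j, 1:] * (\<Prod>i\<in>I. [:- f i, 1:])) = degree [:- f j, 1:] + degree (\<Prod>i\<in>I. [:- f i, 1:])"
      by (intro degree_mult_eq) auto
    then show ?case using insert by simp
  qed simp
  from this[of "{..<n}"] show "degree (\<Prod>i<n. [:- f i, 1:]) = n" by simp
qed

text \<open>One of the two intervals along a subsequence \<open>N\<close> of degrees: \<open>Z k\<close> and \<open>W k\<close> are the zeros of the multiple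
  orthogonal polynomial in this interval and in the other one.\<close>

locale angelesco_side = ac_measure a b \<mu> w for a b :: real and \<mu> and w +
  fixes c d g m :: real and Z W :: "nat \<Rightarrow> real set" and N :: "nat \<Rightarrow> nat" and \<alpha> \<beta> :: "real measure"
  assumes g: "0 < g" and gap: "\<And>t y. t \<in> {a..b} \<Longrightarrow> y \<in> {c..d} \<Longrightarrow> g \<le> \<bar>t - y\<bar>"
    and N_pos: "\<And>k. 0 < N k" and N_lim: "filterlim N at_top sequentially"
    and Z: "\<And>k. finite (Z k)" "\<And>k. card (Z k) = N k" "\<And>k. Z k \<subseteq> {a..b}"
    and W: "\<And>k. finite (W k)" "\<And>k. card (W k) = N k" "\<And>k. W k \<subseteq> {c..d}"
    and \<alpha>: "prob_on a b \<alpha>" and \<beta>: "prob_on c d \<beta>"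
    and conv_\<alpha>: "\<And>f. continuous_on UNIV f \<Longrightarrow> (\<lambda>k. (\<Sum>z\<in>Z k. f z) / real (N k)) \<longlonglongrightarrow> (LINT y|\<alpha>. f y)"
    and conv_\<beta>: "\<And>f. continuous_on UNIV f \<Longrightarrow> (\<lambda>k. (\<Sum>z\<in>W k. f z) / real (N k)) \<longlonglongrightarrow> (LINT y|\<beta>. f y)"
    and minimal: "\<And>k R. degree R = N k \<Longrightarrow> lead_coeff R = 1 \<Longrightarrow>
      (LINT x|\<mu>. (poly (root_poly (Z k)) x)\<^sup>2 * \<bar>poly (root_poly (W k)) x\<bar>) \<le> (LINT x|\<mu>. (poly R x)\<^sup>2 * \<bar>poly (root_poly (W k)) x\<bar>)"
    and m_lim: "(\<lambda>k. - ln (LINT x|\<mu>. (poly (root_poly (Z k)) x)\<^sup>2 * \<bar>poly (root_poly (W k)) x\<bar>) / real (N k)) \<longlonglongrightarrow> m"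
begin

section \<open>Asymptotics of the minimal weighted norms on one interval\<close>

definition nrm :: "nat \<Rightarrow> real" where
  "nrm k = (LINT x|\<mu>. (poly (root_poly (Z k)) x)\<^sup>2 * \<bar>poly (root_poly (W k)) x\<bar>)"

lemma inverse_N_lim: "(\<lambda>k. C / real (N k)) \<longlonglongrightarrow> 0"
  by (rule real_tendsto_divide_at_top[OF tendsto_const filterlim_compose[OF filterlim_real_sequentially N_lim]])

lemma nrm_lim: "(\<lambda>k. - ln (nrm k) / real (N k)) \<longlonglongrightarrow> m"
  using m_lim by (simp add: nrm_def)

lemma pot_lim_\<alpha>: "0 < e \<Longrightarrow> (\<lambda>k. (\<Sum>z\<in>Z k. log_ker e \<bar>t - z\<bar>) / real (N k)) \<longlonglongrightarrow> log_pot e \<alpha> t"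
  unfolding log_pot_def by (intro conv_\<alpha> continuous_intros) auto

lemma pot_lim_\<beta>: "0 < e \<Longrightarrow> (\<lambda>k. (\<Sum>z\<in>W k. log_ker e \<bar>t - z\<bar>) / real (N k)) \<longlonglongrightarrow> log_pot e \<beta> t"
  unfolding log_pot_def by (intro conv_\<beta> continuous_intros) auto

lemma pot_lim_\<alpha>':
  assumes e: "0 < e" and X: "X \<longlonglongrightarrow> x"
  shows "(\<lambda>k. (\<Sum>z\<in>Z k. log_ker e \<bar>X k - z\<bar>) / real (N k)) \<longlonglongrightarrow> log_pot e \<alpha> x"
  by (rule equi_lipschitz_tendsto[where L="1/e" and g="log_pot e \<alpha>" and f="\<lambda>k t. (\<Sum>z\<in>Z k. log_ker e \<bar>t - z\<bar>) / real (N k)"])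
    (rule average_log_ker_lipschitz[OF e Z(1,2) N_pos] pot_lim_\<alpha>[OF e] X)+

lemma pot_lim_uniform_\<beta>:
  assumes e: "0 < e" and r: "0 < r"
  shows "\<forall>\<^sub>F k in sequentially. \<forall>t\<in>{a..b}. \<bar>(\<Sum>z\<in>W k. log_ker e \<bar>t - z\<bar>) / real (N k) - log_pot e \<beta> t\<bar> \<le> r"
  by (rule equi_lipschitz_uniform[where L="1/e" and g="log_pot e \<beta>" and f="\<lambda>k t. (\<Sum>z\<in>W k. log_ker e \<bar>t - z\<bar>) / real (N k)"])
    (rule average_log_ker_lipschitz[OF e W(1,2) N_pos] pot_lim_\<beta>[OF e] r)+

lemma nrm_pos: "0 < nrm k"
proof -
  let ?F = "\<lambda>x. (poly (root_poly (Z k)) x)\<^sup>2 * \<bar>poly (root_poly (W k)) x\<bar>"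
  have int: "integrable \<mu> ?F" by (intro continuous_integrable continuous_intros)
  have "0 \<le> nrm k" unfolding nrm_def by (intro integral_nonneg_AE) auto
  moreover have "nrm k \<noteq> 0"
  proof
    assume "nrm k = 0"
    then have "AE x in \<mu>. ?F x = 0"
      using integral_nonneg_eq_0_iff_AE[OF int] by (auto simp: nrm_def)
    then have "AE x in \<mu>. poly ((root_poly (Z k) * root_poly (W k))\<^sup>2) x = 0"
      by eventually_elim auto
    then have "(LINT x|\<mu>. poly ((root_poly (Z k) * root_poly (W k))\<^sup>2) x) = (LINT x|\<mu>. 0)"
      by (intro integral_cong_AE) auto
    then have "(root_poly (Z k) * root_poly (W k))\<^sup>2 = 0"
      by (intro nonneg_poly_integral_0) (auto simp: poly_power)
    then show False by simp
  qed
  ultimately show ?thesis by simp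
qed

text \<open>The norm is minimal among monic polynomials, so it is at most that of the polynomial
  whose zeros discretize \<open>\<sigma>\<close>. A lower bound \<open>C\<close> for the combined
  potential makes the latter at most exp(-nC + o(n)).\<close>

lemma test_measure:
  assumes p: "prob_on a b \<sigma>" and e: "0 < e"
    and low: "\<And>t. t \<in> {a..b} \<Longrightarrow> C \<le> 2 * log_pot e \<sigma> t + log_pot g \<beta> t"
  shows "C \<le> m"
proof -
  interpret finite_measure \<mu> by (rule fin)
  \<comment> \<open>Adding 1 keeps the logarithm of the mass bound meaningful without a positivity
    argument.\<close>
  define M where "M = measure \<mu> UNIV + 1"
  have M: "0 < M" by (simp add: M_def add_nonneg_pos)
  have "\<exists>y. \<forall>f L. f \<in> borel_measurable borel \<longrightarrow> (\<forall>u v. u \<in> {a..b} \<longrightarrow> v \<in> {a..b} \<longrightarrow> \<bar>f u - f v\<bar> \<le> L * \<bar>u - v\<bar>)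
      \<longrightarrow> \<bar>(\<Sum>i<N k. f (y i)) / real (N k) - (LINT x|\<sigma>. f x)\<bar> \<le> L * (b - a) / real (N k)" for k
    by (rule discretize[OF p N_pos[of k]]) blast
  then obtain y where y: "\<And>k f L. f \<in> borel_measurable borel \<Longrightarrow> (\<And>u v. u \<in> {a..b} \<Longrightarrow> v \<in> {a..b} \<Longrightarrow> \<bar>f u - f v\<bar> \<le> L * \<bar>u - v\<bar>)
      \<Longrightarrow> \<bar>(\<Sum>i<N k. f (y k i)) / real (N k) - (LINT x|\<sigma>. f x)\<bar> \<le> L * (b - a) / real (N k)"
    by metis
  have "C - r \<le> m" if r: "0 < r" for r
  proof -
    have ev: "\<forall>\<^sub>F k in sequentially. C - r - 2 * (1 / e * (b - a)) / real (N k) - ln M / real (N k) \<le> - ln (nrm k) / real (N k)"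
      using pot_lim_uniform_\<beta>[OF g r]
    proof eventually_elim
      case (elim k)
      define n where "n = real (N k)"
      have n: "0 < n" using N_pos by (simp add: n_def)
      \<comment> \<open>The discretization error counts twice because the polynomial is squared;
        \<open>r\<close> pays for the uniform convergence of the potentials from the other
        interval.\<close>
      define E where "E = C - r - 2 * (1 / e * (b - a)) / n"
      let ?R = "\<Prod>i<N k. [:- y k i, 1:]"
      have le: "(poly ?R t)\<^sup>2 * \<bar>poly (root_poly (W k)) t\<bar> \<le> exp (- n * E)" if t: "t \<in> {a..b}" for t
      proof -
        let ?S = "\<Sum>i<N k. log_ker e \<bar>t - y k i\<bar>" and ?T = "\<Sum>z\<in>W k. log_ker g \<bar>t - z\<bar>"
        have 1: "\<bar>poly ?R t\<bar> \<le> exp (- ?S)"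
          unfolding poly_prod using abs_prod_le_exp_log_ker[OF e, of "{..<N k}" t "y k"] by simp
        have 2: "\<bar>poly (root_poly (W k)) t\<bar> \<le> exp (- ?T)"
          unfolding poly_root_poly using abs_prod_le_exp_log_ker[OF g W(1)[of k], of t "\<lambda>z. z"] .
        have "log_pot e \<sigma> t - 1 / e * (b - a) / n \<le> ?S / n"
        proof -
          have "\<bar>?S / n - log_pot e \<sigma> t\<bar> \<le> 1 / e * (b - a) / n"
            unfolding log_pot_def n_def by (rule y) (use log_ker_shift_lipschitz[OF e, of t _ t] in auto)
          then show ?thesis by linarith
        qed
        moreover have "log_pot g \<beta> t - r \<le> ?T / n" using bspec[OF elim t] unfolding n_def by linarith
        ultimately have "E \<le> 2 * (?S / n) + ?T / n" using low[OF t] unfolding E_def by linarith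
        then have "n * E \<le> n * (2 * (?S / n) + ?T / n)" using n by (intro mult_left_mono) auto
        also have "\<dots> = 2 * ?S + ?T" using n by (simp add: field_simps)
        finally have 3: "- (2 * ?S + ?T) \<le> - n * E" by simp
        have "(poly ?R t)\<^sup>2 * \<bar>poly (root_poly (W k)) t\<bar> \<le> (exp (- ?S))\<^sup>2 * exp (- ?T)"
          using 2 power_mono[OF 1, of 2] by (intro mult_mono) auto
        also have "\<dots> = exp (- (2 * ?S + ?T))" by (simp add: power2_eq_square flip: exp_add)
        also have "\<dots> \<le> exp (- n * E)" using 3 by simp
        finally show ?thesis .
      qed
      have "nrm k \<le> (LINT x|\<mu>. (poly ?R x)\<^sup>2 * \<bar>poly (root_poly (W k)) x\<bar>)"
        unfolding nrm_def by (rule minimal[OF monic_prod_linear])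
      also have "\<dots> \<le> (LINT x|\<mu>. exp (- n * E))"
        by (rule integral_mono_ab) (use le in \<open>auto intro!: continuous_intros\<close>)
      also have "\<dots> = measure \<mu> UNIV * exp (- n * E)" by simp
      also have "\<dots> \<le> M * exp (- n * E)" by (intro mult_right_mono) (auto simp: M_def)
      finally have "ln (nrm k) \<le> ln (M * exp (- n * E))" using nrm_pos[of k] by simp
      also have "\<dots> = ln M - n * E" using M by (simp add: ln_mult)
      finally have "(n * E - ln M) / n \<le> - ln (nrm k) / n" using n by (intro divide_right_mono) auto
      moreover have "(n * E - ln M) / n = E - ln M / n" using n by (simp add: field_simps)
      ultimately show ?case by (simp add: E_def n_def)
    qed
    have "(\<lambda>k. C - r - 2 * (1 / e * (b - a)) / real (N k) - ln M / real (N k)) \<longlonglongrightarrow> C - r - 0 - 0"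
      by (intro tendsto_diff tendsto_const inverse_N_lim)
    from tendsto_le[OF _ nrm_lim this ev] show ?thesis by simp
  qed
  then show ?thesis by (metis add.commute diff_le_eq field_le_epsilon)
qed

text \<open>Jensen's inequality on a set \<open>S\<close> within distance \<open>h\<close> of
  \<open>t\<close>. For zeros farther than \<open>K * h\<close> from \<open>t\<close>, replacing
  \<open>t\<close> by a point of \<open>S\<close> costs at most \<open>2 / K\<close>; for closer
  ones a crude bound is paid, and their proportion is controlled by the mass of
  \<open>\<alpha>\<close> near \<open>t\<close>.\<close>

lemma lower_at_scale:
  assumes t: "t \<in> {a..b}" and K: "2 \<le> K" and r: "0 < r" "r \<le> 1" and h: "0 < h" "h \<le> (b - a) / 2"
  shows "m \<le> 2 * (log_pot h \<alpha> t + 2 / K + (1 + ln (2 * K / r)) * measure \<alpha> {t - 2 * K * h..t + 2 * K * h} + r)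
    + (log_pot g \<beta> t + h / g + r)"
proof -
  \<comment> \<open>An interval of length \<open>h\<close> at \<open>t\<close>, laid out on the side
    that stays within the given interval.\<close>
  define J where "J = (if t + h \<le> b then {t..t + h} else {t - h..t})"
  have J: "J \<in> sets borel" "J \<subseteq> {a..b}" "measure lborel J = h" "J \<subseteq> {t - h..t + h}"
    using t h by (auto simp: J_def)
  obtain dd where dd: "0 < dd" "measure lborel J / 2 < measure lborel (J \<inter> {x. dd \<le> w x})"
    using density_bounded_below[OF J(1,2)] J(3) h by auto
  define S where "S = J \<inter> {x. dd \<le> w x}"
  have S: "S \<in> sets borel" "S \<subseteq> {a..b}" "S \<subseteq> {t - h..t + h}" "h / 2 < measure lborel S"
    "\<And>x. x \<in> S \<Longrightarrow> dd \<le> w x"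
    using J dd unfolding S_def by (auto simp del: measurable_lborel1)
  have Sb: "bounded S" using S(2) by (rule bounded_subset[OF bounded_closed_interval])
  have Sfin: "emeasure lborel S < \<infinity>" using emeasure_bounded_finite[OF Sb] .
  define s where "s = measure lborel S"
  have s: "0 < s" "h / 2 < s" using S(4) h by (auto simp: s_def)
  \<comment> \<open>The scale of the excess: since \<open>S\<close> has measure above h/2, the cost
    \<open>\<rho>\<close> is at most \<open>r\<close> times that measure.\<close>
  define \<rho> where "\<rho> = r * h / 2"
  have \<rho>: "0 < \<rho>" "\<rho> \<le> r * s" using r h s(2) by (auto simp: \<rho>_def)
  define C where "C = 1 + ln (2 * K / r)"
  have C: "0 \<le> C" using K r by (auto simp: C_def intro!: add_nonneg_nonneg ln_ge_zero)
  \<comment> \<open>Continuous cutoff, equal to 1 within \<open>K * h\<close> of \<open>t\<close>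
    and to 0 beyond \<open>2 * K * h\<close>; an indicator would not be admissible for weak
    convergence.\<close>
  define B where "B z = max 0 (min 1 (2 - \<bar>t - z\<bar> / (K * h)))" for z
  define G where "G z = log_ker h \<bar>t - z\<bar> + 2 / K + C * B z" for z
  define H where "H z = log_ker g \<bar>t - z\<bar> + h / g" for z
  have Kh: "0 < K * h" "h \<le> K * h" using K h by auto
  have Gb: "log_ker \<rho> \<bar>x - z\<bar> \<le> G z" if "x \<in> S" for x z
  proof -
    have xt: "\<bar>x - t\<bar> \<le> h" using that S(3) by (auto simp: abs_le_iff)
    show ?thesis
    proof (cases "K * h \<le> \<bar>t - z\<bar>")
      case True
      let ?u = "\<bar>t - z\<bar>"
      have up: "0 < ?u" using True Kh by linarith
      have "h \<le> ?u / K" using True K by (simp add: field_simps)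
      then have le: "?u * (1 - 1 / K) \<le> \<bar>x - z\<bar>" using xt by (simp add: algebra_simps)
      have K1: "1 / K \<le> 1 / 2" "0 \<le> 1 / K" using K by (auto simp: field_simps)
      then have K0: "0 < 1 - 1 / K" by linarith
      have "0 < ?u * (1 - 1 / K)" by (rule mult_pos_pos[OF up K0])
      then have "log_ker \<rho> \<bar>x - z\<bar> \<le> - ln \<bar>x - z\<bar>" using le \<rho> by (intro log_ker_le_ln) auto
      also have "\<dots> \<le> - ln (?u * (1 - 1 / K))" using le \<open>0 < ?u * (1 - 1 / K)\<close> by simp
      also have "\<dots> = - ln ?u - ln (1 - 1 / K)" by (simp only: ln_mult_pos[OF up K0])
      also have "\<dots> \<le> - ln ?u + 2 / K"
      proof -
        have "- (1 / K) - 2 * (1 / K)\<^sup>2 \<le> ln (1 - 1 / K)" by (rule ln_one_minus_pos_lower_bound[OF K1(2,1)])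
        moreover have "2 * (1 / K)\<^sup>2 \<le> 1 / K"
          using mult_left_mono[OF K1(1) K1(2)] by (simp add: power2_eq_square)
        ultimately show ?thesis by simp
      qed
      also have "- ln ?u = log_ker h ?u" using True Kh h by (intro log_ker_eq[symmetric]) linarith+
      also have "log_ker h ?u + 2 / K \<le> G z" using C by (auto simp: G_def B_def intro!: mult_nonneg_nonneg)
      finally show ?thesis .
    next
      case False
      have "\<bar>t - z\<bar> / (K * h) \<le> 1" using False Kh by (simp add: divide_le_eq)
      then have B1: "B z = 1" by (simp add: B_def)
      have "log_ker \<rho> \<bar>x - z\<bar> \<le> 1 - ln \<rho>" using \<rho> by (intro log_ker_le) auto
      \<comment> \<open>This identity dictates \<open>C\<close>: the ceiling at scale
        \<open>\<rho>\<close> exceeds the value of -ln at distance \<open>K * h\<close> by exactly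
        \<open>C\<close>.\<close>
      also have "\<dots> = - ln (K * h) + C" using K h r by (simp add: C_def \<rho>_def ln_mult ln_div)
      also have "\<dots> \<le> log_ker h \<bar>t - z\<bar> + C" using False h Kh log_ker_ge[of h "\<bar>t - z\<bar>" "K * h"] by simp
      also have "\<dots> \<le> G z" using K by (simp add: G_def B1)
      finally show ?thesis .
    qed
  qed
  have Hb: "log_ker \<rho> \<bar>x - z\<bar> \<le> H z" if "x \<in> S" "z \<in> {c..d}" for x z
  proof -
    have xt: "\<bar>x - t\<bar> \<le> h" using that S(3) by (auto simp: abs_le_iff)
    have gx: "g \<le> \<bar>x - z\<bar>" using gap that S(2) by blast
    have "log_ker \<rho> \<bar>x - z\<bar> \<le> - ln \<bar>x - z\<bar>" using gx g \<rho> by (intro log_ker_le_ln) auto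
    also have "\<dots> = log_ker g \<bar>x - z\<bar>" using gx g by (simp add: log_ker_eq)
    also have "\<dots> \<le> log_ker g \<bar>t - z\<bar> + \<bar>\<bar>x - z\<bar> - \<bar>t - z\<bar>\<bar> / g"
      using log_ker_lipschitz[OF g, of "\<bar>x - z\<bar>" "\<bar>t - z\<bar>"] by linarith
    also have "\<dots> \<le> H z" unfolding H_def using xt g by (intro add_left_mono divide_right_mono) auto
    finally show ?thesis .
  qed
  have intG: "integrable lborel (\<lambda>x. indicator S x * - ln \<bar>x - z\<bar>)"
    "(LINT x|lborel. indicator S x * - ln \<bar>x - z\<bar>) \<le> (G z + r) * s" for z
    using ln_set_integral_le[OF S(1) Sb \<rho>(1) Gb, of z] \<rho>(2) by (auto simp: s_def algebra_simps)
  have intH: "(LINT x|lborel. indicator S x * - ln \<bar>x - z\<bar>) \<le> (H z + r) * s" if "z \<in> {c..d}" for z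
    using ln_set_integral_le(2)[OF S(1) Sb \<rho>(1) Hb, of z] that \<rho>(2) by (auto simp: s_def algebra_simps)
  have ev: "- ln (nrm k) / real (N k) \<le> 2 * ((\<Sum>z\<in>Z k. G z) / real (N k) + r) + ((\<Sum>z\<in>W k. H z) / real (N k) + r) + - ln (dd * s) / real (N k)" for k
  proof -
    define n where "n = real (N k)"
    have n: "0 < n" using N_pos by (simp add: n_def)
    let ?l = "\<lambda>x. 2 * (\<Sum>z\<in>Z k. ln \<bar>x - z\<bar>) + (\<Sum>z\<in>W k. ln \<bar>x - z\<bar>)"
    \<comment> \<open>A lower bound for the average over \<open>S\<close> of the logarithm of the
      weighted square; the summand \<open>r\<close> per zero absorbs the excess.\<close>
    define A where "A = - (2 * (\<Sum>z\<in>Z k. G z + r) + (\<Sum>z\<in>W k. H z + r))"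
    have leq: "indicator S x * ?l x = - (2 * (\<Sum>z\<in>Z k. indicator S x * - ln \<bar>x - z\<bar>) + (\<Sum>z\<in>W k. indicator S x * - ln \<bar>x - z\<bar>))" for x :: real
      by (simp add: sum_distrib_left sum_negf algebra_simps)
    have intl: "integrable lborel (\<lambda>x. indicator S x * ?l x)"
      unfolding leq by (intro Bochner_Integration.integrable_minus Bochner_Integration.integrable_add integrable_mult_right
          Bochner_Integration.integrable_sum intG(1))
    have I: "(LINT x|lborel. indicator S x * ?l x) =
        - (2 * (\<Sum>z\<in>Z k. LINT x|lborel. indicator S x * - ln \<bar>x - z\<bar>) + (\<Sum>z\<in>W k. LINT x|lborel. indicator S x * - ln \<bar>x - z\<bar>))"
    proof -
      have 1: "integrable lborel (\<lambda>x. \<Sum>z\<in>A. indicator S x * - ln \<bar>x - z\<bar>)" for A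
        by (intro Bochner_Integration.integrable_sum intG(1))
      show ?thesis unfolding leq
        by (simp only: Bochner_Integration.integral_minus Bochner_Integration.integral_add[OF integrable_mult_right[OF 1] 1]
            integral_mult_right_zero Bochner_Integration.integral_sum[OF intG(1)])
    qed
    have IZ: "(\<Sum>z\<in>Z k. LINT x|lborel. indicator S x * - ln \<bar>x - z\<bar>) \<le> (\<Sum>z\<in>Z k. G z + r) * s"
      unfolding sum_distrib_right by (intro sum_mono intG(2))
    have IW: "(\<Sum>z\<in>W k. LINT x|lborel. indicator S x * - ln \<bar>x - z\<bar>) \<le> (\<Sum>z\<in>W k. H z + r) * s"
      unfolding sum_distrib_right using W(3)[of k] by (intro sum_mono intH) blast
    have "A * s = - (2 * ((\<Sum>z\<in>Z k. G z + r) * s) + (\<Sum>z\<in>W k. H z + r) * s)"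
      unfolding A_def by algebra
    with IZ IW have Al: "A * measure lborel S \<le> (LINT x|lborel. indicator S x * ?l x)"
      unfolding I s_def[symmetric] by linarith
    have "dd * measure lborel S * exp A \<le> nrm k"
      unfolding nrm_def
    proof (rule jensen_lower_bound[OF _ _ S(1) Sfin dd(1) S(5) intl _ Al])
      have "AE x in lborel. x \<notin> Z k \<union> W k"
        using Z(1) W(1) by (intro AE_not_in finite_imp_null_set_lborel) auto
      then show "AE x in lborel. x \<in> S \<longrightarrow> exp (?l x) \<le> (poly (root_poly (Z k)) x)\<^sup>2 * \<bar>poly (root_poly (W k)) x\<bar>"
        by eventually_elim (simp add: exp_sum_ln_eq[OF Z(1) W(1)])
    qed (auto intro!: continuous_intros)
    then have "ln (dd * s * exp A) \<le> ln (nrm k)" using dd s nrm_pos[of k] by (simp add: s_def)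
    moreover have "ln (dd * s * exp A) = ln (dd * s) + A" using dd s by (simp add: ln_mult)
    ultimately have "- ln (nrm k) / n \<le> (- A - ln (dd * s)) / n" using n by (intro divide_right_mono) auto
    also have "\<dots> = 2 * ((\<Sum>z\<in>Z k. G z) / n + r) + ((\<Sum>z\<in>W k. H z) / n + r) + - ln (dd * s) / n"
      using n Z(2) W(2) by (simp add: A_def sum.distrib n_def[symmetric] field_simps)
    finally show ?thesis unfolding n_def .
  qed
  have Bc: "continuous_on UNIV B" unfolding B_def using Kh by (intro continuous_intros) auto
  have Gc: "continuous_on UNIV G" unfolding G_def using h by (intro continuous_intros Bc) auto
  have Hc: "continuous_on UNIV H" unfolding H_def using g by (intro continuous_intros) auto
  have "(\<lambda>k. 2 * ((\<Sum>z\<in>Z k. G z) / real (N k) + r) + ((\<Sum>z\<in>W k. H z) / real (N k) + r) + - ln (dd * s) / real (N k))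
      \<longlonglongrightarrow> 2 * ((LINT z|\<alpha>. G z) + r) + ((LINT z|\<beta>. H z) + r) + 0"
    by (intro tendsto_intros conv_\<alpha>[OF Gc] conv_\<beta>[OF Hc] inverse_N_lim)
  from LIMSEQ_le[OF nrm_lim this] ev
  have "m \<le> 2 * ((LINT z|\<alpha>. G z) + r) + ((LINT z|\<beta>. H z) + r)" by auto
  moreover have "(LINT z|\<beta>. H z) = log_pot g \<beta> t + h / g"
  proof -
    interpret \<beta>: prob_space \<beta> using prob_on_D[OF \<beta>] by simp
    show ?thesis unfolding H_def log_pot_def using log_ker_integrable[OF \<beta> g] \<beta>.prob_space by simp
  qed
  moreover have "(LINT z|\<alpha>. G z) \<le> log_pot h \<alpha> t + 2 / K + C * measure \<alpha> {t - 2 * K * h..t + 2 * K * h}"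
  proof -
    interpret \<alpha>: prob_space \<alpha> using prob_on_D[OF \<alpha>] by simp
    note [measurable_cong] = prob_on_D(2)[OF \<alpha>]
    have intB: "integrable \<alpha> B"
      by (rule integrable_cont_prob_on[OF \<alpha> borel_measurable_continuous_onI[OF Bc], of 1]) (auto simp: B_def)
    let ?I = "{t - 2 * K * h..t + 2 * K * h}"
    have "(LINT z|\<alpha>. B z) \<le> (LINT z|\<alpha>. indicator ?I z)"
    proof (rule integral_mono[OF intB])
      show "integrable \<alpha> (indicator ?I :: real \<Rightarrow> real)" by (simp add: prob_on_D(2)[OF \<alpha>] less_top[symmetric])
      fix z
      have "\<bar>t - z\<bar> / (K * h) > 2" if "z \<notin> ?I"
      proof -
        have "2 * (K * h) < \<bar>t - z\<bar>" using that by auto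
        then show ?thesis using Kh by (simp add: less_divide_eq)
      qed
      then show "B z \<le> indicator ?I z" by (auto simp: B_def indicator_def)
    qed
    also have "\<dots> = measure \<alpha> ?I" by (simp add: prob_on_D(2,3)[OF \<alpha>])
    finally have "C * (LINT z|\<alpha>. B z) \<le> C * measure \<alpha> ?I" using C by (rule mult_left_mono)
    then show ?thesis unfolding G_def log_pot_def
      using log_ker_integrable[OF \<alpha> h(1)] intB \<alpha>.prob_space by simp
  qed
  moreover have "M \<le> 2 * (P + r) + (Q + r)" if "M \<le> 2 * (x + r) + (y + r)" "y = Q" "x \<le> P" for M P Q x y :: real
    using that by argo
  ultimately show ?thesis unfolding C_def by blast
qed

end

section \<open>Atoms and the effect of spreading mass\<close>

lemma small_interval:
  assumes "prob_on a b \<alpha>" "measure \<alpha> {t} = 0" "0 < r"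
  obtains s where "0 < s" "measure \<alpha> {t - s..t + s} < r"
proof -
  interpret \<alpha>: prob_space \<alpha> using prob_on_D[OF assms(1)] by simp
  define h where "h n = 1 / real (Suc n)" for n
  define A where "A n = {t - h n..t + h n}" for n
  have hmono: "h n \<le> h k" if "k \<le> n" for n k using that by (auto simp: h_def field_simps)
  have h0: "h \<longlonglongrightarrow> 0" unfolding h_def
    by (rule real_tendsto_divide_at_top[OF tendsto_const filterlim_compose[OF filterlim_real_sequentially filterlim_Suc]])
  have "decseq A" unfolding A_def decseq_def using hmono by (auto intro: order_trans dest: hmono)
  moreover have "(\<Inter>n. A n) = {t}"
  proof
    show "(\<Inter>n. A n) \<subseteq> {t}"
    proof
      fix y assume "y \<in> (\<Inter>n. A n)"
      then have "\<bar>y - t\<bar> \<le> h n" for n by (auto simp: A_def abs_le_iff algebra_simps)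
      then have "\<bar>y - t\<bar> \<le> 0" by (intro LIMSEQ_le_const[OF h0]) auto
      then show "y \<in> {t}" by simp
    qed
    show "{t} \<subseteq> (\<Inter>n. A n)" by (auto simp: A_def h_def)
  qed
  moreover have "range A \<subseteq> sets \<alpha>" by (auto simp: A_def prob_on_D(2)[OF assms(1)])
  ultimately have "(\<lambda>n. measure \<alpha> (A n)) \<longlonglongrightarrow> 0"
    using \<alpha>.finite_Lim_measure_decseq[of A] assms(2) by metis
  then have "\<forall>\<^sub>F n in sequentially. measure \<alpha> (A n) < r" using assms(3) by (rule order_tendstoD(2))
  then obtain n where "measure \<alpha> (A n) < r" by (auto simp: eventually_sequentially)
  then show ?thesis by (intro that[of "h n"]) (auto simp: A_def h_def)
qed

text \<open>The kernel at distance 0 is 1 - ln e, so an atom makes the truncated potentials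
  unbounded as \<open>e\<close> tends to 0, whereas the remaining mass contributes at least
  \<open>- ln D\<close>.\<close>

lemma log_pot_atom:
  assumes \<alpha>: "prob_on a b \<alpha>" and t: "t \<in> {a..b}" and atom: "measure \<alpha> {t} \<noteq> 0"
  shows "\<exists>e>0. C < log_pot e \<alpha> t"
proof -
  interpret \<alpha>: prob_space \<alpha> using prob_on_D[OF \<alpha>] by simp
  note [measurable_cong] = prob_on_D(2)[OF \<alpha>]
  define q where "q = measure \<alpha> {t}"
  have q: "0 < q" "q \<le> 1" using atom by (auto simp: q_def less_le)
  define D where "D = max 1 (b - a)"
  \<comment> \<open>Chosen so that the atom of mass \<open>q\<close> alone outweighs \<bar>C\<bar> +
    ln D + 1; then e = exp(-X) gives the kernel the value 1 + X at 0.\<close>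
  define X where "X = (\<bar>C\<bar> + ln D + 1) / q"
  have lnD: "0 \<le> ln D" by (simp add: D_def)
  have X: "0 < X" using q lnD by (simp add: X_def add_nonneg_pos)
  define e where "e = exp (- X)"
  have e: "0 < e" "e \<le> 1" using X by (auto simp: e_def)
  have "(LINT y|\<alpha>. (1 + X) * indicator {t} y - ln D) \<le> log_pot e \<alpha> t"
    unfolding log_pot_def
  proof (rule integral_mono_AE)
    show "AE y in \<alpha>. (1 + X) * indicator {t} y - ln D \<le> log_ker e \<bar>t - y\<bar>"
      using prob_on_D(4)[OF \<alpha>]
    proof eventually_elim
      case (elim y)
      have "- ln D \<le> log_ker e \<bar>t - y\<bar>" using elim t e by (intro log_ker_ge) (auto simp: D_def)
      moreover have "log_ker e 0 = 1 + X" using e by (simp add: log_ker_def) (simp add: e_def)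
      ultimately show ?case using lnD by (cases "y = t") auto
    qed
    show "integrable \<alpha> (\<lambda>y. (1 + X) * indicator {t} y - ln D)"
      by (intro Bochner_Integration.integrable_diff integrable_mult_right) (auto simp: prob_on_D(2)[OF \<alpha>] less_top[symmetric])
  qed (rule log_ker_integrable[OF \<alpha> e(1)])
  moreover have "(LINT y|\<alpha>. (1 + X) * indicator {t} y - ln D) = (1 + X) * q - ln D"
    by (subst Bochner_Integration.integral_diff)
      (auto simp: prob_on_D(2,3)[OF \<alpha>] less_top[symmetric] q_def \<alpha>.prob_space[simplified prob_on_D(3)[OF \<alpha>]])
  moreover have "X * q = \<bar>C\<bar> + ln D + 1" using q by (simp add: X_def)
  ultimately have "\<bar>C\<bar> + 1 \<le> log_pot e \<alpha> t" using q by (simp add: algebra_simps)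
  then show ?thesis using e by (intro exI[of _ e]) auto
qed

text \<open>Quantitative concavity of ln: the product of u - s and u + s is u^2 (1 - s^2/u^2), and
  ln(1 - v) \<le> -v.\<close>

lemma two_point_log_gain:
  fixes s u D :: real
  assumes "0 < s" "s < u" "u \<le> D"
  shows "- 2 * ln u + s\<^sup>2 / D\<^sup>2 \<le> - ln (u - s) - ln (u + s)"
proof -
  have u: "0 < u" using assms by simp
  have su: "s\<^sup>2 < u\<^sup>2" using assms by (intro power_strict_mono) auto
  have "ln (u - s) + ln (u + s) = ln ((u - s) * (u + s))"
    using assms by (intro ln_mult_pos[symmetric]) auto
  also have "(u - s) * (u + s) = u\<^sup>2 * (1 - s\<^sup>2 / u\<^sup>2)" using u by (simp add: field_simps power2_eq_square)
  also have "ln \<dots> = ln (u\<^sup>2) + ln (1 - s\<^sup>2 / u\<^sup>2)" using u su by (intro ln_mult_pos) (auto simp: field_simps)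
  also have "ln (u\<^sup>2) = 2 * ln u" using u by (simp add: ln_realpow)
  also have "ln (1 - s\<^sup>2 / u\<^sup>2) \<le> - (s\<^sup>2 / u\<^sup>2)"
    using ln_le_minus_one[of "1 - s\<^sup>2 / u\<^sup>2"] u su by (simp add: field_simps)
  finally have "ln (u - s) + ln (u + s) \<le> 2 * ln u - s\<^sup>2 / u\<^sup>2" by simp
  moreover have "s\<^sup>2 / D\<^sup>2 \<le> s\<^sup>2 / u\<^sup>2"
    using assms u by (intro divide_left_mono power_mono) auto
  ultimately show ?thesis by simp
qed

text \<open>Clamping to the interval affects only the half that moves away from \<open>t\<close>,
  since \<open>t\<close> itself lies in the interval, and brings it closer. So the distances are at
  most \<open>u - s\<close> and \<open>u + s\<close>, enough for a decreasing kernel.\<close>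

lemma log_ker_spread_gain:
  assumes "0 < s" "s \<le> r / 2" "0 < e" "e \<le> r / 2" "t \<in> {a..b}" "y \<in> {a..b}" "r \<le> \<bar>t - y\<bar>"
  shows "2 * log_ker e \<bar>t - y\<bar> + s\<^sup>2 / (b - a)\<^sup>2 \<le> log_ker e \<bar>t - min b (y + s)\<bar> + log_ker e \<bar>t - max a (y - s)\<bar>"
proof -
  let ?u = "\<bar>t - y\<bar>"
  have u: "s < ?u" "?u \<le> b - a" "e \<le> ?u" using assms by auto
  have ge: "- ln (?u - s) \<le> log_ker e v" if "v \<le> ?u - s" for v
    using assms that by (intro log_ker_ge) auto
  have ge': "- ln (?u + s) \<le> log_ker e v" if "v \<le> ?u + s" for v
    using assms that by (intro log_ker_ge) auto
  have "- ln (?u - s) - ln (?u + s) \<le> log_ker e \<bar>t - min b (y + s)\<bar> + log_ker e \<bar>t - max a (y - s)\<bar>"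
  proof (cases "y \<le> t")
    case True
    then have "\<bar>t - min b (y + s)\<bar> \<le> ?u - s" "\<bar>t - max a (y - s)\<bar> \<le> ?u + s" using assms by (auto simp: min_def max_def)
    then show ?thesis using ge ge' by fastforce
  next
    case False
    then have "\<bar>t - min b (y + s)\<bar> \<le> ?u + s" "\<bar>t - max a (y - s)\<bar> \<le> ?u - s" using assms by (auto simp: min_def max_def)
    then show ?thesis using ge ge' by fastforce
  qed
  moreover have "log_ker e ?u = - ln ?u" using u assms by (intro log_ker_eq) auto
  ultimately show ?thesis using two_point_log_gain[OF assms(1) u(1,2)] by simp
qed

context angelesco_side
begin

text \<open>If \<open>t\<close> is not an atom, the mass near \<open>t\<close> can be made so small
  that it outweighs the constant of \<open>lower_at_scale\<close>. At an atom the potential is as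
  large as desired.\<close>

lemma lower_pointwise:
  assumes t: "t \<in> {a..b}" and r: "0 < r"
  shows "\<exists>e>0. m - r < 2 * log_pot e \<alpha> t + log_pot g \<beta> t"
proof (cases "measure \<alpha> {t} = 0")
  case True
  \<comment> \<open>The errors at scale \<open>h\<close> are at most 8 q altogether; the bound by 1
    gives \<open>K \<ge> 2\<close>.\<close>
  define q where "q = min 1 (r / 20)"
  have q: "0 < q" "q \<le> 1" "20 * q \<le> r" using r by (auto simp: q_def min_def)
  define K where "K = 2 / q"
  have K: "2 \<le> K" "2 / K = q" using q by (auto simp: K_def field_simps)
  define C where "C = 1 + ln (2 * K / q)"
  have "1 \<le> 2 * K / q" using K(1) q(1,2) by (simp only: le_divide_eq) simp
  then have C: "0 < C" unfolding C_def by (intro add_pos_nonneg ln_ge_zero) auto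
  obtain s where s: "0 < s" "measure \<alpha> {t - s..t + s} < q / C"
    using small_interval[OF \<alpha> True, of "q / C"] q C by auto
  define h where "h = min (s / (2 * K)) (min (q * g) ((b - a) / 2))"
  have "0 < s / (2 * K)" "0 < q * g" "0 < (b - a) / 2" using s K(1) q g ab by auto
  then have h: "0 < h" "h \<le> s / (2 * K)" "h \<le> q * g" "h \<le> (b - a) / 2"
    unfolding h_def by linarith+
  have "2 * K * h \<le> s" using h(2) K by (simp add: field_simps)
  then have "measure \<alpha> {t - 2 * K * h..t + 2 * K * h} \<le> measure \<alpha> {t - s..t + s}"
    using prob_on_D(1,2)[OF \<alpha>] by (intro finite_measure.finite_measure_mono prob_space.finite_measure) auto
  then have "measure \<alpha> {t - 2 * K * h..t + 2 * K * h} \<le> q / C" using s by simp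
  then have 1: "C * measure \<alpha> {t - 2 * K * h..t + 2 * K * h} \<le> q" using C by (simp add: field_simps)
  have 2: "h / g \<le> q" using h(3) g by (simp add: field_simps)
  have "m \<le> 2 * (log_pot h \<alpha> t + q + C * measure \<alpha> {t - 2 * K * h..t + 2 * K * h} + q) + (log_pot g \<beta> t + h / g + q)"
    using lower_at_scale[OF t K(1) q(1,2) h(1,4)] unfolding K(2) C_def .
  then have "m - r < 2 * log_pot h \<alpha> t + log_pot g \<beta> t" using 1 2 q by argo
  then show ?thesis using h by blast
next
  case False
  then obtain e where "0 < e" "\<bar>m - r - log_pot g \<beta> t\<bar> + 1 < log_pot e \<alpha> t"
    using log_pot_atom[OF \<alpha> t] by blast
  then show ?thesis by (intro exI[of _ e]) linarith
qed

lemma lower_uniform: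
  assumes r: "0 < r"
  obtains e where "0 < e" "\<And>e' t. 0 < e' \<Longrightarrow> e' \<le> e \<Longrightarrow> t \<in> {a..b} \<Longrightarrow> m - r < 2 * log_pot e' \<alpha> t + log_pot g \<beta> t"
proof -
  have "\<exists>e>0. \<forall>t\<in>{a..b}. m - r < 2 * log_pot e \<alpha> t + log_pot g \<beta> t"
  proof (rule dini_lower)
    show "continuous_on {a..b} (\<lambda>t. 2 * log_pot e \<alpha> t + log_pot g \<beta> t)" if "0 < e" for e
      by (intro continuous_intros log_pot_continuous[OF \<alpha> that] log_pot_continuous[OF \<beta> g])
    show "2 * log_pot e' \<alpha> t + log_pot g \<beta> t \<le> 2 * log_pot e \<alpha> t + log_pot g \<beta> t" if "0 < e" "e \<le> e'" for e e' t
      using log_pot_mono_trunc[OF \<alpha> that, of t] by simp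
  qed (use lower_pointwise[OF _ r] in auto)
  then obtain e where e: "0 < e" "\<And>t. t \<in> {a..b} \<Longrightarrow> m - r < 2 * log_pot e \<alpha> t + log_pot g \<beta> t" by blast
  show ?thesis
  proof (rule that[OF e(1)])
    fix e' t assume "0 < e'" "e' \<le> e" "t \<in> {a..b}"
    then show "m - r < 2 * log_pot e' \<alpha> t + log_pot g \<beta> t"
      using e(2)[of t] log_pot_mono_trunc[OF \<alpha>, of e' e t] by simp
  qed
qed

text \<open>If the inequality failed at a point of the support, splitting the mass near that point and
  moving the halves apart would raise the minimum of \<open>2 U(\<alpha>) + U(\<beta>)\<close>, contradicting
  \<open>test_measure\<close>.\<close>

lemma upper_on_supp:
  assumes x0: "x0 \<in> supp \<alpha>" and e0: "0 < e0"
  shows "2 * log_pot e0 \<alpha> x0 + log_pot g \<beta> x0 \<le> m"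
proof (rule ccontr)
  assume neg: "\<not> ?thesis"
  interpret \<alpha>: prob_space \<alpha> using prob_on_D[OF \<alpha>] by simp
  note [measurable_cong] = prob_on_D(2)[OF \<alpha>]
  \<comment> \<open>A third of the alleged surplus: one third is spent on continuity near
    \<open>x0\<close>, one on moving the mass, one remains.\<close>
  define q where "q = (2 * log_pot e0 \<alpha> x0 + log_pot g \<beta> x0 - m) / 3"
  have q: "0 < q" using neg by (simp add: q_def)
  let ?f = "\<lambda>t. 2 * log_pot e0 \<alpha> t + log_pot g \<beta> t"
  have "continuous_on UNIV ?f"
    by (intro continuous_intros log_pot_continuous[OF \<alpha> e0] log_pot_continuous[OF \<beta> g])
  then have "isCont ?f x0" by (simp add: continuous_on_eq_continuous_at)
  then obtain r2 where r2: "0 < r2" "\<And>t. \<bar>t - x0\<bar> < r2 \<Longrightarrow> \<bar>?f t - ?f x0\<bar> < q"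
    using q unfolding continuous_at_eps_delta dist_real_def by metis
  \<comment> \<open>Mass is moved within distance \<open>r\<close> of \<open>x0\<close>, while the
    surplus is known within 2 r; hence any other \<open>t\<close> has distance at least
    \<open>r\<close> from the moved mass.\<close>
  define r where "r = r2 / 2"
  have r: "0 < r" using r2 by (simp add: r_def)
  have near: "m + 2 * q < ?f t" if "\<bar>t - x0\<bar> < 2 * r" for t
  proof -
    have "\<bar>?f t - ?f x0\<bar> < q" using that by (intro r2(2)) (simp add: r_def)
    moreover have "?f x0 = m + 3 * q" unfolding q_def by argo
    ultimately show ?thesis by linarith
  qed
  define B where "B = ball x0 r"
  have [measurable]: "B \<in> sets borel" by (simp add: B_def)
  have mB: "0 < measure \<alpha> B"
  proof -
    have "0 < emeasure \<alpha> B" using x0 r unfolding supp_def B_def by auto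
    then show ?thesis by (simp add: \<alpha>.emeasure_eq_measure)
  qed
  \<comment> \<open>Below r/2 for the concavity gain; below e0 q / 2 so that the loss near
    \<open>x0\<close>, at most s / e0 by the Lipschitz bound and counted twice, stays within
    \<open>q\<close>.\<close>
  define s where "s = min (r / 2) (e0 * q / 2)"
  have s: "0 < s" "s \<le> r / 2" "s \<le> e0 * q / 2" using r e0 q by (auto simp: s_def)
  \<comment> \<open>A fair coin sends each point of \<open>B\<close> a distance \<open>s\<close> to
    the right or left, clamped to the interval. The push-forward is the spread measure.\<close>
  define Y where "Y yc = (if fst yc \<in> B then if snd yc then min b (fst yc + s) else max a (fst yc - s) else fst yc)" for yc :: "real \<times> bool"
  let ?C = "measure_pmf (bernoulli_pmf (1/2))"
  interpret P: pair_prob_space \<alpha> ?C ..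
  have Ym [measurable]: "Y \<in> borel_measurable (\<alpha> \<Otimes>\<^sub>M ?C)"
  proof -
    have 1: "(\<lambda>yc. min b (fst yc + s)) \<in> borel_measurable (\<alpha> \<Otimes>\<^sub>M ?C)" "(\<lambda>yc. max a (fst yc - s)) \<in> borel_measurable (\<alpha> \<Otimes>\<^sub>M ?C)"
      "fst \<in> borel_measurable (\<alpha> \<Otimes>\<^sub>M ?C)"
      by measurable
    have 2: "{yc \<in> space (\<alpha> \<Otimes>\<^sub>M ?C). snd yc} \<in> sets (\<alpha> \<Otimes>\<^sub>M ?C)" "{yc \<in> space (\<alpha> \<Otimes>\<^sub>M ?C). fst yc \<in> B} \<in> sets (\<alpha> \<Otimes>\<^sub>M ?C)"
      by measurable
    show ?thesis unfolding Y_def by (intro measurable_If 1 2)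
  qed
  define \<sigma> where "\<sigma> = distr (\<alpha> \<Otimes>\<^sub>M ?C) borel Y"
  have int\<sigma>: "(LINT z|\<sigma>. f z) = (LINT y|\<alpha>. (f (Y (y, True)) + f (Y (y, False))) / 2)"
    if f: "f \<in> borel_measurable borel" "\<And>x. \<bar>f x\<bar> \<le> M" for f :: "real \<Rightarrow> real" and M
  proof -
    have "integrable (\<alpha> \<Otimes>\<^sub>M ?C) (\<lambda>yc. f (Y yc))"
      by (rule P.integrable_const_bound[of _ M]) (use f in auto)
    then have "(LINT y|\<alpha>. LINT c|?C. f (Y (y, c))) = (LINT yc|(\<alpha> \<Otimes>\<^sub>M ?C). f (Y yc))"
      by (subst P.integral_fst'[symmetric]) auto
    moreover have "(LINT z|\<sigma>. f z) = (LINT yc|(\<alpha> \<Otimes>\<^sub>M ?C). f (Y yc))"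
      unfolding \<sigma>_def using f by (subst integral_distr) auto
    moreover have "(LINT c|?C. f (Y (y, c))) = (f (Y (y, True)) + f (Y (y, False))) / 2" for y
      by (simp add: integral_bernoulli_pmf)
    ultimately show ?thesis by simp
  qed
  have Yab: "Y (y, c) \<in> {a..b}" "\<bar>Y (y, c) - y\<bar> \<le> s" if "y \<in> {a..b}" for y c
    using that s(1) by (auto simp: Y_def)
  have \<sigma>: "prob_on a b \<sigma>"
  proof (rule prob_on_I)
    show "prob_space \<sigma>" unfolding \<sigma>_def by (rule P.prob_space_distr) measurable
    have "AE yc in \<alpha> \<Otimes>\<^sub>M ?C. fst yc \<in> {a..b}"
      by (rule P.AE_pair_measure) (use prob_on_D(4)[OF \<alpha>] in auto)
    then have "AE yc in \<alpha> \<Otimes>\<^sub>M ?C. Y yc \<in> {a..b}"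
      by eventually_elim (metis Yab(1) prod.collapse)
    then show "AE z in \<sigma>. z \<in> {a..b}" unfolding \<sigma>_def by (subst AE_distr_iff) auto
  qed (simp add: \<sigma>_def)
  have log_pot\<sigma>: "log_pot e \<sigma> t = (LINT y|\<alpha>. (log_ker e \<bar>t - Y (y, True)\<bar> + log_ker e \<bar>t - Y (y, False)\<bar>) / 2)"
    and int: "integrable \<alpha> (\<lambda>y. (log_ker e \<bar>t - Y (y, True)\<bar> + log_ker e \<bar>t - Y (y, False)\<bar>) / 2)" if e: "0 < e" for e t
  proof -
    \<comment> \<open>Clamped version of the kernel, bounded on the whole line as
      \<open>int\<sigma>\<close> requires.\<close>
    define c where "c z = log_ker e \<bar>t - max a (min b z)\<bar>" for z
    have cm [measurable]: "c \<in> borel_measurable borel" unfolding c_def by measurable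
    have cb: "\<bar>c z\<bar> \<le> 1 + \<bar>ln e\<bar> + \<bar>ln (max e (\<bar>t\<bar> + \<bar>a\<bar> + \<bar>b\<bar>))\<bar>" for z
      unfolding c_def using e by (intro log_ker_bounded) auto
    have ceq: "c z = log_ker e \<bar>t - z\<bar>" if "z \<in> {a..b}" for z using that by (auto simp: c_def)
    have m1: "(\<lambda>y. Y (y, v)) \<in> borel_measurable \<alpha>" for v
    proof -
      have "(\<lambda>y. Y (y, v)) = (\<lambda>y. if y \<in> B then if v then min b (y + s) else max a (y - s) else y)"
        by (auto simp: Y_def)
      then show ?thesis by simp
    qed
    note [measurable] = m1[of True] m1[of False]
    have "log_pot e \<sigma> t = (LINT z|\<sigma>. c z)"
      unfolding log_pot_def
    proof (rule integral_cong_AE)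
      show "AE z in \<sigma>. log_ker e \<bar>t - z\<bar> = c z" using prob_on_D(4)[OF \<sigma>] by eventually_elim (simp add: ceq)
    qed (simp_all add: prob_on_D(2)[OF \<sigma>] cong: measurable_cong_sets)
    also have "\<dots> = (LINT y|\<alpha>. (c (Y (y, True)) + c (Y (y, False))) / 2)" by (rule int\<sigma>[OF cm cb])
    also have "\<dots> = (LINT y|\<alpha>. (log_ker e \<bar>t - Y (y, True)\<bar> + log_ker e \<bar>t - Y (y, False)\<bar>) / 2)"
    proof (rule integral_cong_AE)
      show "AE y in \<alpha>. (c (Y (y, True)) + c (Y (y, False))) / 2 = (log_ker e \<bar>t - Y (y, True)\<bar> + log_ker e \<bar>t - Y (y, False)\<bar>) / 2"
        using prob_on_D(4)[OF \<alpha>] by eventually_elim (simp only: ceq[OF Yab(1)])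
    qed measurable
    finally show "log_pot e \<sigma> t = (LINT y|\<alpha>. (log_ker e \<bar>t - Y (y, True)\<bar> + log_ker e \<bar>t - Y (y, False)\<bar>) / 2)" .
    show "integrable \<alpha> (\<lambda>y. (log_ker e \<bar>t - Y (y, True)\<bar> + log_ker e \<bar>t - Y (y, False)\<bar>) / 2)"
    proof (rule integrable_cong_AE_imp)
      show "integrable \<alpha> (\<lambda>y. (c (Y (y, True)) + c (Y (y, False))) / 2)"
        by (intro Bochner_Integration.integrable_divide Bochner_Integration.integrable_add \<alpha>.integrable_const_bound[OF AE_I2])
          (use cb m1 in auto)
      show "AE y in \<alpha>. (c (Y (y, True)) + c (Y (y, False))) / 2 = (log_ker e \<bar>t - Y (y, True)\<bar> + log_ker e \<bar>t - Y (y, False)\<bar>) / 2"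
        using prob_on_D(4)[OF \<alpha>] by eventually_elim (simp only: ceq[OF Yab(1)])
    qed measurable
  qed
  \<comment> \<open>Half the two-point gain, since the coin averages the two positions.\<close>
  define \<kappa> where "\<kappa> = s\<^sup>2 / (2 * (b - a)\<^sup>2)"
  have \<kappa>: "0 < \<kappa>" using s ab by (simp add: \<kappa>_def)
  define \<gamma> where "\<gamma> = measure \<alpha> B * \<kappa>"
  have \<gamma>: "0 < \<gamma>" using mB \<kappa> by (simp add: \<gamma>_def)
  \<comment> \<open>The scale is chosen after \<open>\<gamma>\<close>: away from \<open>x0\<close>
    the potential of \<open>\<alpha>\<close> gains \<open>\<gamma>\<close>, counted twice, which
    beats the deficit \<open>\<gamma>\<close> of the lower bound.\<close>
  obtain e1 where e1: "0 < e1" "\<And>e' t. 0 < e' \<Longrightarrow> e' \<le> e1 \<Longrightarrow> t \<in> {a..b} \<Longrightarrow> m - \<gamma> < 2 * log_pot e' \<alpha> t + log_pot g \<beta> t"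
    using lower_uniform[OF \<gamma>] by blast
  define e where "e = min e1 (min e0 (r / 2))"
  have e: "0 < e" "e \<le> e1" "e \<le> e0" "e \<le> r / 2" using e1 e0 r by (auto simp: e_def)
  have "m + min q \<gamma> \<le> 2 * log_pot e \<sigma> t + log_pot g \<beta> t" if t: "t \<in> {a..b}" for t
  proof (cases "\<bar>t - x0\<bar> < 2 * r")
    case True
    have "log_pot e0 \<alpha> t - s / e0 = (LINT y|\<alpha>. log_ker e0 \<bar>t - y\<bar> - s / e0)"
      using log_ker_integrable[OF \<alpha> e0] \<alpha>.prob_space unfolding log_pot_def by simp
    also have "\<dots> \<le> log_pot e0 \<sigma> t"
      unfolding log_pot\<sigma>[OF e0]
    proof (rule integral_mono_AE[OF _ int[OF e0]])
      show "integrable \<alpha> (\<lambda>y. log_ker e0 \<bar>t - y\<bar> - s / e0)" using log_ker_integrable[OF \<alpha> e0] by simp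
      show "AE y in \<alpha>. log_ker e0 \<bar>t - y\<bar> - s / e0 \<le> (log_ker e0 \<bar>t - Y (y, True)\<bar> + log_ker e0 \<bar>t - Y (y, False)\<bar>) / 2"
        using prob_on_D(4)[OF \<alpha>]
      proof eventually_elim
        case (elim y)
        have "log_ker e0 \<bar>t - y\<bar> - s / e0 \<le> log_ker e0 \<bar>t - Y (y, c)\<bar>" for c
        proof -
          have "1 / e0 * \<bar>y - Y (y, c)\<bar> \<le> 1 / e0 * s" using Yab(2)[OF elim, of c] e0 by (intro mult_left_mono) auto
          then show ?thesis using log_ker_shift_lipschitz[OF e0, of t y t "Y (y, c)"] by (simp add: abs_le_iff)
        qed
        from this[of True] this[of False] show ?case by argo
      qed
    qed
    also have "\<dots> \<le> log_pot e \<sigma> t" by (rule log_pot_mono_trunc[OF \<sigma> e(1,3)])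
    finally have "log_pot e0 \<alpha> t - s / e0 \<le> log_pot e \<sigma> t" .
    moreover have "s / e0 \<le> q / 2" using s(3) e0 by (simp add: field_simps)
    ultimately show ?thesis using near[OF True] by linarith
  next
    case False
    have "log_pot e \<alpha> t + \<gamma> = (LINT y|\<alpha>. log_ker e \<bar>t - y\<bar> + \<kappa> * indicator B y)"
      using log_ker_integrable[OF \<alpha> e(1)] unfolding log_pot_def \<gamma>_def
      by (subst Bochner_Integration.integral_add) (auto simp: prob_on_D(2,3)[OF \<alpha>] less_top[symmetric])
    also have "\<dots> \<le> log_pot e \<sigma> t"
      unfolding log_pot\<sigma>[OF e(1)]
    proof (rule integral_mono_AE[OF _ int[OF e(1)]])
      show "integrable \<alpha> (\<lambda>y. log_ker e \<bar>t - y\<bar> + \<kappa> * indicator B y)"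
        using log_ker_integrable[OF \<alpha> e(1)]
        by (intro Bochner_Integration.integrable_add integrable_mult_right) (auto simp: prob_on_D(2)[OF \<alpha>] less_top[symmetric])
      show "AE y in \<alpha>. log_ker e \<bar>t - y\<bar> + \<kappa> * indicator B y \<le> (log_ker e \<bar>t - Y (y, True)\<bar> + log_ker e \<bar>t - Y (y, False)\<bar>) / 2"
        using prob_on_D(4)[OF \<alpha>]
      proof eventually_elim
        case (elim y)
        show ?case
        proof (cases "y \<in> B")
          case True
          then have "r \<le> \<bar>t - y\<bar>" using False by (auto simp: B_def dist_real_def)
          from log_ker_spread_gain[OF s(1,2) e(1,4) t elim this] True show ?thesis
            by (simp add: Y_def \<kappa>_def)
        qed (simp add: Y_def)
      qed
    qed
    finally have "log_pot e \<alpha> t + \<gamma> \<le> log_pot e \<sigma> t" .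
    with e1(2)[OF e(1,2) t] show ?thesis by linarith
  qed
  from test_measure[OF \<sigma> e(1) this] q \<gamma> show False by simp
qed

end

section \<open>Positivity of the logarithmic energy\<close>

text \<open>Fubini: for a kernel that is a mixture of products, the mutual energy is the inner
  product of two transforms in L^2(\<Lambda>). A finite \<open>\<Lambda>\<close> and the bound on
  \<open>\<phi>\<close> make everything integrable.\<close>

lemma mixture_double_integral:
  fixes \<phi> :: "real \<Rightarrow> 'w \<Rightarrow> real"
  assumes \<Lambda>: "finite_measure \<Lambda>" and \<sigma>: "prob_space \<sigma>" "sets \<sigma> = sets borel" and \<tau>: "prob_space \<tau>" "sets \<tau> = sets borel"
    and \<phi>: "(\<lambda>(x, w). \<phi> x w) \<in> borel_measurable (borel \<Otimes>\<^sub>M \<Lambda>)" "\<And>x w. \<bar>\<phi> x w\<bar> \<le> 1"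
  shows "integrable \<sigma> (\<lambda>x. LINT w|\<Lambda>. \<phi> x w * \<phi> y w)"
    and "integrable \<tau> (\<lambda>y. LINT x|\<sigma>. LINT w|\<Lambda>. \<phi> x w * \<phi> y w)"
    and "(LINT y|\<tau>. LINT x|\<sigma>. LINT w|\<Lambda>. \<phi> x w * \<phi> y w) = (LINT w|\<Lambda>. (LINT x|\<sigma>. \<phi> x w) * (LINT y|\<tau>. \<phi> y w))"
    and "integrable \<Lambda> (\<lambda>w. (LINT x|\<sigma>. \<phi> x w) * (LINT y|\<tau>. \<phi> y w))"
proof -
  interpret L: finite_measure \<Lambda> by fact
  interpret S: prob_space \<sigma> by fact
  interpret T: prob_space \<tau> by fact
  interpret PS: pair_sigma_finite \<sigma> \<Lambda> ..
  interpret PT: pair_sigma_finite \<tau> \<Lambda> ..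
  note [measurable_cong] = \<sigma>(2) \<tau>(2)
  have fS: "finite_measure (\<sigma> \<Otimes>\<^sub>M \<Lambda>)" "finite_measure (\<tau> \<Otimes>\<^sub>M \<Lambda>)"
    by (intro finite_measure_pair_measure L.finite_measure_axioms S.finite_measure_axioms T.finite_measure_axioms)+
  have \<phi>m [measurable (raw)]: "(\<lambda>v. \<phi> (f v) (h v)) \<in> borel_measurable M"
    if "f \<in> borel_measurable M" "h \<in> measurable M \<Lambda>" for f h and M :: "'v measure"
    using measurable_compose[OF measurable_Pair[OF that] \<phi>(1)] by simp
  have \<phi>S [measurable]: "(\<lambda>(x, w). \<phi> x w) \<in> borel_measurable (\<sigma> \<Otimes>\<^sub>M \<Lambda>)" and \<phi>T [measurable]: "(\<lambda>(x, w). \<phi> x w) \<in> borel_measurable (\<tau> \<Otimes>\<^sub>M \<Lambda>)"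
    using \<phi>(1) \<sigma>(2) \<tau>(2) by (simp_all cong: measurable_cong_sets sets_pair_measure_cong)
  have \<phi>w: "\<phi> y \<in> borel_measurable \<Lambda>" for y
    using measurable_compose[OF measurable_Pair1' \<phi>(1)] by simp
  \<comment> \<open>A non-integrable section has integral 0 by convention and satisfies the bound as
    well.\<close>
  have bS: "\<bar>LINT x|\<sigma>. \<phi> x w\<bar> \<le> 1" for w
  proof -
    show ?thesis
    proof (cases "integrable \<sigma> (\<lambda>x. \<phi> x w)")
      case True
      have "\<bar>LINT x|\<sigma>. \<phi> x w\<bar> \<le> (LINT x|\<sigma>. \<bar>\<phi> x w\<bar>)" by (rule integral_abs_bound)
      also have "\<dots> \<le> (LINT x|\<sigma>. 1)" using True \<phi>(2) by (intro integral_mono) auto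
      finally show ?thesis by (simp add: S.prob_space)
    qed (simp add: not_integrable_integral_eq)
  qed
  have mS [measurable]: "(\<lambda>w. LINT x|\<sigma>. \<phi> x w) \<in> borel_measurable \<Lambda>"
    using S.borel_measurable_lebesgue_integral[of "\<lambda>w x. \<phi> x w" \<Lambda>] \<phi>S measurable_pair_swap_iff[of "\<lambda>(x,w). \<phi> x w"]
    by (simp add: case_prod_unfold)
  have mT [measurable]: "(\<lambda>w. LINT x|\<tau>. \<phi> x w) \<in> borel_measurable \<Lambda>"
    using T.borel_measurable_lebesgue_integral[of "\<lambda>w x. \<phi> x w" \<Lambda>] \<phi>T measurable_pair_swap_iff[of "\<lambda>(x,w). \<phi> x w"]
    by (simp add: case_prod_unfold)
  have 1: "(LINT x|\<sigma>. LINT w|\<Lambda>. \<phi> x w * \<phi> y w) = (LINT w|\<Lambda>. (LINT x|\<sigma>. \<phi> x w) * \<phi> y w)"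
    and 2: "integrable \<sigma> (\<lambda>x. LINT w|\<Lambda>. \<phi> x w * \<phi> y w)" for y
  proof -
    have i: "integrable (\<sigma> \<Otimes>\<^sub>M \<Lambda>) (\<lambda>(x, w). \<phi> x w * \<phi> y w)"
    proof (rule finite_measure.integrable_const_bound[OF fS(1), of _ 1])
      show "(\<lambda>(x, w). \<phi> x w * \<phi> y w) \<in> borel_measurable (\<sigma> \<Otimes>\<^sub>M \<Lambda>)"
        using \<phi>S measurable_compose[OF measurable_snd \<phi>w[of y], of \<sigma>] by (simp add: case_prod_unfold)
      show "AE v in \<sigma> \<Otimes>\<^sub>M \<Lambda>. norm (case v of (x, w) \<Rightarrow> \<phi> x w * \<phi> y w) \<le> 1"
        using \<phi>(2) by (intro AE_I2) (auto simp: abs_mult split_beta intro!: mult_le_one)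
    qed
    from PS.Fubini_integral[OF i] show "(LINT x|\<sigma>. LINT w|\<Lambda>. \<phi> x w * \<phi> y w) = (LINT w|\<Lambda>. (LINT x|\<sigma>. \<phi> x w) * \<phi> y w)" by simp
    from PS.integrable_fst'[OF i] show "integrable \<sigma> (\<lambda>x. LINT w|\<Lambda>. \<phi> x w * \<phi> y w)" by simp
  qed
  show "integrable \<sigma> (\<lambda>x. LINT w|\<Lambda>. \<phi> x w * \<phi> y w)" by (rule 2)
  have i: "integrable (\<tau> \<Otimes>\<^sub>M \<Lambda>) (\<lambda>(y, w). (LINT x|\<sigma>. \<phi> x w) * \<phi> y w)"
  proof (rule finite_measure.integrable_const_bound[OF fS(2), of _ 1])
    show "(\<lambda>(y, w). (LINT x|\<sigma>. \<phi> x w) * \<phi> y w) \<in> borel_measurable (\<tau> \<Otimes>\<^sub>M \<Lambda>)"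
      using \<phi>T measurable_compose[OF measurable_snd mS, of \<tau>] by (simp add: case_prod_unfold)
    show "AE v in \<tau> \<Otimes>\<^sub>M \<Lambda>. norm (case v of (y, w) \<Rightarrow> (LINT x|\<sigma>. \<phi> x w) * \<phi> y w) \<le> 1"
      using \<phi>(2) bS by (intro AE_I2) (auto simp: abs_mult split_beta intro!: mult_le_one)
  qed
  from PT.integrable_fst'[OF i] show "integrable \<tau> (\<lambda>y. LINT x|\<sigma>. LINT w|\<Lambda>. \<phi> x w * \<phi> y w)" by (simp add: 1)
  from PT.Fubini_integral[OF i]
  show "(LINT y|\<tau>. LINT x|\<sigma>. LINT w|\<Lambda>. \<phi> x w * \<phi> y w) = (LINT w|\<Lambda>. (LINT x|\<sigma>. \<phi> x w) * (LINT y|\<tau>. \<phi> y w))"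
    by (simp add: 1)
  have bT: "\<bar>LINT x|\<tau>. \<phi> x w\<bar> \<le> 1" for w
  proof -
    show ?thesis
    proof (cases "integrable \<tau> (\<lambda>x. \<phi> x w)")
      case True
      have "\<bar>LINT x|\<tau>. \<phi> x w\<bar> \<le> (LINT x|\<tau>. \<bar>\<phi> x w\<bar>)" by (rule integral_abs_bound)
      also have "\<dots> \<le> (LINT x|\<tau>. 1)" using True \<phi>(2) by (intro integral_mono) auto
      finally show ?thesis by (simp add: T.prob_space)
    qed (simp add: not_integrable_integral_eq)
  qed
  show "integrable \<Lambda> (\<lambda>w. (LINT x|\<sigma>. \<phi> x w) * (LINT y|\<tau>. \<phi> y w))"
    by (rule L.integrable_const_bound[of _ 1]) (use bS bT in \<open>auto simp: abs_mult intro!: mult_le_one\<close>)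
qed

lemma window_integral:
  fixes x y A M r :: real
  assumes "x \<in> {A..A + M}" "y \<in> {A..A + M}" "0 \<le> r" "r \<le> M"
  shows "(LINT u|lborel. indicator {A - M..A + M} u * (indicator {u..u + r} x * indicator {u..u + r} y)) = max 0 (r - \<bar>x - y\<bar>)"
proof -
  have "(LINT u|lborel. indicator {A - M..A + M} u * (indicator {u..u + r} x * indicator {u..u + r} y)) =
      (LINT u|lborel. indicator {max x y - r..min x y} u :: real)"
  proof (rule Bochner_Integration.integral_cong)
    fix u
    have "u \<in> {A - M..A + M} \<and> x \<in> {u..u + r} \<and> y \<in> {u..u + r} \<longleftrightarrow> u \<in> {max x y - r..min x y}"
      using assms by auto
    then show "indicator {A - M..A + M} u * (indicator {u..u + r} x * indicator {u..u + r} y) = (indicator {max x y - r..min x y} u :: real)"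
      by (simp only: indicator_def of_bool_conj[symmetric])
  qed simp
  also have "\<dots> = max 0 (r - \<bar>x - y\<bar>)" by (auto simp: max_def min_def)
  finally show ?thesis .
qed

text \<open>An antiderivative of 1/r - d/r^2 is ln r + d/r; its value at max e d produces exactly
  the tangent continuation of -ln below \<open>e\<close>.\<close>

lemma log_ker_as_mixture:
  assumes "0 < e" "e \<le> M" "0 \<le> d" "d \<le> M"
  shows "(LINT r|lborel. indicator {e..M} r * (1 / r\<^sup>2 * max 0 (r - d))) = log_ker e d + ln M + d / M - 1"
proof -
  let ?m = "max e d"
  have m: "0 < ?m" "?m \<le> M" using assms by auto
  have "(LINT r|lborel. indicator {e..M} r * (1 / r\<^sup>2 * max 0 (r - d))) = (LINT r|lborel. indicator {?m..M} r *\<^sub>R (1 / r - d / r\<^sup>2))"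
  proof (rule Bochner_Integration.integral_cong)
    fix r
    have "1 / r\<^sup>2 * (r - d) = 1 / r - d / r\<^sup>2" by (simp add: diff_divide_distrib power2_eq_square)
    then show "indicator {e..M} r * (1 / r\<^sup>2 * max 0 (r - d)) = indicator {?m..M} r *\<^sub>R (1 / r - d / r\<^sup>2)"
      by (auto simp: indicator_def max_def)
  qed simp
  also have "\<dots> = (ln M + d / M) - (ln ?m + d / ?m)"
  proof (rule integral_FTC_Icc[OF m(2)])
    fix r assume "?m \<le> r" "r \<le> M"
    then have "0 < r" using m(1) by linarith
    then show "((\<lambda>r. ln r + d / r) has_vector_derivative (1 / r - d / r\<^sup>2)) (at r within {?m..M})"
      unfolding has_real_derivative_iff_has_vector_derivative[symmetric]
      by (auto intro!: derivative_eq_intros simp: power2_eq_square)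
  next
    show "continuous_on {?m..M} (\<lambda>r. 1 / r - d / r\<^sup>2)" using m by (intro continuous_intros) auto
  qed
  also have "d / ?m = min e d / e" using assms by (auto simp: max_def min_def)
  finally show ?thesis by (simp add: log_ker_def)
qed

section \<open>The vector energy of a difference of two pairs of measures\<close>

definition mutual :: "real \<Rightarrow> real measure \<Rightarrow> real measure \<Rightarrow> real" where
  "mutual e \<sigma> \<tau> = (LINT y|\<tau>. log_pot e \<sigma> y)"

definition window :: "real \<Rightarrow> real measure \<Rightarrow> real \<Rightarrow> real" where
  "window M \<sigma> u = measure \<sigma> {u..u + M}"

text \<open>The vector energy of the signed pair (\<open>\<alpha>\<close> -
  \<open>\<nu>\<^sub>1\<close>, \<open>\<beta>\<close> - \<open>\<nu>\<^sub>2\<close>), multiplied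
  out so that only probability measures occur. The form \<open>B\<close> is a parameter because the
  two parts of the mixture are treated separately; additive constants in \<open>B\<close>
  cancel.\<close>

definition energy_form :: "(real measure \<Rightarrow> real measure \<Rightarrow> real) \<Rightarrow> real measure \<Rightarrow> real measure \<Rightarrow> real measure \<Rightarrow> real measure \<Rightarrow> real" where
  "energy_form B \<alpha> \<nu>\<^sub>1 \<beta> \<nu>\<^sub>2 = B \<alpha> \<alpha> - B \<alpha> \<nu>\<^sub>1 - B \<nu>\<^sub>1 \<alpha> + B \<nu>\<^sub>1 \<nu>\<^sub>1 + B \<beta> \<beta> - B \<beta> \<nu>\<^sub>2 - B \<nu>\<^sub>2 \<beta> + B \<nu>\<^sub>2 \<nu>\<^sub>2
    + (B \<alpha> \<beta> - B \<alpha> \<nu>\<^sub>2 - B \<nu>\<^sub>1 \<beta> + B \<nu>\<^sub>1 \<nu>\<^sub>2)"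

text \<open>For an integral of products the energy is the integral of one pointwise quadratic form
  in the two differences.\<close>

lemma energy_form_mixture:
  assumes int: "\<And>\<sigma> \<tau>. \<sigma> \<in> {\<alpha>, \<beta>, \<nu>\<^sub>1, \<nu>\<^sub>2} \<Longrightarrow> \<tau> \<in> {\<alpha>, \<beta>, \<nu>\<^sub>1, \<nu>\<^sub>2} \<Longrightarrow> integrable \<Lambda> (\<lambda>w. F \<sigma> w * F \<tau> w :: real)"
  shows "energy_form (\<lambda>\<sigma> \<tau>. LINT w|\<Lambda>. F \<sigma> w * F \<tau> w) \<alpha> \<nu>\<^sub>1 \<beta> \<nu>\<^sub>2 =
      (LINT w|\<Lambda>. (F \<alpha> w - F \<nu>\<^sub>1 w)\<^sup>2 + (F \<beta> w - F \<nu>\<^sub>2 w)\<^sup>2 + (F \<alpha> w - F \<nu>\<^sub>1 w) * (F \<beta> w - F \<nu>\<^sub>2 w))"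
    and "integrable \<Lambda> (\<lambda>w. (F \<alpha> w - F \<nu>\<^sub>1 w)\<^sup>2 + (F \<beta> w - F \<nu>\<^sub>2 w)\<^sup>2 + (F \<alpha> w - F \<nu>\<^sub>1 w) * (F \<beta> w - F \<nu>\<^sub>2 w))"
proof -
  have eq: "(F \<alpha> w - F \<nu>\<^sub>1 w)\<^sup>2 + (F \<beta> w - F \<nu>\<^sub>2 w)\<^sup>2 + (F \<alpha> w - F \<nu>\<^sub>1 w) * (F \<beta> w - F \<nu>\<^sub>2 w) =
    F \<alpha> w * F \<alpha> w - F \<alpha> w * F \<nu>\<^sub>1 w - F \<nu>\<^sub>1 w * F \<alpha> w + F \<nu>\<^sub>1 w * F \<nu>\<^sub>1 w + F \<beta> w * F \<beta> w - F \<beta> w * F \<nu>\<^sub>2 w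
    - F \<nu>\<^sub>2 w * F \<beta> w + F \<nu>\<^sub>2 w * F \<nu>\<^sub>2 w
    + (F \<alpha> w * F \<beta> w - F \<alpha> w * F \<nu>\<^sub>2 w - F \<nu>\<^sub>1 w * F \<beta> w + F \<nu>\<^sub>1 w * F \<nu>\<^sub>2 w)" for w
    by (simp add: power2_eq_square algebra_simps)
  show "integrable \<Lambda> (\<lambda>w. (F \<alpha> w - F \<nu>\<^sub>1 w)\<^sup>2 + (F \<beta> w - F \<nu>\<^sub>2 w)\<^sup>2 + (F \<alpha> w - F \<nu>\<^sub>1 w) * (F \<beta> w - F \<nu>\<^sub>2 w))"
    unfolding eq by (intro Bochner_Integration.integrable_add Bochner_Integration.integrable_diff int) auto
  show "energy_form (\<lambda>\<sigma> \<tau>. LINT w|\<Lambda>. F \<sigma> w * F \<tau> w) \<alpha> \<nu>\<^sub>1 \<beta> \<nu>\<^sub>2 =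
      (LINT w|\<Lambda>. (F \<alpha> w - F \<nu>\<^sub>1 w)\<^sup>2 + (F \<beta> w - F \<nu>\<^sub>2 w)\<^sup>2 + (F \<alpha> w - F \<nu>\<^sub>1 w) * (F \<beta> w - F \<nu>\<^sub>2 w))"
    unfolding eq energy_form_def
    by (subst Bochner_Integration.integral_add Bochner_Integration.integral_diff,
        (intro Bochner_Integration.integrable_add Bochner_Integration.integrable_diff int; simp)+)+ (rule refl)
qed

text \<open>The interaction matrix with diagonal 1 and off-diagonal 1/2 has smallest eigenvalue
  1/2.\<close>

lemma quadratic_form_lower: "(x\<^sup>2 + y\<^sup>2) / 2 \<le> x\<^sup>2 + y\<^sup>2 + x * y" for x y :: real
  using zero_le_power2[of "x + y"] by (simp add: power2_sum)

text \<open>The kernel is a mixture of the kernels \<open>max 0 (r - \<bar>x - y\<bar>)\<close>, and each of these is the integral over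
  \<open>u\<close> of the product of the indicators of \<open>[u, u + r]\<close> at \<open>x\<close> and \<open>y\<close>.\<close>

lemma energy_form_lower:
  assumes e: "0 < e" "e \<le> M"
    and prob: "\<And>\<sigma>. \<sigma> \<in> {\<alpha>, \<beta>, \<nu>\<^sub>1, \<nu>\<^sub>2} \<Longrightarrow> prob_on A (A + M) \<sigma>"
  defines "X \<equiv> \<lambda>u. window M \<alpha> u - window M \<nu>\<^sub>1 u" and "Y \<equiv> \<lambda>u. window M \<beta> u - window M \<nu>\<^sub>2 u"
  defines "\<Lambda>\<^sub>0 \<equiv> density lborel (\<lambda>u. ennreal (indicator {A - M..A + M} u))"
  shows "(LINT u|\<Lambda>\<^sub>0. (X u)\<^sup>2 + (Y u)\<^sup>2 + X u * Y u) / M \<le> energy_form (mutual e) \<alpha> \<nu>\<^sub>1 \<beta> \<nu>\<^sub>2"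
    and "integrable \<Lambda>\<^sub>0 (\<lambda>u. (X u)\<^sup>2 + (Y u)\<^sup>2 + X u * Y u)"
proof -
  let ?P = "{\<alpha>, \<beta>, \<nu>\<^sub>1, \<nu>\<^sub>2}"
  have M: "0 < M" using e by simp
  define \<phi>\<^sub>0 :: "real \<Rightarrow> real \<Rightarrow> real" where "\<phi>\<^sub>0 x u = indicator {u..u + M} x" for x u
  define \<phi>\<^sub>1 :: "real \<Rightarrow> real \<times> real \<Rightarrow> real" where "\<phi>\<^sub>1 x w = indicator {snd w..snd w + fst w} x" for x w
  \<comment> \<open>Density of the mixing measure on pairs (r, u): weight 1/r^2 for the width,
    uniform for the position. The restriction r \<ge> e > 0 keeps it finite.\<close>
  define \<delta> :: "real \<times> real \<Rightarrow> real" where "\<delta> w = indicator {e..M} (fst w) * (1 / (fst w)\<^sup>2) * indicator {A - M..A + M} (snd w)" for w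
  define \<Lambda>\<^sub>1 where "\<Lambda>\<^sub>1 = density (lborel \<Otimes>\<^sub>M lborel) (\<lambda>w. ennreal (\<delta> w))"
  have \<delta>m [measurable]: "\<delta> \<in> borel_measurable (lborel \<Otimes>\<^sub>M lborel)" unfolding \<delta>_def by measurable
  have \<delta>0: "0 \<le> \<delta> w" for w by (simp add: \<delta>_def)
  have \<delta>le: "\<delta> w \<le> 1 / e\<^sup>2 * indicator ({e..M} \<times> {A - M..A + M}) w" for w
  proof (cases "w \<in> {e..M} \<times> {A - M..A + M}")
    case True
    then have "1 / (fst w)\<^sup>2 \<le> 1 / e\<^sup>2" using e by (intro divide_left_mono power_mono) auto
    then show ?thesis using True by (auto simp: \<delta>_def indicator_def)
  next
    case False
    then have "\<delta> w = 0" by (cases w) (auto simp: \<delta>_def)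
    then show ?thesis by (simp add: indicator_def)
  qed
  have fin0: "finite_measure \<Lambda>\<^sub>0"
    unfolding \<Lambda>\<^sub>0_def by (rule finite_measureI) (simp add: emeasure_density ennreal_indicator emeasure_lborel_Icc_eq)
  have fin1: "finite_measure \<Lambda>\<^sub>1"
  proof (rule finite_measureI)
    have "emeasure \<Lambda>\<^sub>1 (space \<Lambda>\<^sub>1) = (\<integral>\<^sup>+w. ennreal (\<delta> w) * indicator (space (lborel \<Otimes>\<^sub>M lborel)) w \<partial>(lborel \<Otimes>\<^sub>M lborel))"
      unfolding \<Lambda>\<^sub>1_def space_density by (rule emeasure_density) (use \<delta>m in measurable)
    also have "\<dots> = (\<integral>\<^sup>+w. ennreal (\<delta> w) \<partial>(lborel \<Otimes>\<^sub>M lborel))"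
      by (intro nn_integral_cong) simp
    also have "\<dots> \<le> (\<integral>\<^sup>+w. ennreal (1 / e\<^sup>2) * indicator ({e..M} \<times> {A - M..A + M}) w \<partial>(lborel \<Otimes>\<^sub>M lborel))"
    proof (rule nn_integral_mono)
      fix w
      have "ennreal (\<delta> w) \<le> ennreal (1 / e\<^sup>2 * indicator ({e..M} \<times> {A - M..A + M}) w)" using \<delta>le by (rule ennreal_leI)
      then show "ennreal (\<delta> w) \<le> ennreal (1 / e\<^sup>2) * indicator ({e..M} \<times> {A - M..A + M}) w"
        by (auto simp: indicator_def ennreal_neg split: if_splits)
    qed
    also have "\<dots> = ennreal (1 / e\<^sup>2) * emeasure (lborel \<Otimes>\<^sub>M lborel) ({e..M} \<times> {A - M..A + M})"
      by (subst nn_integral_cmult_indicator) auto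
    also have "emeasure (lborel \<Otimes>\<^sub>M lborel) ({e..M} \<times> {A - M..A + M}) = emeasure lborel {e..M} * emeasure lborel {A - M..A + M}"
      by (rule lborel.emeasure_pair_measure_Times) auto
    also have "ennreal (1 / e\<^sup>2) * \<dots> < \<infinity>" by (simp add: ennreal_mult_less_top emeasure_lborel_Icc_eq)
    finally show "emeasure \<Lambda>\<^sub>1 (space \<Lambda>\<^sub>1) \<noteq> \<infinity>" by simp
  qed
  have sets0: "sets \<Lambda>\<^sub>0 = sets borel" by (simp add: \<Lambda>\<^sub>0_def)
  have sets1: "sets \<Lambda>\<^sub>1 = sets (borel \<Otimes>\<^sub>M borel)" unfolding \<Lambda>\<^sub>1_def sets_density by (rule sets_pair_measure_cong) auto
  have \<phi>\<^sub>0m: "(\<lambda>(x, u). \<phi>\<^sub>0 x u) \<in> borel_measurable (borel \<Otimes>\<^sub>M \<Lambda>\<^sub>0)"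
  proof -
    have "(\<lambda>(x, u). \<phi>\<^sub>0 x u) = (\<lambda>v. if snd v \<le> fst v \<and> fst v \<le> snd v + M then 1 else 0)"
      by (auto simp: \<phi>\<^sub>0_def indicator_def fun_eq_iff)
    moreover have "\<dots> \<in> borel_measurable (borel \<Otimes>\<^sub>M borel)" by measurable
    ultimately show ?thesis by (simp add: measurable_cong_sets[OF sets_pair_measure_cong[OF refl sets0] refl])
  qed
  have \<phi>\<^sub>1m: "(\<lambda>(x, w). \<phi>\<^sub>1 x w) \<in> borel_measurable (borel \<Otimes>\<^sub>M \<Lambda>\<^sub>1)"
  proof -
    have "(\<lambda>(x, w). \<phi>\<^sub>1 x w) = (\<lambda>v. if snd (snd v) \<le> fst v \<and> fst v \<le> snd (snd v) + fst (snd v) then 1 else 0)"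
      by (auto simp: \<phi>\<^sub>1_def indicator_def fun_eq_iff)
    moreover have "\<dots> \<in> borel_measurable (borel \<Otimes>\<^sub>M (borel \<Otimes>\<^sub>M borel))" by measurable
    ultimately show ?thesis by (simp add: measurable_cong_sets[OF sets_pair_measure_cong[OF refl sets1] refl])
  qed
  have \<phi>b: "\<bar>\<phi>\<^sub>0 x u\<bar> \<le> 1" "\<bar>\<phi>\<^sub>1 x w\<bar> \<le> 1" for x u w by (simp_all add: \<phi>\<^sub>0_def \<phi>\<^sub>1_def indicator_def)
  \<comment> \<open>The term 1 - d/M left over by the mixture is itself a triangle kernel, of width
    \<open>M\<close>, divided by \<open>M\<close>.\<close>
  have \<kappa>0: "(LINT u|\<Lambda>\<^sub>0. \<phi>\<^sub>0 x u * \<phi>\<^sub>0 y u) = M - \<bar>x - y\<bar>" if "x \<in> {A..A + M}" "y \<in> {A..A + M}" for x y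
  proof -
    have "(\<lambda>u. \<phi>\<^sub>0 x u * \<phi>\<^sub>0 y u) = (\<lambda>u. if u \<le> x \<and> x \<le> u + M \<and> u \<le> y \<and> y \<le> u + M then 1 else 0)"
      by (auto simp: \<phi>\<^sub>0_def indicator_def fun_eq_iff)
    moreover have "\<dots> \<in> borel_measurable lborel" by measurable
    ultimately have "(\<lambda>u. \<phi>\<^sub>0 x u * \<phi>\<^sub>0 y u) \<in> borel_measurable lborel" by simp
    then have "(LINT u|\<Lambda>\<^sub>0. \<phi>\<^sub>0 x u * \<phi>\<^sub>0 y u) = (LINT u|lborel. indicator {A - M..A + M} u * (\<phi>\<^sub>0 x u * \<phi>\<^sub>0 y u))"
      unfolding \<Lambda>\<^sub>0_def by (subst integral_density) auto
    also have "\<dots> = max 0 (M - \<bar>x - y\<bar>)" unfolding \<phi>\<^sub>0_def using that M by (intro window_integral) auto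
    also have "\<dots> = M - \<bar>x - y\<bar>" using that by auto
    finally show ?thesis .
  qed
  have \<kappa>1: "(LINT w|\<Lambda>\<^sub>1. \<phi>\<^sub>1 x w * \<phi>\<^sub>1 y w) = log_ker e \<bar>x - y\<bar> + ln M + \<bar>x - y\<bar> / M - 1" if xy: "x \<in> {A..A + M}" "y \<in> {A..A + M}" for x y
  proof -
    have m: "(\<lambda>w. \<phi>\<^sub>1 x w * \<phi>\<^sub>1 y w) \<in> borel_measurable (lborel \<Otimes>\<^sub>M lborel)"
    proof -
      have "(\<lambda>w. \<phi>\<^sub>1 x w * \<phi>\<^sub>1 y w) = (\<lambda>w. if snd w \<le> x \<and> x \<le> snd w + fst w \<and> snd w \<le> y \<and> y \<le> snd w + fst w then 1 else 0)"
        by (auto simp: \<phi>\<^sub>1_def indicator_def fun_eq_iff)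
      moreover have "\<dots> \<in> borel_measurable (lborel \<Otimes>\<^sub>M lborel)" by measurable
      ultimately show ?thesis by simp
    qed
    have "integrable \<Lambda>\<^sub>1 (\<lambda>w. \<phi>\<^sub>1 x w * \<phi>\<^sub>1 y w)"
    proof (rule finite_measure.integrable_const_bound[OF fin1, of _ 1])
      show "AE w in \<Lambda>\<^sub>1. norm (\<phi>\<^sub>1 x w * \<phi>\<^sub>1 y w) \<le> 1" using \<phi>b by (auto simp: abs_mult intro!: mult_le_one)
      show "(\<lambda>w. \<phi>\<^sub>1 x w * \<phi>\<^sub>1 y w) \<in> borel_measurable \<Lambda>\<^sub>1" using m unfolding \<Lambda>\<^sub>1_def by simp
    qed
    then have "integrable (lborel \<Otimes>\<^sub>M lborel) (\<lambda>w. \<delta> w * (\<phi>\<^sub>1 x w * \<phi>\<^sub>1 y w))"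
      unfolding \<Lambda>\<^sub>1_def using m \<delta>0 by (subst (asm) integrable_density) auto
    from lborel_pair.integral_fst'[OF this]
    have "(LINT r|lborel. LINT u|lborel. \<delta> (r, u) * (\<phi>\<^sub>1 x (r, u) * \<phi>\<^sub>1 y (r, u))) = (LINT w|(lborel \<Otimes>\<^sub>M lborel). \<delta> w * (\<phi>\<^sub>1 x w * \<phi>\<^sub>1 y w))" .
    moreover have "(LINT w|\<Lambda>\<^sub>1. \<phi>\<^sub>1 x w * \<phi>\<^sub>1 y w) = (LINT w|(lborel \<Otimes>\<^sub>M lborel). \<delta> w * (\<phi>\<^sub>1 x w * \<phi>\<^sub>1 y w))"
      unfolding \<Lambda>\<^sub>1_def using m \<delta>0 by (subst integral_density) auto
    moreover have "(LINT u|lborel. \<delta> (r, u) * (\<phi>\<^sub>1 x (r, u) * \<phi>\<^sub>1 y (r, u))) = indicator {e..M} r * (1 / r\<^sup>2 * max 0 (r - \<bar>x - y\<bar>))" for r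
    proof (cases "r \<in> {e..M}")
      case True
      have "(LINT u|lborel. \<delta> (r, u) * (\<phi>\<^sub>1 x (r, u) * \<phi>\<^sub>1 y (r, u)))
          = (LINT u|lborel. 1 / r\<^sup>2 * (indicator {A - M..A + M} u * (indicator {u..u + r} x * indicator {u..u + r} y)))"
        using True by (simp add: \<delta>_def \<phi>\<^sub>1_def mult_ac)
      also have "\<dots> = 1 / r\<^sup>2 * max 0 (r - \<bar>x - y\<bar>)"
        using True e by (subst integral_mult_right_zero, subst window_integral[OF xy]) auto
      finally show ?thesis using True by simp
    qed (simp add: \<delta>_def)
    ultimately have "(LINT w|\<Lambda>\<^sub>1. \<phi>\<^sub>1 x w * \<phi>\<^sub>1 y w) = (LINT r|lborel. indicator {e..M} r * (1 / r\<^sup>2 * max 0 (r - \<bar>x - y\<bar>)))" by simp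
    also have "\<dots> = log_ker e \<bar>x - y\<bar> + ln M + \<bar>x - y\<bar> / M - 1" using xy by (intro log_ker_as_mixture[OF e]) auto
    finally show ?thesis .
  qed
  define F\<^sub>0 where "F\<^sub>0 \<sigma> u = (LINT x|\<sigma>. \<phi>\<^sub>0 x u)" for \<sigma> u
  define F\<^sub>1 where "F\<^sub>1 \<sigma> w = (LINT x|\<sigma>. \<phi>\<^sub>1 x w)" for \<sigma> w
  note D = prob_on_D[OF prob]
  have int0: "integrable \<Lambda>\<^sub>0 (\<lambda>u. F\<^sub>0 \<sigma> u * F\<^sub>0 \<tau> u)" if "\<sigma> \<in> ?P" "\<tau> \<in> ?P" for \<sigma> \<tau>
    unfolding F\<^sub>0_def
    by (rule mixture_double_integral(4)[OF fin0 D(1,2)[OF that(1)] D(1,2)[OF that(2)] \<phi>\<^sub>0m \<phi>b(1)])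
  have int1: "integrable \<Lambda>\<^sub>1 (\<lambda>w. F\<^sub>1 \<sigma> w * F\<^sub>1 \<tau> w)"
    if "\<sigma> \<in> ?P" "\<tau> \<in> ?P" for \<sigma> \<tau>
    unfolding F\<^sub>1_def
    by (rule mixture_double_integral(4)[OF fin1 D(1,2)[OF that(1)] D(1,2)[OF that(2)] \<phi>\<^sub>1m \<phi>b(2)])
  \<comment> \<open>The constant \<open>ln M\<close> drops out of the energy form because all
    measures have mass 1.\<close>
  have mut: "mutual e \<sigma> \<tau> = (LINT w|\<Lambda>\<^sub>1. F\<^sub>1 \<sigma> w * F\<^sub>1 \<tau> w) + (LINT u|\<Lambda>\<^sub>0. F\<^sub>0 \<sigma> u * F\<^sub>0 \<tau> u) / M - ln M"
    if \<sigma>\<tau>: "\<sigma> \<in> ?P" "\<tau> \<in> ?P" for \<sigma> \<tau>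
  proof -
    interpret S: prob_space \<sigma> using D(1)[OF \<sigma>\<tau>(1)] .
    interpret T: prob_space \<tau> using D(1)[OF \<sigma>\<tau>(2)] .
    let ?k1 = "\<lambda>y x. LINT w|\<Lambda>\<^sub>1. \<phi>\<^sub>1 x w * \<phi>\<^sub>1 y w" and ?k0 = "\<lambda>y x. LINT u|\<Lambda>\<^sub>0. \<phi>\<^sub>0 x u * \<phi>\<^sub>0 y u"
    note P1 = mixture_double_integral[OF fin1 D(1,2)[OF \<sigma>\<tau>(1)] D(1,2)[OF \<sigma>\<tau>(2)] \<phi>\<^sub>1m \<phi>b(2)]
    note P0 = mixture_double_integral[OF fin0 D(1,2)[OF \<sigma>\<tau>(1)] D(1,2)[OF \<sigma>\<tau>(2)] \<phi>\<^sub>0m \<phi>b(1)]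
    have log_pot_eq: "log_pot e \<sigma> y = (LINT x|\<sigma>. ?k1 y x) + (LINT x|\<sigma>. ?k0 y x) / M - ln M" if y: "y \<in> {A..A + M}" for y
    proof -
      have "log_pot e \<sigma> y = (LINT x|\<sigma>. ?k1 y x + ?k0 y x / M - ln M)"
        unfolding log_pot_def
      proof (rule integral_cong_AE)
        show "AE x in \<sigma>. log_ker e \<bar>y - x\<bar> = ?k1 y x + ?k0 y x / M - ln M"
          using D(4)[OF \<sigma>\<tau>(1)]
        proof eventually_elim
          case (elim x)
          have "(M - \<bar>x - y\<bar>) / M = 1 - \<bar>x - y\<bar> / M" using M by (simp add: diff_divide_distrib)
          then show ?case unfolding \<kappa>1[OF elim y] \<kappa>0[OF elim y] by (simp add: abs_minus_commute)
        qed
        show "(\<lambda>x. log_ker e \<bar>y - x\<bar>) \<in> borel_measurable \<sigma>" by (simp add: D(2)[OF \<sigma>\<tau>(1)] cong: measurable_cong_sets)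
        show "(\<lambda>x. ?k1 y x + ?k0 y x / M - ln M) \<in> borel_measurable \<sigma>"
          using borel_measurable_integrable[OF P1(1)[of y]] borel_measurable_integrable[OF P0(1)[of y]] by simp
      qed
      also have "\<dots> = (LINT x|\<sigma>. ?k1 y x) + (LINT x|\<sigma>. ?k0 y x) / M - ln M"
        using P1(1)[of y] P0(1)[of y] S.prob_space by simp
      finally show ?thesis .
    qed
    have "mutual e \<sigma> \<tau> = (LINT y|\<tau>. (LINT x|\<sigma>. ?k1 y x) + (LINT x|\<sigma>. ?k0 y x) / M - ln M)"
      unfolding mutual_def
    proof (rule integral_cong_AE)
      show "AE y in \<tau>. log_pot e \<sigma> y = (LINT x|\<sigma>. ?k1 y x) + (LINT x|\<sigma>. ?k0 y x) / M - ln M"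
        using D(4)[OF \<sigma>\<tau>(2)] by eventually_elim (rule log_pot_eq)
      show "log_pot e \<sigma> \<in> borel_measurable \<tau>"
        using borel_measurable_continuous_onI[OF log_pot_continuous[OF prob[OF \<sigma>\<tau>(1)] e(1)]]
        by (simp add: D(2)[OF \<sigma>\<tau>(2)] cong: measurable_cong_sets)
      show "(\<lambda>y. (LINT x|\<sigma>. ?k1 y x) + (LINT x|\<sigma>. ?k0 y x) / M - ln M) \<in> borel_measurable \<tau>"
        using borel_measurable_integrable[OF P1(2)] borel_measurable_integrable[OF P0(2)] by simp
    qed
    also have "\<dots> = (LINT y|\<tau>. LINT x|\<sigma>. ?k1 y x) + (LINT y|\<tau>. LINT x|\<sigma>. ?k0 y x) / M - ln M"
      using P1(2) P0(2) T.prob_space by simp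
    finally show ?thesis unfolding P1(3) P0(3) F\<^sub>0_def F\<^sub>1_def .
  qed
  have "energy_form (mutual e) \<alpha> \<nu>\<^sub>1 \<beta> \<nu>\<^sub>2 =
      energy_form (\<lambda>\<sigma> \<tau>. LINT w|\<Lambda>\<^sub>1. F\<^sub>1 \<sigma> w * F\<^sub>1 \<tau> w) \<alpha> \<nu>\<^sub>1 \<beta> \<nu>\<^sub>2
      + energy_form (\<lambda>\<sigma> \<tau>. LINT u|\<Lambda>\<^sub>0. F\<^sub>0 \<sigma> u * F\<^sub>0 \<tau> u) \<alpha> \<nu>\<^sub>1 \<beta> \<nu>\<^sub>2 / M"
    unfolding energy_form_def by (simp add: mut add_divide_distrib diff_divide_distrib)
  \<comment> \<open>Only the sign of this part is used, as it depends on \<open>e\<close>; the other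
    part does not and provides the lower bound.\<close>
  moreover have "0 \<le> energy_form (\<lambda>\<sigma> \<tau>. LINT w|\<Lambda>\<^sub>1. F\<^sub>1 \<sigma> w * F\<^sub>1 \<tau> w) \<alpha> \<nu>\<^sub>1 \<beta> \<nu>\<^sub>2"
    by (subst energy_form_mixture(1)[OF int1], assumption, assumption,
        rule integral_nonneg_AE, rule AE_I2, rule order_trans[OF _ quadratic_form_lower]) simp
  moreover have F0: "F\<^sub>0 \<sigma> u = window M \<sigma> u" if "\<sigma> \<in> ?P" for \<sigma> u
    unfolding F\<^sub>0_def \<phi>\<^sub>0_def window_def using D(2,3)[OF that] by simp
  then have XY: "(\<lambda>u. (F\<^sub>0 \<alpha> u - F\<^sub>0 \<nu>\<^sub>1 u)\<^sup>2 + (F\<^sub>0 \<beta> u - F\<^sub>0 \<nu>\<^sub>2 u)\<^sup>2 + (F\<^sub>0 \<alpha> u - F\<^sub>0 \<nu>\<^sub>1 u) * (F\<^sub>0 \<beta> u - F\<^sub>0 \<nu>\<^sub>2 u))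
      = (\<lambda>u. (X u)\<^sup>2 + (Y u)\<^sup>2 + X u * Y u)"
    by (simp add: X_def Y_def)
  moreover have "energy_form (\<lambda>\<sigma> \<tau>. LINT u|\<Lambda>\<^sub>0. F\<^sub>0 \<sigma> u * F\<^sub>0 \<tau> u) \<alpha> \<nu>\<^sub>1 \<beta> \<nu>\<^sub>2 = (LINT u|\<Lambda>\<^sub>0. (X u)\<^sup>2 + (Y u)\<^sup>2 + X u * Y u)"
    unfolding XY[symmetric] by (rule energy_form_mixture(1)[OF int0])
  ultimately show "(LINT u|\<Lambda>\<^sub>0. (X u)\<^sup>2 + (Y u)\<^sup>2 + X u * Y u) / M \<le> energy_form (mutual e) \<alpha> \<nu>\<^sub>1 \<beta> \<nu>\<^sub>2"
    by simp
  show "integrable \<Lambda>\<^sub>0 (\<lambda>u. (X u)\<^sup>2 + (Y u)\<^sup>2 + X u * Y u)"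
    unfolding XY[symmetric] by (rule energy_form_mixture(2)[OF int0])
qed

text \<open>A window of length \<open>M\<close> that starts left of \<open>A\<close> sees all mass
  up to its right end, so it equals the distribution function there. Agreement almost everywhere
  extends to every point by right continuity.\<close>

lemma prob_on_cdf_eq:
  assumes "prob_on A (A + M) \<alpha>" "prob_on A (A + M) \<nu>" "0 < M"
    and ae: "AE u in lborel. u \<in> {A - M..A + M} \<longrightarrow> window M \<alpha> u = window M \<nu> u"
  shows "\<alpha> = \<nu>"
proof -
  have rd: "real_distribution \<sigma>" if "prob_on A (A + M) \<sigma>" for \<sigma>
  proof -
    interpret prob_space \<sigma> using prob_on_D[OF that] by simp
    show ?thesis by unfold_locales (use prob_on_D[OF that] in auto)
  qed
  have null: "measure \<sigma> B = 0" if "prob_on A (A + M) \<sigma>" "B \<in> sets borel" "B \<inter> {A..A + M} = {}" for \<sigma> B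
  proof -
    interpret prob_space \<sigma> using prob_on_D[OF that(1)] by simp
    have "AE x in \<sigma>. x \<notin> B" using prob_on_D(4)[OF that(1)] by eventually_elim (use that(3) in auto)
    then show ?thesis using that(2) prob_on_D(2)[OF that(1)] by (subst prob_eq_0) auto
  qed
  have win: "window M \<sigma> u = cdf \<sigma> (u + M)" if p: "prob_on A (A + M) \<sigma>" and u: "u < A" for \<sigma> u
  proof -
    interpret real_distribution \<sigma> by (rule rd[OF p])
    have "{..u + M} = {..<u} \<union> {u..u + M}" using \<open>0 < M\<close> by auto
    then have "cdf \<sigma> (u + M) = measure \<sigma> ({..<u} \<union> {u..u + M})" by (simp add: cdf_def2)
    also have "\<dots> = measure \<sigma> {..<u} + measure \<sigma> {u..u + M}" by (intro finite_measure_Union) auto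
    also have "measure \<sigma> {..<u} = 0" using u by (intro null[OF p]) auto
    finally show ?thesis by (simp add: window_def)
  qed
  have dense: "\<exists>v. x < v \<and> v < y \<and> cdf \<alpha> v = cdf \<nu> v" if "A \<le> x" "x < y" "y \<le> A + M" for x y
  proof (rule ccontr)
    assume neg: "\<not> ?thesis"
    have "AE u in lborel. u \<notin> {x - M<..<y - M}"
      using ae
    proof eventually_elim
      case (elim u)
      show ?case
      proof
        assume u: "u \<in> {x - M<..<y - M}"
        then have "cdf \<alpha> (u + M) = cdf \<nu> (u + M)" using elim that win[OF assms(1)] win[OF assms(2)] by auto
        then show False using neg u by (auto simp: algebra_simps)
      qed
    qed
    then have "emeasure lborel {x - M<..<y - M} = 0"
      by (subst (asm) AE_iff_measurable[of "{x - M<..<y - M}"]) auto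
    then show False using that by simp
  qed
  show ?thesis
  proof (rule cdf_unique[OF rd[OF assms(1)] rd[OF assms(2)]], rule ext)
    fix x
    interpret a: real_distribution \<alpha> by (rule rd[OF assms(1)])
    interpret n: real_distribution \<nu> by (rule rd[OF assms(2)])
    consider "x < A" | "A \<le> x" "x < A + M" | "A + M \<le> x" by linarith
    then show "cdf \<alpha> x = cdf \<nu> x"
    proof cases
      case 1
      then show ?thesis unfolding cdf_def2 using null[OF assms(1), of "{..x}"] null[OF assms(2), of "{..x}"] by auto
    next
      case 2
      define y where "y n = x + (A + M - x) / real (Suc n)" for n
      have y: "x < y n" "y n \<le> A + M" for n
      proof -
        have "(A + M - x) / real (Suc n) \<le> (A + M - x) / 1" using 2 by (intro divide_left_mono) auto
        then show "x < y n" "y n \<le> A + M" using 2 by (auto simp: y_def)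
      qed
      have "y \<longlonglongrightarrow> x + 0" unfolding y_def
        by (intro tendsto_add tendsto_const real_tendsto_divide_at_top[OF tendsto_const filterlim_compose[OF filterlim_real_sequentially filterlim_Suc]])
      then have ylim: "y \<longlonglongrightarrow> x" by simp
      obtain v where v: "\<And>n. x < v n" "\<And>n. v n < y n" "\<And>n. cdf \<alpha> (v n) = cdf \<nu> (v n)"
        using dense[OF 2(1) y] by metis
      have "v \<longlonglongrightarrow> x"
        by (rule real_tendsto_sandwich[OF _ _ tendsto_const ylim]) (use v(1,2) in \<open>auto intro!: always_eventually less_imp_le\<close>)
      then have v_lim: "filterlim v (at_right x) sequentially"
        using v(1) by (simp add: filterlim_at less_imp_neq[symmetric] always_eventually)
      have "(\<lambda>n. cdf \<alpha> (v n)) \<longlonglongrightarrow> cdf \<alpha> x" "(\<lambda>n. cdf \<nu> (v n)) \<longlonglongrightarrow> cdf \<nu> x"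
        using a.cdf_is_right_cont[of x] n.cdf_is_right_cont[of x]
        by (auto simp: continuous_within intro: filterlim_compose[OF _ v_lim])
      then show ?thesis unfolding v(3) by (rule LIMSEQ_unique)
    next
      case 3
      have "cdf \<sigma> x = 1" if p: "prob_on A (A + M) \<sigma>" for \<sigma>
      proof -
        interpret real_distribution \<sigma> by (rule rd[OF p])
        have "AE z in \<sigma>. z \<in> {..x}" using prob_on_D(4)[OF p] by eventually_elim (use 3 in auto)
        then show ?thesis unfolding cdf_def2 by (subst prob_eq_1) auto
      qed
      then show ?thesis using assms(1,2) by simp
    qed
  qed
qed

text \<open>The lower bound for the energy does not involve \<open>e\<close>; arbitrarily small
  energies force the window differences to vanish almost everywhere.\<close>

lemma energy_form_unique:
  assumes M: "0 < M" and prob: "\<And>\<sigma>. \<sigma> \<in> {\<alpha>, \<beta>, \<nu>\<^sub>1, \<nu>\<^sub>2} \<Longrightarrow> prob_on A (A + M) \<sigma>"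
    and small: "\<And>r. 0 < r \<Longrightarrow> \<exists>e. 0 < e \<and> e \<le> M \<and> energy_form (mutual e) \<alpha> \<nu>\<^sub>1 \<beta> \<nu>\<^sub>2 \<le> r"
  shows "\<alpha> = \<nu>\<^sub>1" "\<beta> = \<nu>\<^sub>2"
proof -
  let ?X = "\<lambda>u. window M \<alpha> u - window M \<nu>\<^sub>1 u" and ?Y = "\<lambda>u. window M \<beta> u - window M \<nu>\<^sub>2 u"
  let ?L = "density lborel (\<lambda>u. ennreal (indicator {A - M..A + M} u))"
  let ?Q = "\<lambda>u. (?X u)\<^sup>2 + (?Y u)\<^sup>2 + ?X u * ?Y u"
  have le: "(LINT u|?L. ?Q u) / M \<le> r" if "0 < r" for r
  proof -
    from small[OF that] obtain e where e: "0 < e" "e \<le> M" "energy_form (mutual e) \<alpha> \<nu>\<^sub>1 \<beta> \<nu>\<^sub>2 \<le> r" by blast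
    from energy_form_lower(1)[OF e(1,2) prob] e(3) show ?thesis by (rule order_trans)
  qed
  have "(LINT u|?L. ?Q u) / M \<le> 0" by (rule field_le_epsilon) (use le in simp)
  then have le0: "(LINT u|?L. ?Q u) \<le> 0" using M by (simp add: divide_le_0_iff)
  obtain e where "0 < e" "e \<le> M" using small[of 1] by auto
  then have int: "integrable ?L ?Q" by (rule energy_form_lower(2)[OF _ _ prob])
  have nn: "0 \<le> ?Q u" for u by (rule order_trans[OF _ quadratic_form_lower]) simp
  have "(LINT u|?L. ?Q u) = 0" using le0 nn by (intro antisym integral_nonneg_AE) auto
  then have "AE u in ?L. ?Q u = 0" using integral_nonneg_eq_0_iff_AE[OF int] nn by auto
  then have ae: "AE u in lborel. u \<in> {A - M..A + M} \<longrightarrow> ?Q u = 0"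
    by (subst (asm) AE_density) (auto elim!: eventually_mono simp: indicator_def)
  have 0: "?X u = 0 \<and> ?Y u = 0" if "?Q u = 0" for u
  proof -
    have "((?X u)\<^sup>2 + (?Y u)\<^sup>2) / 2 \<le> 0" using quadratic_form_lower[of "?X u" "?Y u"] that by simp
    then show ?thesis using sum_power2_le_zero_iff[of "?X u" "?Y u"] by simp
  qed
  have 1: "AE u in lborel. u \<in> {A - M..A + M} \<longrightarrow> window M \<alpha> u = window M \<nu>\<^sub>1 u"
    using ae by eventually_elim (use 0 in fastforce)
  show "\<alpha> = \<nu>\<^sub>1" by (rule prob_on_cdf_eq[OF prob prob M 1]) auto
  have 2: "AE u in lborel. u \<in> {A - M..A + M} \<longrightarrow> window M \<beta> u = window M \<nu>\<^sub>2 u"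
    using ae by eventually_elim (use 0 in fastforce)
  show "\<beta> = \<nu>\<^sub>2" by (rule prob_on_cdf_eq[OF prob prob M 2]) auto
qed

section \<open>Christoffel functions at the nodes\<close>

context angelesco_side
begin

text \<open>A lower bound for the derivative of \<open>root_poly (Z k)\<close> at a node \<open>\<xi>\<close>: by the extremal property
  of the Christoffel function every polynomial of degree less than \<open>N k\<close> gives one, and we
  use a discretization of \<open>\<alpha>\<close> in which the little mass close to \<open>x\<close> is moved to an endpoint.\<close>

lemma node_lower_bound:
  assumes \<xi>: "\<And>k. \<xi> k \<in> Z k" "\<xi> \<longlonglongrightarrow> x" and x: "x \<in> {a..b}" and u: "\<And>e. 0 < e \<Longrightarrow> log_pot e \<alpha> x \<le> u"
    and orth: "\<And>k h. degree h < N k \<Longrightarrow> (LINT t|\<mu>. poly (root_poly (Z k) * root_poly (W k) * h) t) = 0"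
    and sgn: "\<And>k t. t \<in> {a..b} \<Longrightarrow> \<bar>poly (root_poly (W k)) t\<bar> = s k * poly (root_poly (W k)) t"
    and r: "0 < r"
  shows "\<forall>\<^sub>F k in sequentially. - ln \<bar>poly (root_poly (Z k - {\<xi> k})) (\<xi> k)\<bar> / real (N k) \<le> u + r"
proof -
  interpret finite_measure \<mu> by (rule fin)
  interpret \<alpha>: prob_space \<alpha> using prob_on_D[OF \<alpha>] by simp
  note [measurable_cong] = prob_on_D(2)[OF \<alpha>]
  define D where "D = max 1 (b - a)"
  have D: "1 \<le> D" "b - a \<le> D" "0 \<le> ln D" by (auto simp: D_def)
  \<comment> \<open>An atom at \<open>x\<close> would make the potential there infinite.\<close>
  have "measure \<alpha> {x} = 0"
    using log_pot_atom[OF \<alpha> x, of u] u by (meson not_less)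
  \<comment> \<open>The errors amount to 9 \<open>r8\<close> in a bound for twice the quantity, for
    which 16 \<open>r8\<close> are available.\<close>
  define r8 where "r8 = r / 8"
  have r8: "0 < r8" using r by (simp add: r8_def)
  obtain e' where e': "0 < e'" "\<And>e'' t. 0 < e'' \<Longrightarrow> e'' \<le> e' \<Longrightarrow> t \<in> {a..b} \<Longrightarrow> m - r8 < 2 * log_pot e'' \<alpha> t + log_pot g \<beta> t"
    using lower_uniform[OF r8] by blast
  define e where "e = min e' 1"
  have e: "0 < e" "e \<le> 1" "ln e \<le> 0" "\<And>t. t \<in> {a..b} \<Longrightarrow> m - r8 < 2 * log_pot e \<alpha> t + log_pot g \<beta> t"
    using e' by (auto simp: e_def)
  \<comment> \<open>Every point of the interval has an endpoint at least this far away.\<close>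
  define \<omega> where "\<omega> = (b - a) / 2"
  have \<omega>: "0 < \<omega>" using ab by (simp add: \<omega>_def)
  \<comment> \<open>Price per unit of moved mass: the first summand for the lower bound of the
    potentials at all \<open>t\<close>, the second for the upper bound at \<open>x\<close>.\<close>
  define c where "c = 2 * (1 - ln e + ln D) + (\<bar>ln \<omega>\<bar> + ln D)"
  have c: "0 < c" unfolding c_def using e(3) D(3) abs_ge_zero[of "ln \<omega>"] by argo
  obtain s' where s': "0 < s'" "measure \<alpha> {x - s'..x + s'} < r8 / c"
    using small_interval[OF \<alpha> \<open>measure \<alpha> {x} = 0\<close>, of "r8 / c"] r8 c by auto
  define \<kappa> where "\<kappa> = min s' (\<omega> / 2)"
  have \<kappa>: "0 < \<kappa>" "\<kappa> \<le> s'" "\<kappa> < \<omega>" using s' \<omega> by (auto simp: \<kappa>_def)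
  define B where "B = {x - \<kappa>..x + \<kappa>}"
  have [measurable]: "B \<in> sets borel" by (simp add: B_def)
  define \<theta> where "\<theta> = measure \<alpha> B"
  have "\<theta> \<le> measure \<alpha> {x - s'..x + s'}"
    unfolding \<theta>_def B_def using \<kappa> by (intro \<alpha>.finite_measure_mono) auto
  then have "\<theta> < r8 / c" using s' by linarith
  then have "c * \<theta> \<le> r8" using c by (simp add: field_simps)
  moreover have \<theta>0: "0 \<le> \<theta>" by (simp add: \<theta>_def)
  ultimately have \<theta>: "2 * (\<theta> * (1 - ln e + ln D)) \<le> r8" "\<theta> * (\<bar>ln \<omega>\<bar> + ln D) \<le> r8"
  proof -
    have 1: "0 \<le> \<theta> * (1 - ln e + ln D)" "0 \<le> \<theta> * (\<bar>ln \<omega>\<bar> + ln D)"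
      by (intro mult_nonneg_nonneg \<theta>0; use e(3) D(3) abs_ge_zero[of "ln \<omega>"] in argo)+
    have "c * \<theta> = 2 * (\<theta> * (1 - ln e + ln D)) + \<theta> * (\<bar>ln \<omega>\<bar> + ln D)" unfolding c_def by algebra
    with 1 \<open>c * \<theta> \<le> r8\<close> show "2 * (\<theta> * (1 - ln e + ln D)) \<le> r8" "\<theta> * (\<bar>ln \<omega>\<bar> + ln D) \<le> r8" by linarith+
  qed
  define z0 where "z0 = (if \<omega> \<le> x - a then a else b)"
  have z0: "z0 \<in> {a..b}" "\<omega> \<le> \<bar>x - z0\<bar>" using x ab by (auto simp: z0_def \<omega>_def)
  \<comment> \<open>After the mass of \<open>B\<close> is moved to \<open>z0\<close>, all zeros of
    the discretized polynomial keep distance \<open>\<kappa>\<close> from \<open>x\<close>. At nodes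
    within \<kappa>/2 of \<open>x\<close> its value is then given exactly by the kernel at scale
    \<kappa>/2, which yields a lower bound.\<close>
  define f where "f y = (if y \<in> B then z0 else y)" for y
  have fm [measurable]: "f \<in> borel_measurable borel" unfolding f_def by measurable
  define \<sigma> where "\<sigma> = distr \<alpha> borel f"
  have \<sigma>: "prob_on a b \<sigma>"
  proof (rule prob_on_I)
    show "prob_space \<sigma>" unfolding \<sigma>_def by (rule \<alpha>.prob_space_distr) measurable
    have "AE y in \<alpha>. f y \<in> {a..b}" using prob_on_D(4)[OF \<alpha>] by eventually_elim (use z0 in \<open>auto simp: f_def\<close>)
    then show "AE z in \<sigma>. z \<in> {a..b}" unfolding \<sigma>_def by (subst AE_distr_iff) auto
  qed (simp add: \<sigma>_def)
  have supp_far: "\<kappa> \<le> \<bar>y - x\<bar>" if y: "y \<in> supp \<sigma>" for y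
  proof (rule ccontr)
    assume "\<not> \<kappa> \<le> \<bar>y - x\<bar>"
    then have "y \<in> ball x \<kappa>" by (simp add: dist_real_def abs_minus_commute)
    then have "0 < emeasure \<sigma> (ball x \<kappa>)" using y unfolding supp_def by auto
    moreover have "f -` ball x \<kappa> = {}"
      using z0(2) \<kappa>(3) by (auto simp: f_def B_def dist_real_def split: if_splits)
    then have "emeasure \<sigma> (ball x \<kappa>) = 0" unfolding \<sigma>_def by (subst emeasure_distr) auto
    ultimately show False by simp
  qed
  have log_pot\<sigma>: "log_pot q \<sigma> t = (LINT y|\<alpha>. log_ker q \<bar>t - f y\<bar>)" for q t
    unfolding log_pot_def \<sigma>_def by (subst integral_distr) auto
  have int\<sigma>: "integrable \<alpha> (\<lambda>y. log_ker q \<bar>t - f y\<bar>)" if "0 < q" for q t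
  proof -
    have "integrable \<sigma> (\<lambda>y. log_ker q \<bar>t - y\<bar>)" by (rule log_ker_integrable[OF \<sigma> that])
    then show ?thesis unfolding \<sigma>_def by (subst (asm) integrable_distr_eq) auto
  qed
  have intB: "integrable \<alpha> (indicator B :: real \<Rightarrow> real)"
    by (auto simp: prob_on_D(2,3)[OF \<alpha>] less_top[symmetric])
  have low: "m - 2 * r8 < 2 * log_pot e \<sigma> t + log_pot g \<beta> t" if t: "t \<in> {a..b}" for t
  proof -
    have "log_pot e \<alpha> t - \<theta> * (1 - ln e + ln D) = (LINT y|\<alpha>. log_ker e \<bar>t - y\<bar> - (1 - ln e + ln D) * indicator B y)"
      unfolding log_pot_def using log_ker_integrable[OF \<alpha> e(1), of t] intB
      by (simp add: \<theta>_def prob_on_D(3)[OF \<alpha>] mult.commute)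
    also have "\<dots> \<le> log_pot e \<sigma> t"
      unfolding log_pot\<sigma>
    proof (rule integral_mono_AE[OF _ int\<sigma>[OF e(1)]])
      show "integrable \<alpha> (\<lambda>y. log_ker e \<bar>t - y\<bar> - (1 - ln e + ln D) * indicator B y)"
        using log_ker_integrable[OF \<alpha> e(1), of t] intB by simp
      show "AE y in \<alpha>. log_ker e \<bar>t - y\<bar> - (1 - ln e + ln D) * indicator B y \<le> log_ker e \<bar>t - f y\<bar>"
        using prob_on_D(4)[OF \<alpha>]
      proof eventually_elim
        case (elim y)
        have "- ln D \<le> log_ker e \<bar>t - z0\<bar>" using t z0 e D by (intro log_ker_ge) auto
        moreover have "log_ker e \<bar>t - y\<bar> \<le> 1 - ln e" using e by (intro log_ker_le) auto
        ultimately show ?case by (auto simp: f_def indicator_def)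
      qed
    qed
    finally show ?thesis using e(4)[OF t] \<theta>(1) by linarith
  qed
  have up: "log_pot (\<kappa> / 2) \<sigma> x \<le> u + r8"
  proof -
    have k2: "0 < \<kappa> / 2" using \<kappa> by simp
    have "log_pot (\<kappa> / 2) \<sigma> x \<le> (LINT y|\<alpha>. log_ker (\<kappa> / 2) \<bar>x - y\<bar> + (\<bar>ln \<omega>\<bar> + ln D) * indicator B y)"
      unfolding log_pot\<sigma>
    proof (rule integral_mono_AE[OF int\<sigma>[OF k2]])
      show "integrable \<alpha> (\<lambda>y. log_ker (\<kappa> / 2) \<bar>x - y\<bar> + (\<bar>ln \<omega>\<bar> + ln D) * indicator B y)"
        using log_ker_integrable[OF \<alpha> k2, of x] intB by simp
      show "AE y in \<alpha>. log_ker (\<kappa> / 2) \<bar>x - f y\<bar> \<le> log_ker (\<kappa> / 2) \<bar>x - y\<bar> + (\<bar>ln \<omega>\<bar> + ln D) * indicator B y"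
        using prob_on_D(4)[OF \<alpha>]
      proof eventually_elim
        case (elim y)
        have "\<kappa> / 2 \<le> D" using \<kappa> D ab by (simp add: \<omega>_def)
        then have "- ln D \<le> log_ker (\<kappa> / 2) \<bar>x - y\<bar>" using x elim k2 D by (intro log_ker_ge) auto
        moreover have "log_ker (\<kappa> / 2) \<bar>x - z0\<bar> \<le> log_ker (\<kappa> / 2) \<omega>" using z0 by (intro log_ker_antimono k2)
        moreover have "log_ker (\<kappa> / 2) \<omega> = - ln \<omega>" using \<kappa> by (intro log_ker_eq) auto
        ultimately show ?case by (auto simp: f_def indicator_def)
      qed
    qed
    also have "\<dots> = log_pot (\<kappa> / 2) \<alpha> x + \<theta> * (\<bar>ln \<omega>\<bar> + ln D)"
      unfolding log_pot_def using log_ker_integrable[OF \<alpha> k2, of x] intB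
      by (simp add: \<theta>_def prob_on_D(3)[OF \<alpha>] mult.commute)
    finally show ?thesis using u[OF k2] \<theta>(2) by linarith
  qed
  define M where "M = measure \<mu> UNIV + 1"
  have M: "0 < M" by (simp add: M_def add_nonneg_pos)
  define v where "v = u + 2 * r8"
  define v' where "v' = m - 3 * r8"
  \<comment> \<open>\<open>C1\<close>, \<open>C2\<close> and \<open>C\<close> collect what does not
    grow with the degree: discretization errors, the missing zero of a polynomial of degree N - 1,
    the factor t - \<xi>, and the total mass.\<close>
  define C1 where "C1 = \<bar>v\<bar> + D / (\<kappa> / 2)"
  define C2 where "C2 = 2 * (1 - ln e) + 2 * (D / e)"
  define C where "C = 2 * C1 + C2 + 2 * ln D + ln M"
  \<comment> \<open>The first bound keeps the node away from the zeros; the second pays for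
    replacing \<open>x\<close> by the node under the Lipschitz constant 2/\<kappa>.\<close>
  have ev1: "\<forall>\<^sub>F k in sequentially. \<bar>\<xi> k - x\<bar> < min (\<kappa> / 2) (r8 * (\<kappa> / 2))"
    using tendstoD[OF \<xi>(2), of "min (\<kappa> / 2) (r8 * (\<kappa> / 2))"] \<kappa> r8 by (simp add: dist_real_def)
  have ev2: "\<forall>\<^sub>F k in sequentially. - ln (nrm k) / real (N k) < m + r8"
    using nrm_lim r8 by (intro order_tendstoD(2)) auto
  have ev3: "\<forall>\<^sub>F k in sequentially. C / real (N k) < r8"
    using inverse_N_lim r8 by (intro order_tendstoD(2)) auto
  have ev4: "\<forall>\<^sub>F k in sequentially. 2 \<le> N k"
    using N_lim by (simp add: filterlim_at_top)
  show ?thesis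
    using ev1 ev2 ev3 ev4 pot_lim_uniform_\<beta>[OF g r8]
  proof eventually_elim
    case (elim k)
    define n where "n = real (N k)"
    have n: "0 < n" using N_pos by (simp add: n_def)
    \<comment> \<open>The extremal property concerns degrees strictly below
      \<open>N k\<close>.\<close>
    define n1 where "n1 = N k - 1"
    have n1: "0 < n1" "real n1 = n - 1" "n1 < N k" using elim(4) by (auto simp: n1_def n_def)
    obtain y where y: "\<And>i. i < n1 \<Longrightarrow> y i \<in> supp \<sigma>"
      "\<And>f L. f \<in> borel_measurable borel \<Longrightarrow> (\<And>u v. u \<in> {a..b} \<Longrightarrow> v \<in> {a..b} \<Longrightarrow> \<bar>f u - f v\<bar> \<le> L * \<bar>u - v\<bar>)
        \<Longrightarrow> \<bar>(\<Sum>i<n1. f (y i)) / real n1 - (LINT x|\<sigma>. f x)\<bar> \<le> L * (b - a) / real n1"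
      using discretize[OF \<sigma> n1(1)] by metis
    have dis: "\<bar>(\<Sum>i<n1. log_ker q \<bar>t - y i\<bar>) - real n1 * log_pot q \<sigma> t\<bar> \<le> D / q" if q: "0 < q" for q t
    proof -
      have "\<bar>(\<Sum>i<n1. log_ker q \<bar>t - y i\<bar>) / real n1 - log_pot q \<sigma> t\<bar> \<le> 1 / q * (b - a) / real n1"
        unfolding log_pot_def by (rule y(2)) (use log_ker_shift_lipschitz[OF q, of t _ t] in auto)
      then have 1: "real n1 * \<bar>(\<Sum>i<n1. log_ker q \<bar>t - y i\<bar>) / real n1 - log_pot q \<sigma> t\<bar> \<le> real n1 * (1 / q * (b - a) / real n1)"
        by (intro mult_left_mono) auto
      have "(\<Sum>i<n1. log_ker q \<bar>t - y i\<bar>) - real n1 * log_pot q \<sigma> t = real n1 * ((\<Sum>i<n1. log_ker q \<bar>t - y i\<bar>) / real n1 - log_pot q \<sigma> t)"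
        using n1(1) by (simp add: right_diff_distrib)
      then have "\<bar>(\<Sum>i<n1. log_ker q \<bar>t - y i\<bar>) - real n1 * log_pot q \<sigma> t\<bar> = real n1 * \<bar>(\<Sum>i<n1. log_ker q \<bar>t - y i\<bar>) / real n1 - log_pot q \<sigma> t\<bar>"
        by (simp add: abs_mult)
      also note 1
      also have "real n1 * (1 / q * (b - a) / real n1) = (b - a) / q" using n1(1) by simp
      also have "(b - a) / q \<le> D / q" using D q by (intro divide_right_mono) auto
      finally show ?thesis .
    qed
    let ?R = "\<Prod>i<n1. [:- y i, 1:]" and ?\<rho> = "root_poly (Z k - {\<xi> k})"
    have degR: "degree ?R < N k" using n1(3) by (simp only: monic_prod_linear)
    have chr: "(poly ?R (\<xi> k))\<^sup>2 * (LINT t|\<mu>. (poly ?\<rho> t)\<^sup>2 * \<bar>poly (root_poly (W k)) t\<bar>)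
        \<le> (poly ?\<rho> (\<xi> k))\<^sup>2 * (LINT t|\<mu>. (poly ?R t)\<^sup>2 * \<bar>poly (root_poly (W k)) t\<bar>)"
      by (rule orth_christoffel[where s="s k", OF _ Z(1,2) \<xi>(1) degR]) (use orth sgn in blast)+
    have R\<xi>: "exp (- (n * v + C1)) \<le> \<bar>poly ?R (\<xi> k)\<bar>"
    proof -
      have k2: "0 < \<kappa> / 2" using \<kappa> by simp
      have far: "\<kappa> / 2 \<le> \<bar>\<xi> k - y i\<bar>" if "i < n1" for i
        using supp_far[OF y(1)[OF that]] elim(1) by linarith
      have "\<bar>poly ?R (\<xi> k)\<bar> = exp (- (\<Sum>i<n1. log_ker (\<kappa> / 2) \<bar>\<xi> k - y i\<bar>))"
        unfolding poly_prod using abs_prod_eq_exp_log_ker[OF k2, of "{..<n1}" "\<xi> k" y] far by simp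
      moreover have "(\<Sum>i<n1. log_ker (\<kappa> / 2) \<bar>\<xi> k - y i\<bar>) \<le> n * v + C1"
      proof -
        have "\<bar>\<xi> k - x\<bar> / (\<kappa> / 2) \<le> r8" using elim(1) k2 by (simp add: pos_divide_le_eq)
        then have "log_pot (\<kappa> / 2) \<sigma> (\<xi> k) \<le> v"
          using log_pot_lipschitz[OF \<sigma> k2, of "\<xi> k" x] up unfolding v_def by linarith
        then have "real n1 * log_pot (\<kappa> / 2) \<sigma> (\<xi> k) \<le> real n1 * v" by (intro mult_left_mono) auto
        also have "\<dots> = n * v - v" unfolding n1(2) by (simp add: left_diff_distrib)
        finally have "(\<Sum>i<n1. log_ker (\<kappa> / 2) \<bar>\<xi> k - y i\<bar>) \<le> n * v - v + D / (\<kappa> / 2)"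
          using dis[OF k2, of "\<xi> k"] by linarith
        moreover have "- v \<le> \<bar>v\<bar>" by simp
        ultimately show ?thesis unfolding C1_def by argo
      qed
      ultimately show ?thesis by simp
    qed
    have I2: "(LINT t|\<mu>. (poly ?R t)\<^sup>2 * \<bar>poly (root_poly (W k)) t\<bar>) \<le> M * exp (- (n * v' - C2))"
    proof -
      have le: "(poly ?R t)\<^sup>2 * \<bar>poly (root_poly (W k)) t\<bar> \<le> exp (- (n * v' - C2))" if t: "t \<in> {a..b}" for t
      proof -
        let ?S = "\<Sum>i<n1. log_ker e \<bar>t - y i\<bar>" and ?T = "\<Sum>z\<in>W k. log_ker g \<bar>t - z\<bar>"
        have 1: "\<bar>poly ?R t\<bar> \<le> exp (- ?S)"
          unfolding poly_prod using abs_prod_le_exp_log_ker[OF e(1), of "{..<n1}" t y] by simp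
        have 2: "\<bar>poly (root_poly (W k)) t\<bar> \<le> exp (- ?T)"
          unfolding poly_root_poly using abs_prod_le_exp_log_ker[OF g W(1)[of k], of t "\<lambda>z. z"] .
        have "real n1 * log_pot e \<sigma> t - D / e \<le> ?S" using dis[OF e(1), of t] by linarith
        moreover have "real n1 * log_pot e \<sigma> t = n * log_pot e \<sigma> t - log_pot e \<sigma> t" unfolding n1(2) by (simp add: left_diff_distrib)
        moreover have "log_pot e \<sigma> t \<le> 1 - ln e"
        proof -
          interpret \<sigma>: prob_space \<sigma> using prob_on_D[OF \<sigma>] by simp
          have "log_pot e \<sigma> t \<le> (LINT y|\<sigma>. 1 - ln e)"
            unfolding log_pot_def using log_ker_integrable[OF \<sigma> e(1)] e by (intro integral_mono log_ker_le) auto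
          then show ?thesis using \<sigma>.prob_space by simp
        qed
        ultimately have 3: "n * log_pot e \<sigma> t - (1 - ln e) - D / e \<le> ?S" by linarith
        have "log_pot g \<beta> t - r8 \<le> ?T / n" using bspec[OF elim(5) t] unfolding n_def by linarith
        then have "n * (log_pot g \<beta> t - r8) \<le> n * (?T / n)" using n by (intro mult_left_mono) auto
        then have 4: "n * (log_pot g \<beta> t - r8) \<le> ?T" using n by simp
        have "n * v' \<le> n * (2 * log_pot e \<sigma> t + (log_pot g \<beta> t - r8))"
          using low[OF t] n unfolding v'_def by (intro mult_left_mono) auto
        also have "\<dots> = 2 * (n * log_pot e \<sigma> t) + n * (log_pot g \<beta> t - r8)" by algebra
        finally have 5: "- (2 * ?S + ?T) \<le> - (n * v' - C2)"
          using 3 4 unfolding C2_def by argo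
        have "(poly ?R t)\<^sup>2 * \<bar>poly (root_poly (W k)) t\<bar> \<le> (exp (- ?S))\<^sup>2 * exp (- ?T)"
          using 2 power_mono[OF 1, of 2] by (intro mult_mono) auto
        also have "\<dots> = exp (- (2 * ?S + ?T))" by (simp add: power2_eq_square flip: exp_add)
        also have "\<dots> \<le> exp (- (n * v' - C2))" using 5 by simp
        finally show ?thesis .
      qed
      have "(LINT t|\<mu>. (poly ?R t)\<^sup>2 * \<bar>poly (root_poly (W k)) t\<bar>) \<le> (LINT t|\<mu>. exp (- (n * v' - C2)))"
        by (rule integral_mono_ab) (use le in \<open>auto intro!: continuous_intros\<close>)
      also have "\<dots> = measure \<mu> UNIV * exp (- (n * v' - C2))" by simp
      also have "\<dots> \<le> M * exp (- (n * v' - C2))" by (intro mult_right_mono) (auto simp: M_def)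
      finally show ?thesis .
    qed
    \<comment> \<open>Dropping the factor at the node changes the norm by at most \<open>D\<close>
      squared.\<close>
    have I1: "nrm k \<le> D\<^sup>2 * (LINT t|\<mu>. (poly ?\<rho> t)\<^sup>2 * \<bar>poly (root_poly (W k)) t\<bar>)"
    proof -
      have "nrm k \<le> (LINT t|\<mu>. D\<^sup>2 * ((poly ?\<rho> t)\<^sup>2 * \<bar>poly (root_poly (W k)) t\<bar>))"
        unfolding nrm_def
      proof (rule integral_mono_ab)
        fix t assume t: "t \<in> {a..b}"
        have "\<xi> k \<in> {a..b}" using \<xi>(1) Z(3) by blast
        then have "\<bar>t - \<xi> k\<bar> \<le> D" using t D by auto
        then have "(t - \<xi> k)\<^sup>2 \<le> D\<^sup>2" by (rule abs_le_square_iff[THEN iffD1, OF order_trans]) simp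
        moreover have "poly (root_poly (Z k)) t = (t - \<xi> k) * poly ?\<rho> t"
          unfolding root_poly_remove[OF Z(1) \<xi>(1)] by (simp add: left_diff_distrib)
        ultimately show "(poly (root_poly (Z k)) t)\<^sup>2 * \<bar>poly (root_poly (W k)) t\<bar> \<le> D\<^sup>2 * ((poly ?\<rho> t)\<^sup>2 * \<bar>poly (root_poly (W k)) t\<bar>)"
          by (simp add: power_mult_distrib mult.assoc mult_right_mono)
      qed (auto intro!: continuous_intros)
      then show ?thesis by simp
    qed
    have \<rho>\<xi>: "poly ?\<rho> (\<xi> k) \<noteq> 0" using Z(1)[of k] by (simp add: poly_root_poly_eq_0_iff)
    define E where "E = exp (- (n * v + C1))"
    define F where "F = M * exp (- (n * v' - C2))"
    have EF: "0 < E" "0 < F" using M by (auto simp: E_def F_def)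
    have "E\<^sup>2 * (nrm k / D\<^sup>2) \<le> (poly ?R (\<xi> k))\<^sup>2 * (LINT t|\<mu>. (poly ?\<rho> t)\<^sup>2 * \<bar>poly (root_poly (W k)) t\<bar>)"
    proof (rule mult_mono)
      show "E\<^sup>2 \<le> (poly ?R (\<xi> k))\<^sup>2" using power_mono[OF R\<xi>[folded E_def], of 2] EF by simp
      show "nrm k / D\<^sup>2 \<le> (LINT t|\<mu>. (poly ?\<rho> t)\<^sup>2 * \<bar>poly (root_poly (W k)) t\<bar>)"
        using I1 D by (simp add: divide_le_eq mult.commute)
    qed (use nrm_pos[of k] in auto)
    also have "\<dots> \<le> (poly ?\<rho> (\<xi> k))\<^sup>2 * (LINT t|\<mu>. (poly ?R t)\<^sup>2 * \<bar>poly (root_poly (W k)) t\<bar>)" by (rule chr)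
    also have "\<dots> \<le> (poly ?\<rho> (\<xi> k))\<^sup>2 * F" using I2 unfolding F_def by (intro mult_left_mono) auto
    finally have "E\<^sup>2 * (nrm k / D\<^sup>2) \<le> \<bar>poly ?\<rho> (\<xi> k)\<bar>\<^sup>2 * F" by simp
    then have "ln (E\<^sup>2 * (nrm k / D\<^sup>2)) \<le> ln (\<bar>poly ?\<rho> (\<xi> k)\<bar>\<^sup>2 * F)"
      using EF nrm_pos[of k] D \<rho>\<xi> by (intro ln_mono) auto
    moreover have "ln (E\<^sup>2 * (nrm k / D\<^sup>2)) = 2 * ln E + ln (nrm k) - 2 * ln D"
      using EF nrm_pos[of k] D by (simp add: ln_mult_pos ln_div ln_realpow)
    moreover have "ln (\<bar>poly ?\<rho> (\<xi> k)\<bar>\<^sup>2 * F) = 2 * ln \<bar>poly ?\<rho> (\<xi> k)\<bar> + ln F"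
    proof -
      have p: "0 < \<bar>poly ?\<rho> (\<xi> k)\<bar>" using \<rho>\<xi> by simp
      show ?thesis unfolding ln_mult_pos[OF zero_less_power[OF p] EF(2)] ln_realpow by simp
    qed
    moreover have "ln E = - (n * v + C1)" by (simp add: E_def)
    moreover have "ln F = ln M - (n * v' - C2)" using M by (simp add: F_def ln_mult_pos)
    ultimately have "2 * - ln \<bar>poly ?\<rho> (\<xi> k)\<bar> \<le> 2 * (n * v) - n * v' + C - ln (nrm k)"
      unfolding C_def by linarith
    then have "2 * - ln \<bar>poly ?\<rho> (\<xi> k)\<bar> / n \<le> (2 * (n * v) - n * v' + C - ln (nrm k)) / n"
      using n by (intro divide_right_mono) auto
    also have "\<dots> = 2 * v - v' + C / n + - ln (nrm k) / n"
      using n by (simp add: add_divide_distrib diff_divide_distrib)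
    also have "\<dots> < 2 * v - v' + r8 + (m + r8)"
      using elim(2,3) unfolding n_def by linarith
    also have "\<dots> = 2 * u + 9 * r8" unfolding v_def v'_def by simp
    also have "\<dots> \<le> 2 * (u + r)" using r by (simp add: r8_def)
    finally show ?case unfolding n_def by simp
  qed
qed

end

section \<open>Identification of the limits\<close>

text \<open>The variational conditions in truncated, real-valued form: the upper bound at every
  scale on the support, the lower bound uniformly on the interval at fine scales. In this form they
  integrate directly into energy inequalities.\<close>

definition equilibrium_conditions :: "real \<Rightarrow> real \<Rightarrow> real \<Rightarrow> real \<Rightarrow> real measure \<Rightarrow> real measure \<Rightarrow> bool" where
  "equilibrium_conditions a b g m \<sigma> \<tau> \<longleftrightarrow>
    (\<forall>e>0. \<forall>t\<in>supp \<sigma>. 2 * log_pot e \<sigma> t + log_pot g \<tau> t \<le> m) \<and>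
    (\<forall>r>0. \<exists>e\<^sub>0>0. \<forall>e t. 0 < e \<and> e \<le> e\<^sub>0 \<and> t \<in> {a..b} \<longrightarrow> m - r \<le> 2 * log_pot e \<sigma> t + log_pot g \<tau> t)"

lemma (in angelesco_side) limit_equilibrium_conditions: "equilibrium_conditions a b g m \<alpha> \<beta>"
  unfolding equilibrium_conditions_def
proof (intro conjI allI impI ballI)
  fix r :: real assume "0 < r"
  from lower_uniform[OF this] obtain e where "0 < e"
    "\<And>e' t. 0 < e' \<Longrightarrow> e' \<le> e \<Longrightarrow> t \<in> {a..b} \<Longrightarrow> m - r < 2 * log_pot e' \<alpha> t + log_pot g \<beta> t" by blast
  then show "\<exists>e\<^sub>0>0. \<forall>e t. 0 < e \<and> e \<le> e\<^sub>0 \<and> t \<in> {a..b} \<longrightarrow> m - r \<le> 2 * log_pot e \<alpha> t + log_pot g \<beta> t"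
    by (intro exI[of _ e]) (auto intro: less_imp_le)
qed (rule upper_on_supp)

text \<open>Truncation lowers the potential, which gives the bound on the support at once; the lower
  bound is pointwise at first and becomes uniform by Dini's argument.\<close>

lemma equilibrium_conditions_log_potential:
  assumes \<sigma>: "prob_on a b \<sigma>" and \<tau>: "prob_on c d \<tau>" and g: "0 < g"
    and gap: "\<forall>t\<in>{a..b}. \<forall>y\<in>{c..d}. g \<le> \<bar>t - y\<bar>"
    and eq: "\<And>t. t \<in> supp \<sigma> \<Longrightarrow> 2 * log_potential t \<sigma> + log_potential t \<tau> = ereal l"
    and ge: "\<And>t. t \<in> {a..b} \<Longrightarrow> ereal l \<le> 2 * log_potential t \<sigma> + log_potential t \<tau>"
  shows "equilibrium_conditions a b g l \<sigma> \<tau>"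
proof -
  have far: "log_potential t \<tau> = ereal (log_pot g \<tau> t)" if "t \<in> {a..b}" for t
    using gap that by (intro log_potential_far[OF \<tau> g]) auto
  have supp: "supp \<sigma> \<subseteq> {a..b}" using \<sigma> by (simp add: prob_on_def)
  have two: "2 * x = ereal 2 * x" for x :: ereal by simp
  have up: "2 * log_pot e \<sigma> t + log_pot g \<tau> t \<le> l" if "0 < e" "t \<in> supp \<sigma>" for e t
  proof -
    have "ereal (log_pot e \<sigma> t) \<le> log_potential t \<sigma>" by (rule log_pot_le_log_potential[OF \<sigma> that(1)])
    moreover have "2 * log_potential t \<sigma> + ereal (log_pot g \<tau> t) = ereal l"
      using eq[OF that(2)] far[of t] supp that(2) by auto
    ultimately show ?thesis unfolding two by (cases "log_potential t \<sigma>") auto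
  qed
  have pt: "\<exists>e>0. l - r < 2 * log_pot e \<sigma> t + log_pot g \<tau> t" if "0 < r" "t \<in> {a..b}" for r t
  proof -
    have "ereal l \<le> 2 * log_potential t \<sigma> + ereal (log_pot g \<tau> t)" using ge[OF that(2)] far[OF that(2)] by simp
    then have "ereal ((l - r - log_pot g \<tau> t) / 2) < log_potential t \<sigma>"
      unfolding two using that(1) by (cases "log_potential t \<sigma>") (auto simp: field_simps)
    from less_log_potential[OF \<sigma> this] obtain e where "0 < e" "(l - r - log_pot g \<tau> t) / 2 < log_pot e \<sigma> t" by blast
    then show ?thesis by (intro exI[of _ e]) (auto simp: field_simps)
  qed
  have low: "\<exists>e\<^sub>0>0. \<forall>e t. 0 < e \<and> e \<le> e\<^sub>0 \<and> t \<in> {a..b} \<longrightarrow> l - r \<le> 2 * log_pot e \<sigma> t + log_pot g \<tau> t" if "0 < r" for r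
  proof -
    have "\<exists>e>0. \<forall>t\<in>{a..b}. l - r < 2 * log_pot e \<sigma> t + log_pot g \<tau> t"
    proof (rule dini_lower)
      show "continuous_on {a..b} (\<lambda>t. 2 * log_pot e \<sigma> t + log_pot g \<tau> t)" if "0 < e" for e
        by (intro continuous_intros log_pot_continuous[OF \<sigma> that] log_pot_continuous[OF \<tau> g])
      show "2 * log_pot e' \<sigma> t + log_pot g \<tau> t \<le> 2 * log_pot e \<sigma> t + log_pot g \<tau> t" if "0 < e" "e \<le> e'" for e e' t
        using log_pot_mono_trunc[OF \<sigma> that, of t] by simp
    qed (use pt[OF that] in auto)
    then obtain e where e: "0 < e" "\<And>t. t \<in> {a..b} \<Longrightarrow> l - r < 2 * log_pot e \<sigma> t + log_pot g \<tau> t" by blast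
    have "l - r \<le> 2 * log_pot e' \<sigma> t + log_pot g \<tau> t" if "0 < e'" "e' \<le> e" "t \<in> {a..b}" for e' t
      using e(2)[OF that(3)] log_pot_mono_trunc[OF \<sigma> that(1,2), of t] by linarith
    then show ?thesis using e(1) by blast
  qed
  show ?thesis unfolding equilibrium_conditions_def using up low by blast
qed

section \<open>Mutual energies and uniqueness in the variational conditions\<close>

lemma log_pot_integrable:
  assumes "prob_on a b \<sigma>" "prob_on c d \<rho>" "0 < e"
  shows "integrable \<rho> (log_pot e \<sigma>)"
proof -
  have c: "continuous_on UNIV (log_pot e \<sigma>)" by (rule log_pot_continuous[OF assms(1,3)])
  have "compact (log_pot e \<sigma> ` {c..d})" by (intro compact_continuous_image continuous_on_subset[OF c]) auto
  then obtain B where "\<And>x. x \<in> {c..d} \<Longrightarrow> \<bar>log_pot e \<sigma> x\<bar> \<le> B"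
    using compact_imp_bounded bounded_iff by (metis image_eqI real_norm_def)
  then show ?thesis by (rule integrable_cont_prob_on[OF assms(2) borel_measurable_continuous_onI[OF c]])
qed

lemma mutual_commute:
  assumes \<sigma>: "prob_on a b \<sigma>" and \<tau>: "prob_on c d \<tau>" and e: "0 < e"
  shows "mutual e \<sigma> \<tau> = mutual e \<tau> \<sigma>"
proof -
  interpret S: prob_space \<sigma> using prob_on_D[OF \<sigma>] by simp
  interpret T: prob_space \<tau> using prob_on_D[OF \<tau>] by simp
  interpret P: pair_prob_space \<sigma> \<tau> ..
  note [measurable_cong] = prob_on_D(2)[OF \<sigma>] prob_on_D(2)[OF \<tau>]
  define B where "B = 1 + \<bar>ln e\<bar> + \<bar>ln (max e (\<bar>a\<bar> + \<bar>b\<bar> + \<bar>c\<bar> + \<bar>d\<bar>))\<bar>"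
  have "integrable (\<sigma> \<Otimes>\<^sub>M \<tau>) (\<lambda>(x, y). log_ker e \<bar>x - y\<bar>)"
  proof (rule P.integrable_const_bound[of _ B])
    have "AE z in \<sigma> \<Otimes>\<^sub>M \<tau>. fst z \<in> {a..b} \<and> snd z \<in> {c..d}"
    proof (rule P.AE_pair_measure)
      show "{z \<in> space (\<sigma> \<Otimes>\<^sub>M \<tau>). fst z \<in> {a..b} \<and> snd z \<in> {c..d}} \<in> sets (\<sigma> \<Otimes>\<^sub>M \<tau>)" by measurable
      show "AE x in \<sigma>. AE y in \<tau>. fst (x, y) \<in> {a..b} \<and> snd (x, y) \<in> {c..d}"
        using prob_on_D(4)[OF \<sigma>]
      proof eventually_elim
        case (elim x)
        show ?case using prob_on_D(4)[OF \<tau>] by eventually_elim (use elim in simp)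
      qed
    qed
    then show "AE z in \<sigma> \<Otimes>\<^sub>M \<tau>. norm (case z of (x, y) \<Rightarrow> log_ker e \<bar>x - y\<bar>) \<le> B"
    proof eventually_elim
      case (elim z)
      have "\<bar>log_ker e \<bar>fst z - snd z\<bar>\<bar> \<le> B" unfolding B_def using elim e by (intro log_ker_bounded) auto
      then show ?case by (simp add: case_prod_unfold)
    qed
  qed measurable
  from P.Fubini_integral[OF this] show ?thesis
    unfolding mutual_def log_pot_def by (simp add: abs_minus_commute)
qed

text \<open>Brings the cross potential from the scale of the gap to the common scale
  \<open>e\<close> needed in the energy form.\<close>

lemma mutual_eq_far:
  assumes \<rho>: "prob_on a b \<rho>" and \<tau>: "prob_on c d \<tau>" and e: "0 < e" "e \<le> g"
    and gap: "\<forall>t\<in>{a..b}. \<forall>y\<in>{c..d}. g \<le> \<bar>t - y\<bar>" and \<sigma>: "prob_on a b \<sigma>"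
  shows "(LINT t|\<rho>. 2 * log_pot e \<sigma> t + log_pot g \<tau> t) = (LINT t|\<rho>. 2 * log_pot e \<sigma> t + log_pot e \<tau> t)"
proof (rule integral_cong_AE)
  have g: "0 < g" using e by simp
  show "AE t in \<rho>. 2 * log_pot e \<sigma> t + log_pot g \<tau> t = 2 * log_pot e \<sigma> t + log_pot e \<tau> t"
    using prob_on_D(4)[OF \<rho>]
  proof eventually_elim
    case (elim t)
    have "log_pot g \<tau> t = log_pot e \<tau> t" using bspec[OF gap elim] e by (intro log_pot_eq_far[OF \<tau>]) fastforce+
    then show ?case by simp
  qed
  note [measurable] = borel_measurable_integrable[OF log_pot_integrable[OF \<sigma> \<rho> e(1)]]
    borel_measurable_integrable[OF log_pot_integrable[OF \<tau> \<rho> e(1)]] borel_measurable_integrable[OF log_pot_integrable[OF \<tau> \<rho> g]]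
  show "(\<lambda>t. 2 * log_pot e \<sigma> t + log_pot g \<tau> t) \<in> borel_measurable \<rho>" "(\<lambda>t. 2 * log_pot e \<sigma> t + log_pot e \<tau> t) \<in> borel_measurable \<rho>"
    by measurable
qed

text \<open>The upper bound is integrated against \<open>\<sigma>\<close>, which is carried by its
  support; the lower bound against an arbitrary competitor on the interval.\<close>

lemma equilibrium_conditions_mutual:
  assumes E: "equilibrium_conditions a b g m \<sigma> \<tau>" and \<sigma>: "prob_on a b \<sigma>" and \<tau>: "prob_on c d \<tau>" and g: "0 < g"
    and gap: "\<forall>t\<in>{a..b}. \<forall>y\<in>{c..d}. g \<le> \<bar>t - y\<bar>"
  shows "0 < e \<Longrightarrow> e \<le> g \<Longrightarrow> 2 * mutual e \<sigma> \<sigma> + mutual e \<tau> \<sigma> \<le> m"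
    and "0 < r \<Longrightarrow> \<exists>e\<^sub>0>0. \<forall>e \<rho>. 0 < e \<longrightarrow> e \<le> e\<^sub>0 \<longrightarrow> e \<le> g \<longrightarrow> prob_on a b \<rho> \<longrightarrow> m - r \<le> 2 * mutual e \<sigma> \<rho> + mutual e \<tau> \<rho>"
proof -
  have int: "integrable \<rho> (\<lambda>t. 2 * log_pot e \<sigma> t + log_pot g \<tau> t)" if "prob_on a b \<rho>" "0 < e" for \<rho> e
    using log_pot_integrable[OF \<sigma> that] log_pot_integrable[OF \<tau> that(1) g] by simp
  have mut: "(LINT t|\<rho>. 2 * log_pot e \<sigma> t + log_pot g \<tau> t) = 2 * mutual e \<sigma> \<rho> + mutual e \<tau> \<rho>"
    if "prob_on a b \<rho>" "0 < e" "e \<le> g" for \<rho> e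
    unfolding trans[OF mutual_eq_far[OF that(1) \<tau> that(2,3) gap \<sigma>] refl] mutual_def
    using log_pot_integrable[OF \<sigma> that(1,2)] log_pot_integrable[OF \<tau> that(1,2)] by simp
  have up: "2 * log_pot e \<sigma> t + log_pot g \<tau> t \<le> m" if "0 < e" "t \<in> supp \<sigma>" for e t
    using conjunct1[OF E[unfolded equilibrium_conditions_def]] that by blast
  show "2 * mutual e \<sigma> \<sigma> + mutual e \<tau> \<sigma> \<le> m" if e: "0 < e" "e \<le> g"
  proof -
    interpret prob_space \<sigma> using prob_on_D[OF \<sigma>] by simp
    have "(LINT t|\<sigma>. 2 * log_pot e \<sigma> t + log_pot g \<tau> t) \<le> (LINT t|\<sigma>. m)"
    proof (rule integral_mono_AE[OF int[OF \<sigma> e(1)] integrable_const])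
      show "AE t in \<sigma>. 2 * log_pot e \<sigma> t + log_pot g \<tau> t \<le> m"
        using AE_supp[OF prob_on_D(2)[OF \<sigma>]]
      proof eventually_elim
        case (elim t)
        show ?case by (rule up[OF e(1) elim])
      qed
    qed
    moreover have "(LINT t|\<sigma>. m) = m" using prob_space by simp
    ultimately show ?thesis by (simp only: mut[OF \<sigma> e])
  qed
  show "\<exists>e\<^sub>0>0. \<forall>e \<rho>. 0 < e \<longrightarrow> e \<le> e\<^sub>0 \<longrightarrow> e \<le> g \<longrightarrow> prob_on a b \<rho> \<longrightarrow> m - r \<le> 2 * mutual e \<sigma> \<rho> + mutual e \<tau> \<rho>"
    if "0 < r"
  proof -
    from conjunct2[OF E[unfolded equilibrium_conditions_def], rule_format, OF that] obtain e\<^sub>0 where "0 < e\<^sub>0"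
      and *: "\<forall>e t. 0 < e \<and> e \<le> e\<^sub>0 \<and> t \<in> {a..b} \<longrightarrow> m - r \<le> 2 * log_pot e \<sigma> t + log_pot g \<tau> t" by (elim exE conjE)
    have e0: "0 < e\<^sub>0" "\<And>e t. 0 < e \<Longrightarrow> e \<le> e\<^sub>0 \<Longrightarrow> t \<in> {a..b} \<Longrightarrow> m - r \<le> 2 * log_pot e \<sigma> t + log_pot g \<tau> t"
      using \<open>0 < e\<^sub>0\<close> * by blast+
    have "m - r \<le> 2 * mutual e \<sigma> \<rho> + mutual e \<tau> \<rho>" if e: "0 < e" "e \<le> e\<^sub>0" "e \<le> g" and \<rho>: "prob_on a b \<rho>" for e \<rho>
    proof -
      interpret prob_space \<rho> using prob_on_D[OF \<rho>] by simp
      have "(LINT t|\<rho>. m - r) \<le> (LINT t|\<rho>. 2 * log_pot e \<sigma> t + log_pot g \<tau> t)"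
      proof (rule integral_mono_AE[OF integrable_const int[OF \<rho> e(1)]])
        show "AE t in \<rho>. m - r \<le> 2 * log_pot e \<sigma> t + log_pot g \<tau> t"
          using prob_on_D(4)[OF \<rho>] by eventually_elim (rule e0(2)[OF e(1,2)])
      qed
      moreover have "(LINT t|\<rho>. m - r) = m - r" using prob_space by simp
      ultimately show ?thesis by (simp only: mut[OF \<rho> e(1,3)])
    qed
    then show ?thesis using e0(1) by blast
  qed
qed

text \<open>Lower and upper bound are compared at one point of the support, which is nonempty since
  the mass is 1.\<close>

lemma equilibrium_constant_le:
  assumes "equilibrium_conditions a b g m \<sigma> \<tau>" "equilibrium_conditions a b g l \<sigma> \<tau>" "prob_on a b \<sigma>"
  shows "m \<le> l"
proof (rule field_le_epsilon)
  fix r :: real assume r: "0 < r"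
  interpret prob_space \<sigma> using prob_on_D[OF assms(3)] by simp
  obtain t where t: "t \<in> supp \<sigma>"
  proof (rule ccontr)
    assume "\<not> thesis"
    with that have "supp \<sigma> = {}" by blast
    then have "AE x in \<sigma>. False" using AE_supp[OF prob_on_D(2)[OF assms(3)]] by simp
    then show False using AE_False by blast
  qed
  then have "t \<in> {a..b}" using assms(3) by (auto simp: prob_on_def)
  from conjunct2[OF assms(1)[unfolded equilibrium_conditions_def], rule_format, OF r] obtain e where e: "0 < e"
    and *: "\<forall>e' t. 0 < e' \<and> e' \<le> e \<and> t \<in> {a..b} \<longrightarrow> m - r \<le> 2 * log_pot e' \<sigma> t + log_pot g \<tau> t" by (elim exE conjE)
  have "m - r \<le> 2 * log_pot e \<sigma> t + log_pot g \<tau> t" using *[rule_format, of e t] e \<open>t \<in> {a..b}\<close> by simp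
  moreover have "2 * log_pot e \<sigma> t + log_pot g \<tau> t \<le> l"
    by (rule conjunct1[OF assms(2)[unfolded equilibrium_conditions_def], rule_format, OF e t])
  ultimately show "m \<le> l + r" by linarith
qed

lemma equilibrium_conditions_unique:
  fixes a\<^sub>1 b\<^sub>1 a\<^sub>2 b\<^sub>2 :: real
  assumes prob: "prob_on a\<^sub>1 b\<^sub>1 \<alpha>" "prob_on a\<^sub>2 b\<^sub>2 \<beta>" "prob_on a\<^sub>1 b\<^sub>1 \<nu>\<^sub>1" "prob_on a\<^sub>2 b\<^sub>2 \<nu>\<^sub>2" and less: "b\<^sub>1 < a\<^sub>2"
    and E: "equilibrium_conditions a\<^sub>1 b\<^sub>1 (a\<^sub>2 - b\<^sub>1) m\<^sub>1 \<alpha> \<beta>" "equilibrium_conditions a\<^sub>2 b\<^sub>2 (a\<^sub>2 - b\<^sub>1) m\<^sub>2 \<beta> \<alpha>"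
      "equilibrium_conditions a\<^sub>1 b\<^sub>1 (a\<^sub>2 - b\<^sub>1) l\<^sub>1 \<nu>\<^sub>1 \<nu>\<^sub>2" "equilibrium_conditions a\<^sub>2 b\<^sub>2 (a\<^sub>2 - b\<^sub>1) l\<^sub>2 \<nu>\<^sub>2 \<nu>\<^sub>1"
  shows "\<alpha> = \<nu>\<^sub>1" "\<beta> = \<nu>\<^sub>2" "m\<^sub>1 = l\<^sub>1" "m\<^sub>2 = l\<^sub>2"
proof -
  define g where "g = a\<^sub>2 - b\<^sub>1"
  have g: "0 < g" using less by (simp add: g_def)
  note E' = E[folded g_def]
  have gap: "\<forall>t\<in>{a\<^sub>1..b\<^sub>1}. \<forall>y\<in>{a\<^sub>2..b\<^sub>2}. g \<le> \<bar>t - y\<bar>" by (auto simp: g_def)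
  have gap': "\<forall>t\<in>{a\<^sub>2..b\<^sub>2}. \<forall>y\<in>{a\<^sub>1..b\<^sub>1}. g \<le> \<bar>t - y\<bar>" by (auto simp: g_def)
  have ab: "a\<^sub>1 \<le> b\<^sub>1" "a\<^sub>2 \<le> b\<^sub>2" using prob_on_D(5)[OF prob(1)] prob_on_D(5)[OF prob(2)] .
  define M where "M = b\<^sub>2 - a\<^sub>1"
  have M: "0 < M" "g \<le> M" using ab less by (auto simp: M_def g_def)
  have prob': "prob_on a\<^sub>1 (a\<^sub>1 + M) \<sigma>" if "\<sigma> \<in> {\<alpha>, \<beta>, \<nu>\<^sub>1, \<nu>\<^sub>2}" for \<sigma>
    using that prob ab less by (auto simp: prob_on_def M_def)
  have small: "\<exists>e. 0 < e \<and> e \<le> M \<and> energy_form (mutual e) \<alpha> \<nu>\<^sub>1 \<beta> \<nu>\<^sub>2 \<le> r" if r: "0 < r" for r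
  proof -
    have r4: "0 < r / 4" using r by simp
    note K1 = equilibrium_conditions_mutual[OF E'(1) prob(1,2) g gap]
      and K2 = equilibrium_conditions_mutual[OF E'(2) prob(2,1) g gap']
      and K3 = equilibrium_conditions_mutual[OF E'(3) prob(3,4) g gap]
      and K4 = equilibrium_conditions_mutual[OF E'(4) prob(4,3) g gap']
    obtain e1 where e1: "0 < e1" "\<And>e \<rho>. 0 < e \<Longrightarrow> e \<le> e1 \<Longrightarrow> e \<le> g \<Longrightarrow> prob_on a\<^sub>1 b\<^sub>1 \<rho> \<Longrightarrow> m\<^sub>1 - r / 4 \<le> 2 * mutual e \<alpha> \<rho> + mutual e \<beta> \<rho>"
      using K1(2)[OF r4] by blast
    obtain e2 where e2: "0 < e2" "\<And>e \<rho>. 0 < e \<Longrightarrow> e \<le> e2 \<Longrightarrow> e \<le> g \<Longrightarrow> prob_on a\<^sub>2 b\<^sub>2 \<rho> \<Longrightarrow> m\<^sub>2 - r / 4 \<le> 2 * mutual e \<beta> \<rho> + mutual e \<alpha> \<rho>"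
      using K2(2)[OF r4] by blast
    obtain e3 where e3: "0 < e3" "\<And>e \<rho>. 0 < e \<Longrightarrow> e \<le> e3 \<Longrightarrow> e \<le> g \<Longrightarrow> prob_on a\<^sub>1 b\<^sub>1 \<rho> \<Longrightarrow> l\<^sub>1 - r / 4 \<le> 2 * mutual e \<nu>\<^sub>1 \<rho> + mutual e \<nu>\<^sub>2 \<rho>"
      using K3(2)[OF r4] by blast
    obtain e4 where e4: "0 < e4" "\<And>e \<rho>. 0 < e \<Longrightarrow> e \<le> e4 \<Longrightarrow> e \<le> g \<Longrightarrow> prob_on a\<^sub>2 b\<^sub>2 \<rho> \<Longrightarrow> l\<^sub>2 - r / 4 \<le> 2 * mutual e \<nu>\<^sub>2 \<rho> + mutual e \<nu>\<^sub>1 \<rho>"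
      using K4(2)[OF r4] by blast
    define e where "e = min g (min (min e1 e2) (min e3 e4))"
    have e: "0 < e" "e \<le> g" "e \<le> e1" "e \<le> e2" "e \<le> e3" "e \<le> e4"
      using g e1(1) e2(1) e3(1) e4(1) unfolding e_def by auto
    let ?B = "mutual e"
    have c: "?B \<beta> \<alpha> = ?B \<alpha> \<beta>" "?B \<beta> \<nu>\<^sub>1 = ?B \<nu>\<^sub>1 \<beta>" "?B \<nu>\<^sub>2 \<alpha> = ?B \<alpha> \<nu>\<^sub>2" "?B \<nu>\<^sub>2 \<nu>\<^sub>1 = ?B \<nu>\<^sub>1 \<nu>\<^sub>2"
      using prob e(1) by (blast intro: mutual_commute)+
    have 1: "2 * ?B \<alpha> \<alpha> + ?B \<beta> \<alpha> \<le> m\<^sub>1" by (rule K1(1)) (use e in auto)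
    have 2: "2 * ?B \<beta> \<beta> + ?B \<alpha> \<beta> \<le> m\<^sub>2" by (rule K2(1)) (use e in auto)
    have 3: "2 * ?B \<nu>\<^sub>1 \<nu>\<^sub>1 + ?B \<nu>\<^sub>2 \<nu>\<^sub>1 \<le> l\<^sub>1" by (rule K3(1)) (use e in auto)
    have 4: "2 * ?B \<nu>\<^sub>2 \<nu>\<^sub>2 + ?B \<nu>\<^sub>1 \<nu>\<^sub>2 \<le> l\<^sub>2" by (rule K4(1)) (use e in auto)
    note 5 = e1(2)[OF e(1,3,2) prob(3)] e2(2)[OF e(1,4,2) prob(4)] e3(2)[OF e(1,5,2) prob(1)] e4(2)[OF e(1,6,2) prob(2)]
    \<comment> \<open>Twice the energy form is the sum of the four diagonal expressions minus the
      sum of the four mixed ones. Each constant bounds one of either kind, so the constants cancel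
      and only multiples of \<open>r\<close> remain.\<close>
    have "energy_form ?B \<alpha> \<nu>\<^sub>1 \<beta> \<nu>\<^sub>2 \<le> r"
      using 1 2 3 4 5 r unfolding energy_form_def c by linarith
    then show ?thesis using e M by (intro exI[of _ e]) auto
  qed
  show eq: "\<alpha> = \<nu>\<^sub>1" "\<beta> = \<nu>\<^sub>2" using energy_form_unique[OF M(1) prob' small] by blast+
  show "m\<^sub>1 = l\<^sub>1" "m\<^sub>2 = l\<^sub>2"
    using equilibrium_constant_le[OF E(1)] equilibrium_constant_le[OF E(3)] equilibrium_constant_le[OF E(2)] equilibrium_constant_le[OF E(4)]
      E prob unfolding eq by (meson antisym)+
qed

section \<open>Subsequences\<close>

text \<open>Lets Bolzano-Weierstrass be applied to the normalized logarithms. The integral is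
  bounded above through the diameter, below by Jensen's inequality with the kernel at scale 1. The
  larger interval admits the zeros from both sides.\<close>

lemma (in ac_measure) log_norm_bounded:
  assumes A: "A \<le> a" "b \<le> B"
  obtains C where "\<And>n Z W. 0 < n \<Longrightarrow> finite Z \<Longrightarrow> card Z = n \<Longrightarrow> Z \<subseteq> {A..B} \<Longrightarrow> finite W \<Longrightarrow> card W = n \<Longrightarrow> W \<subseteq> {A..B} \<Longrightarrow>
    \<bar>- ln (LINT x|\<mu>. (poly (root_poly Z) x)\<^sup>2 * \<bar>poly (root_poly W) x\<bar>) / real n\<bar> \<le> C"
proof -
  interpret finite_measure \<mu> by (rule fin)
  define M where "M = measure \<mu> UNIV + 1"
  have M: "1 \<le> M" by (simp add: M_def)
  define D where "D = max 1 (B - A)"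
  have D: "1 \<le> D" by (simp add: D_def)
  obtain d where d: "0 < d" "measure lborel {a..b} / 2 < measure lborel ({a..b} \<inter> {x. d \<le> w x})"
    using density_bounded_below[of "{a..b}"] ab by auto
  define S where "S = {a..b} \<inter> {x. d \<le> w x}"
  have S: "S \<in> sets borel" "S \<subseteq> {a..b}" "\<And>x. x \<in> S \<Longrightarrow> d \<le> w x" unfolding S_def by auto
  have Sb: "bounded S" using S(2) by (rule bounded_subset[OF bounded_closed_interval])
  have Sfin: "emeasure lborel S < \<infinity>" using emeasure_bounded_finite[OF Sb] .
  define s where "s = measure lborel S"
  have s: "0 < s" using d(2) ab unfolding s_def S_def by simp
  \<comment> \<open>Three groups of \<open>n\<close> zeros, as \<open>Z\<close> counts twice, each
    contribute at most n (s + 1), divided by the measure \<open>s\<close> of the set.\<close>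
  define C1 where "C1 = 3 * (1 + 1 / s) + \<bar>ln (d * s)\<bar>"
  define C2 where "C2 = ln M + 3 * ln D"
  show ?thesis
  proof (rule that[of "C1 + C2"])
    fix n :: nat and Z W :: "real set"
    assume n: "0 < n" and Z: "finite Z" "card Z = n" "Z \<subseteq> {A..B}" and W: "finite W" "card W = n" "W \<subseteq> {A..B}"
    define I where "I = (LINT x|\<mu>. (poly (root_poly Z) x)\<^sup>2 * \<bar>poly (root_poly W) x\<bar>)"
    have n1: "1 \<le> real n" using n by simp
    let ?l = "\<lambda>x. 2 * (\<Sum>z\<in>Z. ln \<bar>x - z\<bar>) + (\<Sum>z\<in>W. ln \<bar>x - z\<bar>)"
    have ln1: "integrable lborel (\<lambda>x. indicator S x * - ln \<bar>x - z\<bar>)"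
      "(LINT x|lborel. indicator S x * - ln \<bar>x - z\<bar>) \<le> 1 * measure lborel S + 1" for z
      using ln_set_integral_le[OF S(1) Sb, of 1 z 1] log_ker_le[of 1] by auto
    have leq: "indicator S x * ?l x = - (2 * (\<Sum>z\<in>Z. indicator S x * - ln \<bar>x - z\<bar>) + (\<Sum>z\<in>W. indicator S x * - ln \<bar>x - z\<bar>))" for x :: real
      by (simp add: sum_distrib_left sum_negf algebra_simps)
    have 1: "integrable lborel (\<lambda>x. \<Sum>z\<in>A. indicator S x * - ln \<bar>x - z\<bar>)" for A
      by (intro Bochner_Integration.integrable_sum ln1(1))
    have intl: "integrable lborel (\<lambda>x. indicator S x * ?l x)"
      unfolding leq by (intro Bochner_Integration.integrable_minus Bochner_Integration.integrable_add integrable_mult_right 1)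
    have I: "(LINT x|lborel. indicator S x * ?l x) =
        - (2 * (\<Sum>z\<in>Z. LINT x|lborel. indicator S x * - ln \<bar>x - z\<bar>) + (\<Sum>z\<in>W. LINT x|lborel. indicator S x * - ln \<bar>x - z\<bar>))"
      unfolding leq
      by (simp only: Bochner_Integration.integral_minus Bochner_Integration.integral_add[OF integrable_mult_right[OF 1] 1]
          integral_mult_right_zero Bochner_Integration.integral_sum[OF ln1(1)])
    have bnd: "(\<Sum>z\<in>Y. LINT x|lborel. indicator S x * - ln \<bar>x - z\<bar>) \<le> real n * (s + 1)" if "card Y = n" for Y
    proof -
      have "(\<Sum>z\<in>Y. LINT x|lborel. indicator S x * - ln \<bar>x - z\<bar>) \<le> (\<Sum>z\<in>Y. s + 1)"
        using ln1(2) unfolding s_def by (intro sum_mono) simp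
      then show ?thesis using that by simp
    qed
    define E where "E = - (3 * real n * (1 + 1 / s))"
    have "E * s = - (3 * (real n * (s + 1)))" using s by (simp add: E_def field_simps)
    then have Al: "E * measure lborel S \<le> (LINT x|lborel. indicator S x * ?l x)"
      unfolding I s_def[symmetric] using bnd[OF Z(2)] bnd[OF W(2)] by linarith
    have low: "d * s * exp E \<le> I"
      unfolding I_def s_def
    proof (rule jensen_lower_bound[OF _ _ S(1) Sfin d(1) S(3) intl _ Al])
      have "AE x in lborel. x \<notin> Z \<union> W"
        using Z(1) W(1) by (intro AE_not_in finite_imp_null_set_lborel) auto
      then show "AE x in lborel. x \<in> S \<longrightarrow> exp (?l x) \<le> (poly (root_poly Z) x)\<^sup>2 * \<bar>poly (root_poly W) x\<bar>"
        by eventually_elim (simp add: exp_sum_ln_eq[OF Z(1) W(1)])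
    qed (auto intro!: continuous_intros)
    have ds: "0 < d * s" using d s by simp
    then have Ipos: "0 < I" using low by (metis exp_gt_zero less_le_trans mult_pos_pos)
    have "ln (d * s) + E \<le> ln I"
      using ln_mono[OF low] ds by (simp add: ln_mult_pos)
    moreover have "- \<bar>ln (d * s)\<bar> * real n \<le> ln (d * s)"
    proof -
      have "\<bar>ln (d * s)\<bar> * 1 \<le> \<bar>ln (d * s)\<bar> * real n" using n1 by (intro mult_left_mono) auto
      then show ?thesis by linarith
    qed
    moreover have "E - \<bar>ln (d * s)\<bar> * real n = - (C1 * real n)" unfolding E_def C1_def by algebra
    ultimately have lo: "- (C1 * real n) \<le> ln I" by linarith
    have up: "I \<le> M * D ^ (3 * n)"
    proof -
      have le: "\<bar>poly (root_poly Y) x\<bar> \<le> D ^ n" if "card Y = n" "Y \<subseteq> {A..B}" "x \<in> {a..b}" for Y x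
      proof -
        have "(\<Prod>z\<in>Y. \<bar>x - z\<bar>) \<le> (\<Prod>z\<in>Y. D)"
        proof (rule prod_mono)
          fix z assume "z \<in> Y"
          then have "z \<in> {A..B}" using that by blast
          then show "0 \<le> \<bar>x - z\<bar> \<and> \<bar>x - z\<bar> \<le> D" using that(3) A by (auto simp: D_def)
        qed
        then show ?thesis using that(1) by (simp add: poly_root_poly abs_prod)
      qed
      have "I \<le> (LINT x|\<mu>. D ^ (3 * n))"
        unfolding I_def
      proof (rule integral_mono_ab)
        fix x assume x: "x \<in> {a..b}"
        have "(poly (root_poly Z) x)\<^sup>2 * \<bar>poly (root_poly W) x\<bar> \<le> (D ^ n)\<^sup>2 * D ^ n"
          using power_mono[OF le[OF Z(2,3) x], of 2] le[OF W(2,3) x] by (intro mult_mono) auto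
        also have "\<dots> = D ^ (3 * n)" by (simp add: power_mult[symmetric] power_add[symmetric] mult.commute)
        finally show "(poly (root_poly Z) x)\<^sup>2 * \<bar>poly (root_poly W) x\<bar> \<le> D ^ (3 * n)" .
      qed (auto intro!: continuous_intros)
      also have "\<dots> = measure \<mu> UNIV * D ^ (3 * n)" by simp
      also have "\<dots> \<le> M * D ^ (3 * n)" using D by (intro mult_right_mono) (auto simp: M_def)
      finally show ?thesis .
    qed
    have "ln I \<le> ln (M * D ^ (3 * n))" using up Ipos by (intro ln_mono) auto
    also have "\<dots> = ln M + real (3 * n) * ln D" using M D by (subst ln_mult_pos) (auto simp: ln_realpow)
    also have "\<dots> \<le> ln M * real n + 3 * ln D * real n"
      using mult_left_mono[OF n1, of "ln M"] M by simp
    finally have hi: "ln I \<le> C2 * real n" unfolding C2_def by (simp add: algebra_simps)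
    have C: "0 \<le> C1" "0 \<le> C2" using s M D unfolding C1_def C2_def by auto
    have "(C1 + C2) * real n = C1 * real n + C2 * real n" by (rule distrib_right)
    moreover have "0 \<le> C1 * real n" "0 \<le> C2 * real n" using C by auto
    ultimately have "\<bar>ln I\<bar> \<le> (C1 + C2) * real n" using lo hi by (simp only: abs_le_iff) linarith
    then have "\<bar>ln I\<bar> / real n \<le> C1 + C2" using n by (simp add: pos_divide_le_eq)
    then show "\<bar>- ln (LINT x|\<mu>. (poly (root_poly Z) x)\<^sup>2 * \<bar>poly (root_poly W) x\<bar>) / real n\<bar> \<le> C1 + C2"
      unfolding I_def[symmetric] by simp
  qed
qed

lemma LIMSEQ_if_subsequences:
  fixes X :: "nat \<Rightarrow> real"
  assumes "\<And>r. strict_mono (r :: nat \<Rightarrow> nat) \<Longrightarrow> \<exists>s. strict_mono s \<and> (\<lambda>k. X (r (s k))) \<longlonglongrightarrow> L"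
  shows "X \<longlonglongrightarrow> L"
proof (rule ccontr)
  assume "\<not> X \<longlonglongrightarrow> L"
  then obtain e where e: "0 < e" "\<not> (\<forall>\<^sub>F n in sequentially. dist (X n) L < e)"
    unfolding tendsto_iff by blast
  define A where "A = {n. \<not> dist (X n) L < e}"
  have "infinite A"
    unfolding infinite_nat_iff_unbounded_le A_def using e(2) by (auto simp: eventually_sequentially)
  then have r: "strict_mono (enumerate A)" "\<And>n. enumerate A n \<in> A"
    by (auto intro: strict_mono_enumerate enumerate_in_set)
  obtain s where s: "strict_mono s" "(\<lambda>k. X (enumerate A (s k))) \<longlonglongrightarrow> L" using assms[OF r(1)] by blast
  from tendstoD[OF s(2) e(1)] obtain k where "dist (X (enumerate A (s k))) L < e"
    by (auto simp: eventually_sequentially)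
  then show False using r(2)[of "s k"] by (simp add: A_def)
qed

section \<open>The weights along a subsequence\<close>

text \<open>The logarithm of the weight splits into three parts. The numerator is the minimal norm
  up to a factor between \<open>g\<close> and the total diameter; the value of the first polynomial
  lies across the gap, where truncation is exact; the third part needs two separate bounds.\<close>

lemma quad_weight_log_limit:
  fixes a\<^sub>1 b\<^sub>1 a\<^sub>2 b\<^sub>2 g :: real
  defines "g \<equiv> a\<^sub>2 - b\<^sub>1"
  assumes S1: "angelesco_side a\<^sub>1 b\<^sub>1 \<mu>\<^sub>1 w\<^sub>1 a\<^sub>2 b\<^sub>2 g l\<^sub>1 Z\<^sub>1 Z\<^sub>2 K \<nu>\<^sub>1 \<nu>\<^sub>2"
    and S2: "angelesco_side a\<^sub>2 b\<^sub>2 \<mu>\<^sub>2 w\<^sub>2 a\<^sub>1 b\<^sub>1 g l\<^sub>2 Z\<^sub>2 Z\<^sub>1 K \<nu>\<^sub>2 \<nu>\<^sub>1"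
    and less: "b\<^sub>1 < a\<^sub>2"
    and mop: "\<And>k. mop \<mu>\<^sub>1 \<mu>\<^sub>2 (K k) = root_poly (Z\<^sub>1 k) * root_poly (Z\<^sub>2 k)"
    and orth1: "\<And>k h. degree h < K k \<Longrightarrow> (LINT x|\<mu>\<^sub>1. poly (root_poly (Z\<^sub>1 k) * root_poly (Z\<^sub>2 k) * h) x) = 0"
    and orth2: "\<And>k h. degree h < K k \<Longrightarrow> (LINT x|\<mu>\<^sub>2. poly (root_poly (Z\<^sub>2 k) * root_poly (Z\<^sub>1 k) * h) x) = 0"
    and j: "\<And>k. j k \<in> {1..K k}"
    and lim: "(\<lambda>k. mop_zero \<mu>\<^sub>1 \<mu>\<^sub>2 (K k) (K k + j k)) \<longlonglongrightarrow> x" and x: "x \<in> {a\<^sub>2..b\<^sub>2}"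
    and u: "log_potential x \<nu>\<^sub>2 = ereal u"
  defines "wt \<equiv> \<lambda>k. \<bar>quad_weight \<mu>\<^sub>1 \<mu>\<^sub>2 \<mu>\<^sub>1 (K k) (K k + j k)\<bar>"
  shows "0 < wt k" and "(\<lambda>k. ln (wt k) / real (K k)) \<longlonglongrightarrow> 2 * log_pot g \<nu>\<^sub>1 x + u - l\<^sub>1"
proof -
  interpret S1: angelesco_side a\<^sub>1 b\<^sub>1 \<mu>\<^sub>1 w\<^sub>1 a\<^sub>2 b\<^sub>2 g l\<^sub>1 Z\<^sub>1 Z\<^sub>2 K \<nu>\<^sub>1 \<nu>\<^sub>2 by (rule S1)
  interpret S2: angelesco_side a\<^sub>2 b\<^sub>2 \<mu>\<^sub>2 w\<^sub>2 a\<^sub>1 b\<^sub>1 g l\<^sub>2 Z\<^sub>2 Z\<^sub>1 K \<nu>\<^sub>2 \<nu>\<^sub>1 by (rule S2)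
  define D where "D = b\<^sub>2 - a\<^sub>1"
  have D: "0 < D" using S1.ab S2.ab less by (simp add: D_def)
  define \<xi> where "\<xi> k = mop_zero \<mu>\<^sub>1 \<mu>\<^sub>2 (K k) (K k + j k)" for k
  have Zless: "y < z" if "y \<in> Z\<^sub>1 k" "z \<in> Z\<^sub>2 k" for y z k
    using S1.Z(3)[of k] S1.W(3)[of k] that less by force
  have \<xi>: "\<xi> k \<in> Z\<^sub>2 k" for k
    unfolding \<xi>_def by (rule mop_zero_upper[OF mop S1.Z(1) S1.W(1) Zless S1.Z(2) S1.W(2) j])
  have \<xi>ab: "\<xi> k \<in> {a\<^sub>2..b\<^sub>2}" for k using \<xi> S1.W(3) by blast
  have \<xi>lim: "\<xi> \<longlonglongrightarrow> x" using lim unfolding \<xi>_def .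
  let ?p = "\<lambda>k. root_poly (Z\<^sub>1 k)" and ?q = "\<lambda>k. root_poly (Z\<^sub>2 k - {\<xi> k})"
  define num where "num k = (LINT t|\<mu>\<^sub>1. (poly (?p k) t)\<^sup>2 * \<bar>poly (?q k) t\<bar>)" for k
  have wt: "wt k = num k / ((poly (?p k) (\<xi> k))\<^sup>2 * \<bar>poly (?q k) (\<xi> k)\<bar>)" for k
    unfolding wt_def num_def \<xi>_def
  proof (rule quad_weight_eq[OF S1.ac_measure_axioms mop S1.Z(1) S1.W(1) S1.Z(3) _ S1.Z(2) S1.W(2) j])
    show "b\<^sub>1 < y" if "y \<in> Z\<^sub>2 k" for y using S1.W(3)[of k] that less by force
  qed (rule orth1)
  have q\<xi>: "poly (?q k) (\<xi> k) \<noteq> 0" for k using S1.W(1)[of k] by (simp add: poly_root_poly_eq_0_iff)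
  have p\<xi>: "\<bar>poly (?p k) (\<xi> k)\<bar> = exp (- (\<Sum>z\<in>Z\<^sub>1 k. log_ker g \<bar>\<xi> k - z\<bar>))" for k
    unfolding poly_root_poly
  proof (rule abs_prod_eq_exp_log_ker[OF S1.g S1.Z(1)])
    fix z assume "z \<in> Z\<^sub>1 k"
    then have "z \<in> {a\<^sub>1..b\<^sub>1}" using S1.Z(3) by blast
    then show "g \<le> \<bar>\<xi> k - z\<bar>" using \<xi>ab S2.gap by blast
  qed
  have num_le: "g * num k \<le> S1.nrm k" and num_ge: "S1.nrm k \<le> D * num k" for k
  proof -
    have eq: "\<bar>poly (root_poly (Z\<^sub>2 k)) t\<bar> = \<bar>t - \<xi> k\<bar> * \<bar>poly (?q k) t\<bar>" for t
      unfolding root_poly_remove[OF S1.W(1) \<xi>] by (simp add: abs_mult[symmetric] left_diff_distrib)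
    have bd: "g \<le> \<bar>t - \<xi> k\<bar>" "\<bar>t - \<xi> k\<bar> \<le> D" if "t \<in> {a\<^sub>1..b\<^sub>1}" for t
      using S1.gap[OF that \<xi>ab[of k]] that \<xi>ab[of k] less unfolding D_def atLeastAtMost_iff by linarith+
    have "(LINT t|\<mu>\<^sub>1. g * ((poly (?p k) t)\<^sup>2 * \<bar>poly (?q k) t\<bar>)) \<le> S1.nrm k"
      unfolding S1.nrm_def
    proof (rule S1.integral_mono_ab)
      fix t assume "t \<in> {a\<^sub>1..b\<^sub>1}"
      from mult_right_mono[OF bd(1)[OF this], of "(poly (?p k) t)\<^sup>2 * \<bar>poly (?q k) t\<bar>"]
      show "g * ((poly (?p k) t)\<^sup>2 * \<bar>poly (?q k) t\<bar>) \<le> (poly (?p k) t)\<^sup>2 * \<bar>poly (root_poly (Z\<^sub>2 k)) t\<bar>"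
        unfolding eq by (simp add: mult_ac)
    qed (auto intro!: continuous_intros)
    then show "g * num k \<le> S1.nrm k" by (simp add: num_def)
    have "S1.nrm k \<le> (LINT t|\<mu>\<^sub>1. D * ((poly (?p k) t)\<^sup>2 * \<bar>poly (?q k) t\<bar>))"
      unfolding S1.nrm_def
    proof (rule S1.integral_mono_ab)
      fix t assume "t \<in> {a\<^sub>1..b\<^sub>1}"
      from mult_right_mono[OF bd(2)[OF this], of "(poly (?p k) t)\<^sup>2 * \<bar>poly (?q k) t\<bar>"]
      show "(poly (?p k) t)\<^sup>2 * \<bar>poly (root_poly (Z\<^sub>2 k)) t\<bar> \<le> D * ((poly (?p k) t)\<^sup>2 * \<bar>poly (?q k) t\<bar>)"
        unfolding eq by (simp add: mult_ac)
    qed (auto intro!: continuous_intros)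
    then show "S1.nrm k \<le> D * num k" by (simp add: num_def)
  qed
  have num_pos: "0 < num k" for k
    using num_ge[of k] S1.nrm_pos[of k] D by (metis less_le_trans zero_less_mult_pos)
  have p\<xi>0: "poly (?p k) (\<xi> k) \<noteq> 0" for k using p\<xi>[of k] by (metis abs_zero exp_not_eq_zero)
  show "0 < wt k" unfolding wt using num_pos p\<xi>0 q\<xi> by simp
  have limA: "(\<lambda>k. - ln (num k) / real (K k)) \<longlonglongrightarrow> l\<^sub>1"
  proof (rule real_tendsto_sandwich)
    have "(\<lambda>k. - ln (S1.nrm k) / real (K k) + ln g / real (K k)) \<longlonglongrightarrow> l\<^sub>1 + 0"
      by (intro tendsto_add S1.nrm_lim S1.inverse_N_lim)
    then show "(\<lambda>k. - ln (S1.nrm k) / real (K k) + ln g / real (K k)) \<longlonglongrightarrow> l\<^sub>1" by simp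
    have "(\<lambda>k. - ln (S1.nrm k) / real (K k) + ln D / real (K k)) \<longlonglongrightarrow> l\<^sub>1 + 0"
      by (intro tendsto_add S1.nrm_lim S1.inverse_N_lim)
    then show "(\<lambda>k. - ln (S1.nrm k) / real (K k) + ln D / real (K k)) \<longlonglongrightarrow> l\<^sub>1" by simp
    have "ln g + ln (num k) \<le> ln (S1.nrm k)" "ln (S1.nrm k) \<le> ln D + ln (num k)" for k
      using ln_mono[OF num_le[of k]] ln_mono[OF num_ge[of k]] S1.g D num_pos[of k] S1.nrm_pos[of k]
      by (simp_all add: ln_mult_pos)
    then have "(- ln (S1.nrm k) + ln g) / real (K k) \<le> - ln (num k) / real (K k)"
      "- ln (num k) / real (K k) \<le> (- ln (S1.nrm k) + ln D) / real (K k)" for k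
      by (intro divide_right_mono; simp add: algebra_simps)+
    note this[unfolded add_divide_distrib]
    then show "\<forall>\<^sub>F k in sequentially. - ln (S1.nrm k) / real (K k) + ln g / real (K k) \<le> - ln (num k) / real (K k)"
      "\<forall>\<^sub>F k in sequentially. - ln (num k) / real (K k) \<le> - ln (S1.nrm k) / real (K k) + ln D / real (K k)"
      by (intro always_eventually allI; blast)+
  qed
  have limB: "(\<lambda>k. (\<Sum>z\<in>Z\<^sub>1 k. log_ker g \<bar>\<xi> k - z\<bar>) / real (K k)) \<longlonglongrightarrow> log_pot g \<nu>\<^sub>1 x"
    by (rule S1.pot_lim_\<alpha>'[OF S1.g \<xi>lim])
  \<comment> \<open>Weak convergence with truncated kernels gives the lower half. The upper half
    needs \<open>node_lower_bound\<close>, since weak convergence does not exclude further zeros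
    extremely close to the node.\<close>
  have limC: "(\<lambda>k. - ln \<bar>poly (?q k) (\<xi> k)\<bar> / real (K k)) \<longlonglongrightarrow> u"
  proof (rule order_tendstoI)
    fix y assume y: "y < u"
    then obtain e where e: "0 < e" "y < log_pot e \<nu>\<^sub>2 x"
      using less_log_potential[OF S2.\<alpha>, of y x] u by auto
    \<comment> \<open>The node's own term \<open>log_ker e 0\<close> is finite and negligible after
      division by the degree.\<close>
    have "(\<lambda>k. (\<Sum>z\<in>Z\<^sub>2 k. log_ker e \<bar>\<xi> k - z\<bar>) / real (K k) - log_ker e 0 / real (K k)) \<longlonglongrightarrow> log_pot e \<nu>\<^sub>2 x - 0"
      by (intro tendsto_diff S2.pot_lim_\<alpha>'[OF e(1) \<xi>lim] S1.inverse_N_lim)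
    then have "\<forall>\<^sub>F k in sequentially. y < (\<Sum>z\<in>Z\<^sub>2 k. log_ker e \<bar>\<xi> k - z\<bar>) / real (K k) - log_ker e 0 / real (K k)"
      using e(2) by (intro order_tendstoD(1)) auto
    then show "\<forall>\<^sub>F k in sequentially. y < - ln \<bar>poly (?q k) (\<xi> k)\<bar> / real (K k)"
    proof eventually_elim
      case (elim k)
      have "\<bar>poly (?q k) (\<xi> k)\<bar> \<le> exp (- (\<Sum>z\<in>Z\<^sub>2 k - {\<xi> k}. log_ker e \<bar>\<xi> k - z\<bar>))"
        unfolding poly_root_poly using S1.W(1) by (intro abs_prod_le_exp_log_ker[OF e(1)]) auto
      then have "ln \<bar>poly (?q k) (\<xi> k)\<bar> \<le> - (\<Sum>z\<in>Z\<^sub>2 k - {\<xi> k}. log_ker e \<bar>\<xi> k - z\<bar>)"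
        using ln_mono[of "\<bar>poly (?q k) (\<xi> k)\<bar>" "exp (- (\<Sum>z\<in>Z\<^sub>2 k - {\<xi> k}. log_ker e \<bar>\<xi> k - z\<bar>))"] q\<xi>[of k] by simp
      moreover have "(\<Sum>z\<in>Z\<^sub>2 k. log_ker e \<bar>\<xi> k - z\<bar>) = log_ker e 0 + (\<Sum>z\<in>Z\<^sub>2 k - {\<xi> k}. log_ker e \<bar>\<xi> k - z\<bar>)"
        using sum.remove[OF S1.W(1) \<xi>, of "\<lambda>z. log_ker e \<bar>\<xi> k - z\<bar>"] by simp
      ultimately have "((\<Sum>z\<in>Z\<^sub>2 k. log_ker e \<bar>\<xi> k - z\<bar>) - log_ker e 0) / real (K k) \<le> - ln \<bar>poly (?q k) (\<xi> k)\<bar> / real (K k)"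
        by (intro divide_right_mono) auto
      with elim show ?case by (simp add: diff_divide_distrib)
    qed
  next
    fix y assume y: "u < y"
    have "\<forall>\<^sub>F k in sequentially. - ln \<bar>poly (?q k) (\<xi> k)\<bar> / real (K k) \<le> u + (y - u) / 2"
    proof (rule S2.node_lower_bound[OF \<xi> \<xi>lim x])
      show "log_pot e \<nu>\<^sub>2 x \<le> u" if "0 < e" for e using log_pot_le_log_potential[OF S2.\<alpha> that, of x] u by simp
      show "\<bar>poly (root_poly (Z\<^sub>1 k)) t\<bar> = 1 * poly (root_poly (Z\<^sub>1 k)) t" if "t \<in> {a\<^sub>2..b\<^sub>2}" for k t
        by (rule abs_root_poly_right) (use S1.Z(3)[of k] that less in force)
    qed (use y orth2 in auto)
    then show "\<forall>\<^sub>F k in sequentially. - ln \<bar>poly (?q k) (\<xi> k)\<bar> / real (K k) < y"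
      by eventually_elim (use y in \<open>simp add: field_simps\<close>)
  qed
  have "ln (wt k) = ln (num k) + 2 * (\<Sum>z\<in>Z\<^sub>1 k. log_ker g \<bar>\<xi> k - z\<bar>) - ln \<bar>poly (?q k) (\<xi> k)\<bar>" for k
  proof -
    have p0: "0 < \<bar>poly (?p k) (\<xi> k)\<bar>" using p\<xi>0 by simp
    have q0: "0 < \<bar>poly (?q k) (\<xi> k)\<bar>" using q\<xi> by simp
    have "wt k = num k / (\<bar>poly (?p k) (\<xi> k)\<bar>\<^sup>2 * \<bar>poly (?q k) (\<xi> k)\<bar>)" unfolding wt by simp
    also have "ln \<dots> = ln (num k) - ln (\<bar>poly (?p k) (\<xi> k)\<bar>\<^sup>2 * \<bar>poly (?q k) (\<xi> k)\<bar>)"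
      by (rule ln_divide_pos[OF num_pos mult_pos_pos[OF zero_less_power[OF p0] q0]])
    also have "ln (\<bar>poly (?p k) (\<xi> k)\<bar>\<^sup>2 * \<bar>poly (?q k) (\<xi> k)\<bar>) = 2 * ln \<bar>poly (?p k) (\<xi> k)\<bar> + ln \<bar>poly (?q k) (\<xi> k)\<bar>"
      unfolding ln_mult_pos[OF zero_less_power[OF p0] q0] ln_realpow by simp
    also have "ln \<bar>poly (?p k) (\<xi> k)\<bar> = - (\<Sum>z\<in>Z\<^sub>1 k. log_ker g \<bar>\<xi> k - z\<bar>)" unfolding p\<xi> by simp
    finally show ?thesis by simp
  qed
  then have eq: "ln (wt k) / real (K k) = 2 * ((\<Sum>z\<in>Z\<^sub>1 k. log_ker g \<bar>\<xi> k - z\<bar>) / real (K k))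
      + - ln \<bar>poly (?q k) (\<xi> k)\<bar> / real (K k) - - ln (num k) / real (K k)" for k
    by (simp add: add_divide_distrib diff_divide_distrib)
  show "(\<lambda>k. ln (wt k) / real (K k)) \<longlonglongrightarrow> 2 * log_pot g \<nu>\<^sub>1 x + u - l\<^sub>1"
    unfolding eq by (intro tendsto_intros limA limB limC)
qed

text \<open>Four successive extractions: two for the zero distributions, two for the bounded
  normalized logarithms. Both intervals share one subsequence, so each limit measure can act as
  external field for the other.\<close>

lemma angelesco_side_subsequence:
  fixes a\<^sub>1 b\<^sub>1 a\<^sub>2 b\<^sub>2 g :: real
  defines "g \<equiv> a\<^sub>2 - b\<^sub>1"
  assumes A1: "ac_measure a\<^sub>1 b\<^sub>1 \<mu>\<^sub>1 w\<^sub>1" and A2: "ac_measure a\<^sub>2 b\<^sub>2 \<mu>\<^sub>2 w\<^sub>2" and less: "b\<^sub>1 < a\<^sub>2"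
    and Z1: "\<And>n. finite (Z\<^sub>1 n)" "\<And>n. card (Z\<^sub>1 n) = n" "\<And>n. Z\<^sub>1 n \<subseteq> {a\<^sub>1..b\<^sub>1}"
    and Z2: "\<And>n. finite (Z\<^sub>2 n)" "\<And>n. card (Z\<^sub>2 n) = n" "\<And>n. Z\<^sub>2 n \<subseteq> {a\<^sub>2..b\<^sub>2}"
    and orth1: "\<And>n h. degree h < n \<Longrightarrow> (LINT x|\<mu>\<^sub>1. poly (root_poly (Z\<^sub>1 n) * root_poly (Z\<^sub>2 n) * h) x) = 0"
    and orth2: "\<And>n h. degree h < n \<Longrightarrow> (LINT x|\<mu>\<^sub>2. poly (root_poly (Z\<^sub>2 n) * root_poly (Z\<^sub>1 n) * h) x) = 0"
    and r: "strict_mono (r :: nat \<Rightarrow> nat)"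
  obtains s \<alpha> \<beta> m\<^sub>1 m\<^sub>2 where "strict_mono s" "\<And>k. 0 < r (s k)"
    "angelesco_side a\<^sub>1 b\<^sub>1 \<mu>\<^sub>1 w\<^sub>1 a\<^sub>2 b\<^sub>2 g m\<^sub>1 (\<lambda>k. Z\<^sub>1 (r (s k))) (\<lambda>k. Z\<^sub>2 (r (s k))) (\<lambda>k. r (s k)) \<alpha> \<beta>"
    "angelesco_side a\<^sub>2 b\<^sub>2 \<mu>\<^sub>2 w\<^sub>2 a\<^sub>1 b\<^sub>1 g m\<^sub>2 (\<lambda>k. Z\<^sub>2 (r (s k))) (\<lambda>k. Z\<^sub>1 (r (s k))) (\<lambda>k. r (s k)) \<beta> \<alpha>"
proof -
  interpret m1: ac_measure a\<^sub>1 b\<^sub>1 \<mu>\<^sub>1 w\<^sub>1 by (rule A1)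
  interpret m2: ac_measure a\<^sub>2 b\<^sub>2 \<mu>\<^sub>2 w\<^sub>2 by (rule A2)
  \<comment> \<open>The shift by \<open>Suc\<close> skips the possible degree 0, for which there
    would be no zeros to average over.\<close>
  have rpos: "0 < r (Suc k)" for k using seq_suble[OF r, of "Suc k"] by simp
  have ne: "Z\<^sub>1 n \<noteq> {}" "Z\<^sub>2 n \<noteq> {}" if "0 < n" for n using that Z1(2)[of n] Z2(2)[of n] by auto
  obtain s1 \<alpha> where s1: "strict_mono (s1 :: nat \<Rightarrow> nat)" "prob_on a\<^sub>1 b\<^sub>1 \<alpha>"
    "\<And>f. continuous_on UNIV f \<Longrightarrow> (\<lambda>n. (\<Sum>z\<in>Z\<^sub>1 (r (Suc (s1 n))). f z) / real (card (Z\<^sub>1 (r (Suc (s1 n)))))) \<longlonglongrightarrow> (LINT y|\<alpha>. f y)"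
    by (rule helly_empirical[of "\<lambda>k. Z\<^sub>1 (r (Suc k))" a\<^sub>1 b\<^sub>1]) (use Z1 ne rpos in auto)
  obtain s2 \<beta> where s2: "strict_mono (s2 :: nat \<Rightarrow> nat)" "prob_on a\<^sub>2 b\<^sub>2 \<beta>"
    "\<And>f. continuous_on UNIV f \<Longrightarrow> (\<lambda>n. (\<Sum>z\<in>Z\<^sub>2 (r (Suc (s1 (s2 n)))). f z) / real (card (Z\<^sub>2 (r (Suc (s1 (s2 n))))))) \<longlonglongrightarrow> (LINT y|\<beta>. f y)"
    by (rule helly_empirical[of "\<lambda>k. Z\<^sub>2 (r (Suc (s1 k)))" a\<^sub>2 b\<^sub>2]) (use Z2 ne rpos in auto)
  define I1 where "I1 n = - ln (LINT x|\<mu>\<^sub>1. (poly (root_poly (Z\<^sub>1 n)) x)\<^sup>2 * \<bar>poly (root_poly (Z\<^sub>2 n)) x\<bar>) / real n" for n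
  define I2 where "I2 n = - ln (LINT x|\<mu>\<^sub>2. (poly (root_poly (Z\<^sub>2 n)) x)\<^sup>2 * \<bar>poly (root_poly (Z\<^sub>1 n)) x\<bar>) / real n" for n
  have sub: "Z\<^sub>1 n \<subseteq> {a\<^sub>1..b\<^sub>2}" "Z\<^sub>2 n \<subseteq> {a\<^sub>1..b\<^sub>2}" for n
    using Z1(3)[of n] Z2(3)[of n] m1.ab m2.ab less by force+
  obtain C1 where C1: "\<And>n. 0 < n \<Longrightarrow> \<bar>I1 n\<bar> \<le> C1"
    unfolding I1_def
  proof (rule m1.log_norm_bounded[of a\<^sub>1 b\<^sub>2])
    fix C assume *: "\<And>n Z W. 0 < n \<Longrightarrow> finite Z \<Longrightarrow> card Z = n \<Longrightarrow> Z \<subseteq> {a\<^sub>1..b\<^sub>2} \<Longrightarrow> finite W \<Longrightarrow> card W = n \<Longrightarrow> W \<subseteq> {a\<^sub>1..b\<^sub>2} \<Longrightarrow>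
      \<bar>- ln (LINT x|\<mu>\<^sub>1. (poly (root_poly Z) x)\<^sup>2 * \<bar>poly (root_poly W) x\<bar>) / real n\<bar> \<le> C"
    show thesis by (rule that[of C]) (use *[OF _ Z1(1,2) sub(1) Z2(1,2) sub(2)] in \<open>simp add: I1_def\<close>)
  qed (use m2.ab less in auto)
  obtain C2 where C2: "\<And>n. 0 < n \<Longrightarrow> \<bar>I2 n\<bar> \<le> C2"
    unfolding I2_def
  proof (rule m2.log_norm_bounded[of a\<^sub>1 b\<^sub>2])
    fix C assume *: "\<And>n Z W. 0 < n \<Longrightarrow> finite Z \<Longrightarrow> card Z = n \<Longrightarrow> Z \<subseteq> {a\<^sub>1..b\<^sub>2} \<Longrightarrow> finite W \<Longrightarrow> card W = n \<Longrightarrow> W \<subseteq> {a\<^sub>1..b\<^sub>2} \<Longrightarrow>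
      \<bar>- ln (LINT x|\<mu>\<^sub>2. (poly (root_poly Z) x)\<^sup>2 * \<bar>poly (root_poly W) x\<bar>) / real n\<bar> \<le> C"
    show thesis by (rule that[of C]) (use *[OF _ Z2(1,2) sub(2) Z1(1,2) sub(1)] in \<open>simp add: I2_def\<close>)
  qed (use m1.ab less in auto)
  have "bounded (range (\<lambda>k. I1 (r (Suc (s1 (s2 k))))))"
    unfolding bounded_iff by (rule exI[of _ C1]) (use C1 rpos in auto)
  from bounded_imp_convergent_subsequence[OF this] obtain m\<^sub>1 s3
    where s3: "strict_mono (s3 :: nat \<Rightarrow> nat)" "(\<lambda>k. I1 (r (Suc (s1 (s2 (s3 k)))))) \<longlonglongrightarrow> m\<^sub>1"
    by (auto simp: comp_def)
  have "bounded (range (\<lambda>k. I2 (r (Suc (s1 (s2 (s3 k)))))))"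
    unfolding bounded_iff by (rule exI[of _ C2]) (use C2 rpos in auto)
  from bounded_imp_convergent_subsequence[OF this] obtain m\<^sub>2 s4
    where s4: "strict_mono (s4 :: nat \<Rightarrow> nat)" "(\<lambda>k. I2 (r (Suc (s1 (s2 (s3 (s4 k))))))) \<longlonglongrightarrow> m\<^sub>2"
    by (auto simp: comp_def)
  define s where "s k = Suc (s1 (s2 (s3 (s4 k))))" for k
  define K where "K k = r (s k)" for k
  have s: "strict_mono s"
    using s1(1) s2(1) s3(1) s4(1) by (simp add: s_def strict_mono_def)
  have Kpos: "0 < K k" for k unfolding K_def s_def by (rule rpos)
  have "strict_mono K" unfolding K_def using r s by (simp add: strict_mono_def)
  then have K_lim: "filterlim K at_top sequentially" by (rule filterlim_subseq)
  have conv1: "(\<lambda>k. (\<Sum>z\<in>Z\<^sub>1 (K k). f z) / real (K k)) \<longlonglongrightarrow> (LINT y|\<alpha>. f y)" if "continuous_on UNIV f" for f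
  proof -
    have "strict_mono (\<lambda>k. s2 (s3 (s4 k)))" using s2(1) s3(1) s4(1) by (simp add: strict_mono_def)
    from LIMSEQ_subseq_LIMSEQ[OF s1(3)[OF that] this] show ?thesis by (simp add: comp_def Z1(2) K_def s_def)
  qed
  have conv2: "(\<lambda>k. (\<Sum>z\<in>Z\<^sub>2 (K k). f z) / real (K k)) \<longlonglongrightarrow> (LINT y|\<beta>. f y)" if "continuous_on UNIV f" for f
  proof -
    have "strict_mono (\<lambda>k. s3 (s4 k))" using s3(1) s4(1) by (simp add: strict_mono_def)
    from LIMSEQ_subseq_LIMSEQ[OF s2(3)[OF that] this] show ?thesis by (simp add: comp_def Z2(2) K_def s_def)
  qed
  have I1_lim: "(\<lambda>k. I1 (K k)) \<longlonglongrightarrow> m\<^sub>1"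
    using LIMSEQ_subseq_LIMSEQ[OF s3(2) s4(1)] by (simp add: comp_def K_def s_def)
  have I2_lim: "(\<lambda>k. I2 (K k)) \<longlonglongrightarrow> m\<^sub>2"
    using s4(2) by (simp add: K_def s_def)
  have g: "0 < g" using less by (simp add: g_def)
  have min1: "(LINT x|\<mu>\<^sub>1. (poly (root_poly (Z\<^sub>1 n)) x)\<^sup>2 * \<bar>poly (root_poly (Z\<^sub>2 n)) x\<bar>) \<le> (LINT x|\<mu>\<^sub>1. (poly R x)\<^sup>2 * \<bar>poly (root_poly (Z\<^sub>2 n)) x\<bar>)"
    if "0 < n" "degree R = n" "lead_coeff R = 1" for n R
  proof (rule m1.orth_minimal[OF _ degree_root_poly[OF Z1(1), unfolded Z1(2)] lead_coeff_root_poly that(2,3,1)])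
    show "(LINT x|\<mu>\<^sub>1. poly (root_poly (Z\<^sub>1 n) * root_poly (Z\<^sub>2 n) * h) x) = 0" if "degree h < n" for h
      by (rule orth1[OF that])
    show "\<bar>poly (root_poly (Z\<^sub>2 n)) x\<bar> = (- 1) ^ card (Z\<^sub>2 n) * poly (root_poly (Z\<^sub>2 n)) x" if "x \<in> {a\<^sub>1..b\<^sub>1}" for x
      by (rule abs_root_poly_left) (use Z2(3)[of n] that less in force)
  qed
  have min2: "(LINT x|\<mu>\<^sub>2. (poly (root_poly (Z\<^sub>2 n)) x)\<^sup>2 * \<bar>poly (root_poly (Z\<^sub>1 n)) x\<bar>) \<le> (LINT x|\<mu>\<^sub>2. (poly R x)\<^sup>2 * \<bar>poly (root_poly (Z\<^sub>1 n)) x\<bar>)"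
    if "0 < n" "degree R = n" "lead_coeff R = 1" for n R
  proof (rule m2.orth_minimal[OF _ degree_root_poly[OF Z2(1), unfolded Z2(2)] lead_coeff_root_poly that(2,3,1)])
    show "(LINT x|\<mu>\<^sub>2. poly (root_poly (Z\<^sub>2 n) * root_poly (Z\<^sub>1 n) * h) x) = 0" if "degree h < n" for h
      by (rule orth2[OF that])
    show "\<bar>poly (root_poly (Z\<^sub>1 n)) x\<bar> = 1 * poly (root_poly (Z\<^sub>1 n)) x" if "x \<in> {a\<^sub>2..b\<^sub>2}" for x
      by (rule abs_root_poly_right) (use Z1(3)[of n] that less in force)
  qed
  have "angelesco_side a\<^sub>1 b\<^sub>1 \<mu>\<^sub>1 w\<^sub>1 a\<^sub>2 b\<^sub>2 g m\<^sub>1 (\<lambda>k. Z\<^sub>1 (K k)) (\<lambda>k. Z\<^sub>2 (K k)) K \<alpha> \<beta>"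
    by (intro angelesco_side.intro angelesco_side_axioms.intro A1 g Kpos K_lim Z1 Z2 s1(2) s2(2) conv1 conv2 min1 I1_lim[unfolded I1_def])
      (auto simp: g_def)
  moreover have "angelesco_side a\<^sub>2 b\<^sub>2 \<mu>\<^sub>2 w\<^sub>2 a\<^sub>1 b\<^sub>1 g m\<^sub>2 (\<lambda>k. Z\<^sub>2 (K k)) (\<lambda>k. Z\<^sub>1 (K k)) K \<beta> \<alpha>"
    by (intro angelesco_side.intro angelesco_side_axioms.intro A2 g Kpos K_lim Z1 Z2 s1(2) s2(2) conv1 conv2 min2 I2_lim[unfolded I2_def])
      (auto simp: g_def)
  ultimately show ?thesis using that[OF s] Kpos unfolding K_def by blast
qed

theorem theorem3p2:
  fixes a\<^sub>1 b\<^sub>1 a\<^sub>2 b\<^sub>2 bstar astar l\<^sub>1 l\<^sub>2 x :: real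
    and \<mu>\<^sub>1 \<mu>\<^sub>2 \<nu>\<^sub>1 \<nu>\<^sub>2 :: "real measure"
    and w\<^sub>1 w\<^sub>2 :: "real \<Rightarrow> real"
    and j :: "nat \<Rightarrow> nat"
  assumes "angelesco a\<^sub>1 b\<^sub>1 a\<^sub>2 b\<^sub>2 \<mu>\<^sub>1 \<mu>\<^sub>2"
    and "ac_density \<mu>\<^sub>1 w\<^sub>1" and "AE t in lborel. t \<in> {a\<^sub>1..b\<^sub>1} \<longrightarrow> 0 < w\<^sub>1 t"
    and "ac_density \<mu>\<^sub>2 w\<^sub>2" and "AE t in lborel. t \<in> {a\<^sub>2..b\<^sub>2} \<longrightarrow> 0 < w\<^sub>2 t"
    and "b\<^sub>1 < a\<^sub>2"
    and "vector_equilibrium a\<^sub>1 b\<^sub>1 a\<^sub>2 b\<^sub>2 \<nu>\<^sub>1 \<nu>\<^sub>2"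
    and "supp \<nu>\<^sub>1 = {a\<^sub>1..bstar}" and "bstar \<le> b\<^sub>1"
    and "supp \<nu>\<^sub>2 = {astar..b\<^sub>2}" and "a\<^sub>2 \<le> astar"
    and "\<forall>t\<in>{a\<^sub>1..bstar}. 2 * log_potential t \<nu>\<^sub>1 + log_potential t \<nu>\<^sub>2 = ereal l\<^sub>1"
    and "\<forall>t\<in>{bstar<..b\<^sub>1}. 2 * log_potential t \<nu>\<^sub>1 + log_potential t \<nu>\<^sub>2 > ereal l\<^sub>1"
    and "\<forall>t\<in>{astar..b\<^sub>2}. log_potential t \<nu>\<^sub>1 + 2 * log_potential t \<nu>\<^sub>2 = ereal l\<^sub>2"
    and "\<forall>t\<in>{a\<^sub>2..<astar}. log_potential t \<nu>\<^sub>1 + 2 * log_potential t \<nu>\<^sub>2 > ereal l\<^sub>2"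
    and "\<forall>n\<ge>1. j n \<in> {1..n}"
    and "x \<in> {astar..b\<^sub>2}"
    and "(\<lambda>n. mop_zero \<mu>\<^sub>1 \<mu>\<^sub>2 n (n + j n)) \<longlonglongrightarrow> x"
  shows "(\<lambda>n. \<bar>quad_weight \<mu>\<^sub>1 \<mu>\<^sub>2 \<mu>\<^sub>1 n (n + j n)\<bar> powr (1 / real n))
           \<longlonglongrightarrow> exp (real_of_ereal (2 * log_potential x \<nu>\<^sub>1 + log_potential x \<nu>\<^sub>2 - ereal l\<^sub>1))"
proof -
  define g where "g = a\<^sub>2 - b\<^sub>1"
  have g: "0 < g" using \<open>b\<^sub>1 < a\<^sub>2\<close> by (simp add: g_def)
  have A1: "ac_measure a\<^sub>1 b\<^sub>1 \<mu>\<^sub>1 w\<^sub>1" and A2: "ac_measure a\<^sub>2 b\<^sub>2 \<mu>\<^sub>2 w\<^sub>2"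
    using assms(1-5) by (auto simp: angelesco_def ac_measure_def)
  have \<nu>: "prob_on a\<^sub>1 b\<^sub>1 \<nu>\<^sub>1" "prob_on a\<^sub>2 b\<^sub>2 \<nu>\<^sub>2"
    using \<open>vector_equilibrium a\<^sub>1 b\<^sub>1 a\<^sub>2 b\<^sub>2 \<nu>\<^sub>1 \<nu>\<^sub>2\<close> by (auto simp: vector_equilibrium_def)
  have gap: "\<forall>t\<in>{a\<^sub>1..b\<^sub>1}. \<forall>y\<in>{a\<^sub>2..b\<^sub>2}. g \<le> \<bar>t - y\<bar>" "\<forall>t\<in>{a\<^sub>2..b\<^sub>2}. \<forall>y\<in>{a\<^sub>1..b\<^sub>1}. g \<le> \<bar>t - y\<bar>"
    by (auto simp: g_def)
  have E1: "equilibrium_conditions a\<^sub>1 b\<^sub>1 g l\<^sub>1 \<nu>\<^sub>1 \<nu>\<^sub>2"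
  proof (rule equilibrium_conditions_log_potential[OF \<nu> g gap(1)])
    show "2 * log_potential t \<nu>\<^sub>1 + log_potential t \<nu>\<^sub>2 = ereal l\<^sub>1" if "t \<in> supp \<nu>\<^sub>1" for t
      using assms(8,12) that by blast
    show "ereal l\<^sub>1 \<le> 2 * log_potential t \<nu>\<^sub>1 + log_potential t \<nu>\<^sub>2" if "t \<in> {a\<^sub>1..b\<^sub>1}" for t
      using bspec[OF assms(12), of t] bspec[OF assms(13), of t] that by (cases "t \<le> bstar") (auto intro: less_imp_le)
  qed
  have E2: "equilibrium_conditions a\<^sub>2 b\<^sub>2 g l\<^sub>2 \<nu>\<^sub>2 \<nu>\<^sub>1"
  proof (rule equilibrium_conditions_log_potential[OF \<nu>(2,1) g gap(2)])
    show "2 * log_potential t \<nu>\<^sub>2 + log_potential t \<nu>\<^sub>1 = ereal l\<^sub>2" if "t \<in> supp \<nu>\<^sub>2" for t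
      unfolding add.commute[of "2 * log_potential t \<nu>\<^sub>2"] using assms(10,14) that by blast
    show "ereal l\<^sub>2 \<le> 2 * log_potential t \<nu>\<^sub>2 + log_potential t \<nu>\<^sub>1" if "t \<in> {a\<^sub>2..b\<^sub>2}" for t
      unfolding add.commute[of "2 * log_potential t \<nu>\<^sub>2"]
      using bspec[OF assms(14), of t] bspec[OF assms(15), of t] that by (cases "astar \<le> t") (auto intro: less_imp_le)
  qed
  have x: "x \<in> {a\<^sub>2..b\<^sub>2}" using assms(11,17) by auto
  have far: "log_potential x \<nu>\<^sub>1 = ereal (log_pot g \<nu>\<^sub>1 x)"
    using gap(2) x by (intro log_potential_far[OF \<nu>(1) g]) auto
  \<comment> \<open>On the support of \<open>\<nu>\<^sub>2\<close> the second equilibrium equality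
    and the finite potential of the distant \<open>\<nu>\<^sub>1\<close> leave no room for an
    infinite value.\<close>
  obtain u where u: "log_potential x \<nu>\<^sub>2 = ereal u"
    using bspec[OF assms(14,17)] unfolding far by (cases "log_potential x \<nu>\<^sub>2") auto
  define L where "L = 2 * log_pot g \<nu>\<^sub>1 x + u - l\<^sub>1"
  have L: "real_of_ereal (2 * log_potential x \<nu>\<^sub>1 + log_potential x \<nu>\<^sub>2 - ereal l\<^sub>1) = L"
  proof -
    have "2 * ereal (log_pot g \<nu>\<^sub>1 x) = ereal (2 * log_pot g \<nu>\<^sub>1 x)" by simp
    then show ?thesis unfolding far u L_def by simp
  qed
  have "\<exists>A B. finite A \<and> finite B \<and> card A = n \<and> card B = n \<and> A \<subseteq> {a\<^sub>1<..<b\<^sub>1} \<and> B \<subseteq> {a\<^sub>2<..<b\<^sub>2} \<and>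
      mop \<mu>\<^sub>1 \<mu>\<^sub>2 n = root_poly A * root_poly B \<and>
      (\<forall>h. degree h < n \<longrightarrow> (LINT x|\<mu>\<^sub>1. poly (root_poly A * root_poly B * h) x) = 0) \<and>
      (\<forall>h. degree h < n \<longrightarrow> (LINT x|\<mu>\<^sub>2. poly (root_poly B * root_poly A * h) x) = 0)" for n
    by (rule mop_structure[OF A1 A2 \<open>b\<^sub>1 < a\<^sub>2\<close>, of n]) blast
  then obtain Z\<^sub>1 Z\<^sub>2 where Z: "\<And>n. finite (Z\<^sub>1 n)" "\<And>n. finite (Z\<^sub>2 n)" "\<And>n. card (Z\<^sub>1 n) = n" "\<And>n. card (Z\<^sub>2 n) = n"
      "\<And>n. Z\<^sub>1 n \<subseteq> {a\<^sub>1<..<b\<^sub>1}" "\<And>n. Z\<^sub>2 n \<subseteq> {a\<^sub>2<..<b\<^sub>2}" "\<And>n. mop \<mu>\<^sub>1 \<mu>\<^sub>2 n = root_poly (Z\<^sub>1 n) * root_poly (Z\<^sub>2 n)"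
    and orth: "\<And>n h. degree h < n \<Longrightarrow> (LINT x|\<mu>\<^sub>1. poly (root_poly (Z\<^sub>1 n) * root_poly (Z\<^sub>2 n) * h) x) = 0"
      "\<And>n h. degree h < n \<Longrightarrow> (LINT x|\<mu>\<^sub>2. poly (root_poly (Z\<^sub>2 n) * root_poly (Z\<^sub>1 n) * h) x) = 0"
    by metis
  have Z': "Z\<^sub>1 n \<subseteq> {a\<^sub>1..b\<^sub>1}" "Z\<^sub>2 n \<subseteq> {a\<^sub>2..b\<^sub>2}" for n
    using Z(5,6)[of n] greaterThanLessThan_subseteq_atLeastAtMost_iff by blast+
  have "(\<lambda>n. \<bar>quad_weight \<mu>\<^sub>1 \<mu>\<^sub>2 \<mu>\<^sub>1 n (n + j n)\<bar> powr (1 / real n)) \<longlonglongrightarrow> exp L"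
  proof (rule LIMSEQ_if_subsequences)
    fix r :: "nat \<Rightarrow> nat" assume r: "strict_mono r"
    obtain s \<alpha> \<beta> m\<^sub>1 m\<^sub>2 where s: "strict_mono s" "\<And>k. 0 < r (s k)"
      and S1: "angelesco_side a\<^sub>1 b\<^sub>1 \<mu>\<^sub>1 w\<^sub>1 a\<^sub>2 b\<^sub>2 g m\<^sub>1 (\<lambda>k. Z\<^sub>1 (r (s k))) (\<lambda>k. Z\<^sub>2 (r (s k))) (\<lambda>k. r (s k)) \<alpha> \<beta>"
      and S2: "angelesco_side a\<^sub>2 b\<^sub>2 \<mu>\<^sub>2 w\<^sub>2 a\<^sub>1 b\<^sub>1 g m\<^sub>2 (\<lambda>k. Z\<^sub>2 (r (s k))) (\<lambda>k. Z\<^sub>1 (r (s k))) (\<lambda>k. r (s k)) \<beta> \<alpha>"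
      unfolding g_def
      by (rule angelesco_side_subsequence[OF A1 A2 \<open>b\<^sub>1 < a\<^sub>2\<close> Z(1,3) Z'(1) Z(2,4) Z'(2) orth r]) blast+
    \<comment> \<open>Whatever subsequence was given, the extracted limits are the same, so the
      limit of the weights does not depend on it.\<close>
    have eq: "\<alpha> = \<nu>\<^sub>1" "\<beta> = \<nu>\<^sub>2" "m\<^sub>1 = l\<^sub>1" "m\<^sub>2 = l\<^sub>2"
      using equilibrium_conditions_unique[OF angelesco_side.\<alpha>[OF S1] angelesco_side.\<beta>[OF S1] \<nu> \<open>b\<^sub>1 < a\<^sub>2\<close>
          angelesco_side.limit_equilibrium_conditions[OF S1, unfolded g_def] angelesco_side.limit_equilibrium_conditions[OF S2, unfolded g_def]
          E1[unfolded g_def] E2[unfolded g_def]] by blast+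
    let ?K = "\<lambda>k. r (s k)"
    let ?wt = "\<lambda>k. \<bar>quad_weight \<mu>\<^sub>1 \<mu>\<^sub>2 \<mu>\<^sub>1 (?K k) (?K k + j (?K k))\<bar>"
    have j: "j (?K k) \<in> {1..?K k}" for k using assms(16) s(2)[of k] by simp
    have sub: "(\<lambda>k. mop_zero \<mu>\<^sub>1 \<mu>\<^sub>2 (?K k) (?K k + j (?K k))) \<longlonglongrightarrow> x"
      using LIMSEQ_subseq_LIMSEQ[OF assms(18) strict_mono_o[OF r s(1)]] by (simp add: comp_def)
    note W = quad_weight_log_limit[where K="?K" and j="\<lambda>k. j (?K k)", OF S1[unfolded eq g_def] S2[unfolded eq g_def]
        \<open>b\<^sub>1 < a\<^sub>2\<close> Z(7) orth j sub x u, folded g_def]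
    have "(\<lambda>k. exp (ln (?wt k) / real (?K k))) \<longlonglongrightarrow> exp L"
      unfolding L_def by (intro tendsto_exp W(2))
    \<comment> \<open>Positivity of the weight is essential here: \<open>0 powr s\<close> is 0,
      whereas the left side would be 1.\<close>
    moreover have "exp (ln (?wt k) / real (?K k)) = ?wt k powr (1 / real (?K k))" for k
      using W(1)[of k] by (simp add: powr_def)
    ultimately show "\<exists>s. strict_mono s \<and> (\<lambda>k. \<bar>quad_weight \<mu>\<^sub>1 \<mu>\<^sub>2 \<mu>\<^sub>1 (r (s k)) (r (s k) + j (r (s k)))\<bar> powr (1 / real (r (s k)))) \<longlonglongrightarrow> exp L"
      using s(1) by auto
  qed
  then show ?thesis unfolding L .
qed

end
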